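(* Let $p\ge 5$ be a prime and let $\mathcal{N}=\mathcal{N}(\mathbb{F}_p)$ be the Nottingham group over $\mathbb{F}_p$. Then $\mathrm{diam}(\Delta_{\mathrm{virt}}(\mathcal{N}))=2$. Moreover, if $s\ge1$ and $r$ are integers with $0<r<p^s/2$ and $p\nmid r$, and $\mathcal{Q}^1(s,r)\le\mathcal{N}$ is Ershov's subgroup, then $\mathrm{diam}(\Delta_{\mathrm{virt}}(\mathcal{Q}^1(s,r)))=2$.
   Context: For a topological group $G$, the virtually generating graph $\Gamma_{\mathrm{virt}}(G)$ has vertex set $G$, and two elements $x,y$ are adjacent if and only if the closed subgroup $\langle x,y\rangle$ they topologically generate is open in $G$. A vertex $x$ is isolated if there is no $y\in G$ with $\langle x,y\rangle$ open. The proper virtually generating graph $\Delta_{\mathrm{virt}}(G)$ is obtained from $\Gamma_{\mathrm{virt}}(G)$ by removing its isolated vertices. A statement about the diameter includes that the graph is connected. The Nottingham group $\mathcal{N}(\mathbb{F}_p)$ is the group of formal power series $f=t+\sum_{n\ge1}f_nt^{n+1}\in\mathbb{F}_p[[t]]$ under substitution, with the pro-$p$ topology given by the open normal subgroups $\mathcal{N}_k=\{f\in\mathcal{N}\mid f\equiv t \bmod t^{k+1}\}$, $k\ge1$. For $s\ge1$ and $0<r<p^s/2$ with $p\nmid r$, the group $\mathcal{Q}^1(s,r)$ is the closed subgroup of $\mathcal{N}$ consisting of all power series of the form $$f(t)=\left(\frac{a\,t^r+b}{c\,t^r+d}\right)^{1/r},$$ where $\begin{pmatrix}a&b\\c&d\end{pmatrix}$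 is a matrix of determinant $1$ with entries in $\mathbb{F}_p[[t^{p^s}]]$ congruent to the identity matrix modulo $t^{p^s}$, and the $r$-th root is the one of the form $t+(\text{higher order terms})$. *)

theory Defs
  imports
    "HOL-Analysis.Abstract_Topology"
    "HOL-Algebra.Generated_Groups"
    "HOL-Computational_Algebra.Formal_Power_Series"
    "Graph_Theory.Shortest_Path"
    "Berlekamp_Zassenhaus.Finite_Field"
begin

section \<open>Graph diameter\<close>

text \<open>
  Undirected graphs are represented by symmetric digraphs. Every arc has length 1. If some vertex
  cannot be reached from some other one, the distance is the infimum of the empty set, so the
  diameter is \<open>\<infinity>\<close>; a finite diameter thus includes connectedness. The null graph gets \<open>-\<infinity>\<close>.
\<close>

definition graph_diameter :: "('a, 'b) pre_digraph \<Rightarrow> ereal" where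
  "graph_diameter \<Gamma> = (SUP u \<in> verts \<Gamma>. SUP v \<in> verts \<Gamma>. wf_digraph.\<mu> \<Gamma> (\<lambda>_. 1) u v)"

section \<open>The virtually generating graph\<close>

text \<open>A topological group is given by a group \<open>G\<close> and a topology \<open>T\<close> on its carrier.\<close>

definition top_generate :: "('a, 'm) monoid_scheme \<Rightarrow> 'a topology \<Rightarrow> 'a set \<Rightarrow> 'a set" where
  "top_generate G T S = T closure_of (generate G S)"

definition virt_gen_graph ::
  "('a, 'm) monoid_scheme \<Rightarrow> 'a topology \<Rightarrow> ('a, 'a \<times> 'a) pre_digraph" where
  "virt_gen_graph G T =
    \<lparr> verts = carrier G,
      arcs = {(x, y). x \<in> carrier G \<and> y \<in> carrier G \<and> x \<noteq> y \<and> openin T (top_generate G T {x, y})},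
      tail = fst, head = snd \<rparr>"

definition virt_isolated :: "('a, 'm) monoid_scheme \<Rightarrow> 'a topology \<Rightarrow> 'a \<Rightarrow> bool" where
  "virt_isolated G T x \<longleftrightarrow> \<not> (\<exists>y \<in> carrier G. openin T (top_generate G T {x, y}))"

definition proper_virt_gen_graph ::
  "('a, 'm) monoid_scheme \<Rightarrow> 'a topology \<Rightarrow> ('a, 'a \<times> 'a) pre_digraph" where
  "proper_virt_gen_graph G T =
    (let \<Gamma> = virt_gen_graph G T; V = {x \<in> verts \<Gamma>. \<not> virt_isolated G T x}
     in \<Gamma> \<lparr> verts := V, arcs := {e \<in> arcs \<Gamma>. tail \<Gamma> e \<in> V \<and> head \<Gamma> e \<in> V} \<rparr>)"

section \<open>The Nottingham group\<close>

definition nottingham :: "'a::field fps monoid" where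
  "nottingham =
    \<lparr> carrier = {f. fps_nth f 0 = 0 \<and> fps_nth f 1 = 1},
      monoid.mult = (\<lambda>f g. f oo g),
      one = fps_X \<rparr>"

definition nottingham_filtration :: "nat \<Rightarrow> 'a::field fps set" where
  "nottingham_filtration k = {f \<in> carrier nottingham. fps_X ^ (k + 1) dvd f - fps_X}"

definition nottingham_topology :: "'a::field fps topology" where
  "nottingham_topology =
    topology_generated_by
      {f <#\<^bsub>nottingham\<^esub> nottingham_filtration k |f k. f \<in> carrier nottingham \<and> 1 \<le> k}"

section \<open>Ershov's subgroups\<close>

text \<open>The ring of formal power series in \<open>t\<^sup>q\<close>.\<close>

definition fps_in_power :: "nat \<Rightarrow> 'a::field fps set" where
  "fps_in_power q = {g oo fps_X ^ q |g. True}"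

text \<open>
  Membership of \<open>f\<close> in the Nottingham group selects the \<open>r\<close>-th root with leading term \<open>t\<close>.
  Since the constant term of \<open>d\<close> is 1, the quotient is by a unit of the power series ring.
\<close>

definition ershov_Q1 :: "nat \<Rightarrow> nat \<Rightarrow> 'p::prime_card mod_ring fps set" where
  "ershov_Q1 s r =
    (let q = CARD('p) ^ s in
     {f \<in> carrier nottingham. \<exists>a b c d.
        a \<in> fps_in_power q \<and> b \<in> fps_in_power q \<and> c \<in> fps_in_power q \<and> d \<in> fps_in_power q \<and>
        a * d - b * c = 1 \<and>
        fps_X ^ q dvd a - 1 \<and> fps_X ^ q dvd b \<and> fps_X ^ q dvd c \<and> fps_X ^ q dvd d - 1 \<and>
        f ^ r = (a * fps_X ^ r + b) / (c * fps_X ^ r + d)})"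

end

theory Submission
  imports
    Defs
    "HOL-Number_Theory.Cong"
    "HOL-Library.Product_Plus"
    "HOL-Computational_Algebra.Formal_Laurent_Series"
begin

text \<open>
  Both groups carry a filtration whose layers form a graded Lie algebra: for the Nottingham group it
  has a basis \<open>e\<^sub>1, e\<^sub>2, \<dots>\<close> with \<open>[e\<^sub>k, e\<^sub>l] = (k - l) e\<^sub>k\<^sub>+\<^sub>l\<close>, and for Ershov's group it is
  \<open>sl\<^sub>2(F\<^sub>p) \<otimes> t F\<^sub>p[t]\<close>. A closed subgroup is open as soon as its leading terms fill all large degrees.
  Two elements that commute never generate an open subgroup, so the identity is isolated and \<open>x\<close>,
  \<open>x\<^sup>-\<^sup>1\<close> are not adjacent. It remains to find, for \<open>x\<^sub>1, x\<^sub>2 \<noteq> 1\<close>, a \<open>y\<close> such that \<open>x\<^sub>1, y\<close> and \<open>x\<^sub>2, y\<close>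
  both generate open subgroups.

  In the Nottingham group the set of depths of a subgroup is closed under sums of elements that are
  incongruent mod \<open>p\<close>. If it contains \<open>a\<close>, \<open>b\<close> with \<open>p\<close> dividing none of \<open>a\<close>, \<open>b\<close>, \<open>a - b\<close>, \<open>a + b\<close>, it contains
  all \<open>i a + j b\<close> with \<open>j \<le> i \<le> 2 j\<close>, so it is cofinite once it has no common divisor. The depth of
  \<open>y\<close> is chosen by residues; where the depths of \<open>x\<close>, \<open>y\<close> alone do not suffice, later coefficients of \<open>y\<close>
  are adjusted to give \<open>[x, y]\<close> or \<open>[y, [x, y]]\<close> a suitable depth.

  In Ershov's group let \<open>x\<close>, \<open>y\<close> have leading terms \<open>A t\<^sup>k\<close>, \<open>B t\<^sup>l\<close> with \<open>A\<close>, \<open>B\<close> in general position and \<open>l\<close>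
  an even multiple of \<open>k\<close>. Their brackets fill all large degrees divisible by \<open>k\<close>. Two words of equal
  degree and leading term, but of different degrees in \<open>y\<close>, react differently to a change of \<open>y\<close> one
  degree behind its leading term, so for all but one choice their quotient has a leading term of
  degree \<open>1\<close> mod \<open>k\<close>, which yields all the remaining degrees.
\<close>

section \<open>Groups with a graded filtration\<close>

text \<open>In the Nottingham group the obstacle is that \<open>[e_k, e_l]\<close> vanishes for
  \<open>k\<close>, \<open>l\<close> congruent mod \<open>p\<close>. If \<open>p\<close> divides the
  depth of \<open>x\<close>, leading terms alone give only depths congruent to 0 or to the depth of
  \<open>y\<close>; a new residue must come from a bracket whose expected leading term vanishes. Its
  depth is steered to three times a known residue \<open>u\<close>: the pair \<open>u\<close>,
  \<open>3 u\<close> is admissible as 2, 3, 4 are invertible mod \<open>p\<close>, which uses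
  \<open>p \<ge> 5\<close>. Where one \<open>y\<close> must be adjusted for both \<open>x1\<close>
  and \<open>x2\<close>, the dependence on one free coefficient is affine, so each forbids a single
  value. In Ershov's group the entries are series in \<open>t^q\<close> with \<open>q = p^s\<close>.
  As \<open>g^q = g(t^q)\<close> over the prime field, substituting \<open>g\<close> keeps series in
  \<open>t^q\<close> such, and the matrix of \<open>f oo g\<close> is that of \<open>f\<close> after
  substitution of \<open>g\<close>, times that of \<open>g\<close>. As \<open>f - t\<close> vanishes
  to high order, this twist is invisible in leading brackets. The bound \<open>2 r < q\<close> makes
  1, \<open>t^r\<close>, \<open>t^(2 r)\<close> independent, so \<open>f\<close> determines its
  matrix. Genericity with respect to \<open>x1\<close> and \<open>x2\<close> is tested by a
  polynomial in one parameter of degree at most 4, which has a nonroot as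
  \<open>p \<ge> 5\<close>.\<close>

locale graded_group = group G for G (structure) +
  fixes T :: "'a topology"
    and L :: "nat \<Rightarrow> 'v::ab_group_add \<Rightarrow> 'a \<Rightarrow> bool"
    and br :: "nat \<Rightarrow> nat \<Rightarrow> 'v \<Rightarrow> 'v \<Rightarrow> 'v"
  assumes L_pos: "L k A f \<Longrightarrow> 1 \<le> k"
    and L_carrier: "L k A f \<Longrightarrow> f \<in> carrier G"
    and L_all: "f \<in> carrier G \<Longrightarrow> \<exists>A. L 1 A f"
    and L_mult: "L k A f \<Longrightarrow> L k B g \<Longrightarrow> L k (A + B) (f \<otimes> g)"
    and L_inv: "L k A f \<Longrightarrow> L k (- A) (inv f)"
    and L_Suc: "1 \<le> k \<Longrightarrow> L k 0 f \<longleftrightarrow> (\<exists>A. L (Suc k) A f)"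
    and L_one_unique: "L k A \<one> \<Longrightarrow> A = 0"
    and L_surj: "1 \<le> k \<Longrightarrow> \<exists>f. L k A f"
    and L_comm: "L k A f \<Longrightarrow> L l B g \<Longrightarrow> L (k + l) (br k l A B) (f \<otimes> g \<otimes> inv f \<otimes> inv g)"
    and L_sep: "f \<in> carrier G \<Longrightarrow> (\<And>k. 1 \<le> k \<Longrightarrow> \<exists>A. L k A f) \<Longrightarrow> f = \<one>"
    and br_add_left: "br k l (A + A') B = br k l A B + br k l A' B"
    and br_add_right: "br k l A (B + B') = br k l A B + br k l A B'"
    and br_nonzero: "\<exists>i\<ge>k. \<exists>j\<ge>k. \<exists>A B. br i j A B \<noteq> 0"
    and no_2_torsion: "\<exists>A::'v. A + A \<noteq> 0"
    and open_iff: "openin T U \<longleftrightarrow>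
      U \<subseteq> carrier G \<and> (\<forall>x\<in>U. \<exists>k\<ge>1. \<forall>g A. L k A g \<longrightarrow> x \<otimes> g \<in> U)"
begin

definition cm :: "'a \<Rightarrow> 'a \<Rightarrow> 'a" where "cm f g = f \<otimes> g \<otimes> inv f \<otimes> inv g"

lemma cm_closed [simp]: "f \<in> carrier G \<Longrightarrow> g \<in> carrier G \<Longrightarrow> cm f g \<in> carrier G"
  by (simp add: cm_def)

lemma L_cm: "L k A f \<Longrightarrow> L l B g \<Longrightarrow> L (k + l) (br k l A B) (cm f g)"
  unfolding cm_def by (rule L_comm)

lemma topspace_T: "topspace T = carrier G"
proof
  show "topspace T \<subseteq> carrier G" using openin_topspace[of T] by (simp only: open_iff)
  have "openin T (carrier G)"
    unfolding open_iff by (auto intro!: exI[of _ 1] dest: L_carrier)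
  then show "carrier G \<subseteq> topspace T" by (rule openin_subset)
qed

text \<open>\<open>L k A f\<close> reads: \<open>f\<close> lies in the \<open>k\<close>-th
  filtration term and has class \<open>A\<close> in its layer. The class 0 is allowed and by
  \<open>L_Suc\<close> means lying in the next term, so the identity climbs through all
  terms.\<close>

lemma L_one: "1 \<le> k \<Longrightarrow> L k 0 \<one>"
proof (induction k rule: nat_induct_at_least)
  case base
  obtain A where "L 1 A \<one>" using L_all by blast
  then show ?case using L_one_unique by metis
next
  case (Suc k)
  then obtain A where "L (Suc k) A \<one>" using L_Suc by metis
  then show ?case using L_one_unique by metis
qed

lemma L_unique: "L k A f \<Longrightarrow> L k B f \<Longrightarrow> A = B"
proof -
  assume a: "L k A f" "L k B f"
  have "L k (A + - B) (f \<otimes> inv f)" by (intro L_mult L_inv a)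
  then have "L k (A - B) \<one>" using L_carrier[OF a(1)] by simp
  from L_one_unique[OF this] show ?thesis by simp
qed

lemma L_lower: "L k A f \<Longrightarrow> 1 \<le> j \<Longrightarrow> j < k \<Longrightarrow> L j 0 f"
proof (induction "k - Suc j" arbitrary: j)
  case 0
  then have "k = Suc j" by simp
  then show ?case using L_Suc 0 by blast
next
  case (Suc d)
  have "L (Suc j) 0 f" by (rule Suc.hyps(1)) (use Suc in auto)
  then show ?case using L_Suc Suc by blast
qed

lemma L_lower_ex: "L k A f \<Longrightarrow> 1 \<le> j \<Longrightarrow> j \<le> k \<Longrightarrow> \<exists>A. L j A f"
  using L_lower by (cases "j = k") (blast, metis le_neq_implies_less)

lemma br_zero_left [simp]: "br k l 0 B = 0"
  using br_add_left[of k l 0 0 B] by simp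

lemma br_zero_right [simp]: "br k l A 0 = 0"
  using br_add_right[of k l A 0 0] by simp

text \<open>The commutator of \<open>g\<close> and \<open>f\<close> lies at least one step deeper
  than \<open>f\<close>, so conjugation does not move leading terms.\<close>

lemma L_conj:
  assumes f: "L k A f" and g: "g \<in> carrier G"
  shows "L k A (g \<otimes> f \<otimes> inv g)"
proof -
  note fc = L_carrier[OF f] and k = L_pos[OF f]
  obtain B where B: "L 1 B g" using L_all[OF g] by blast
  have "L (1 + k) (br 1 k B A) (cm g f)" by (rule L_cm[OF B f])
  then have "L k 0 (cm g f)" using L_lower k by simp
  from L_mult[OF this f] have "L k A (cm g f \<otimes> f)" by simp
  also have "cm g f \<otimes> f = g \<otimes> f \<otimes> inv g" using g fc by (simp add: cm_def m_assoc)
  finally show ?thesis .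
qed

text \<open>The layers are mere additive groups here, so the \<open>n\<close>-fold sum of
  \<open>A\<close> is written as an iterate.\<close>

lemma L_multiple: "L k A f \<Longrightarrow> L k (((+) A ^^ n) 0) (f [^] n)"
proof (induction n)
  case 0
  then show ?case using L_one L_pos by simp
next
  case (Suc n)
  have "L k (((+) A ^^ n) 0 + A) (f [^] n \<otimes> f)" using Suc L_mult by blast
  then show ?case by (simp add: add.commute[of _ A])
qed

lemma depth_exists:
  assumes f: "f \<in> carrier G" "f \<noteq> \<one>"
  shows "\<exists>k A. L k A f \<and> A \<noteq> 0"
proof (rule ccontr)
  assume no: "\<not> ?thesis"
  have "\<exists>A. L k A f" if "1 \<le> k" for k
    using that
  proof (induction k rule: nat_induct_at_least)
    case base
    then show ?case using L_all f by blast
  next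
    case (Suc k)
    then obtain A where "L k A f" by blast
    with no have "L k 0 f" by blast
    with L_Suc Suc show ?case by blast
  qed
  with L_sep f show False by blast
qed

text \<open>The commutator obeys a Leibniz rule to first order. The exact expansion of
  \<open>cm (u \<otimes> d) (v \<otimes> e)\<close> consists of conjugates of \<open>cm d v\<close>,
  \<open>cm d e\<close>, \<open>cm u e\<close> and of \<open>cm u v\<close> itself;
  \<open>cm d e\<close> has depth \<open>n + m + 2 i\<close> and drops out.\<close>

lemma perturb:
  assumes u: "L n E u" and v: "L m K v" and d: "L (n + i) F d" and e: "L (m + i) H e" and i: "1 \<le> i"
  shows "L (n + m + i) (br (n + i) m F K + br n (m + i) E H) (cm (u \<otimes> d) (v \<otimes> e) \<otimes> inv (cm u v))"
proof -
  note c[simp] = u[THEN L_carrier] v[THEN L_carrier] d[THEN L_carrier] e[THEN L_carrier]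
  have n: "1 \<le> n" "1 \<le> m" using u v L_pos by auto
  have "L (n + i + (m + i)) (br (n + i) (m + i) F H) (cm d e)" by (rule L_cm[OF d e])
  then have de: "L (n + m + i) 0 (cm d e)" using L_lower i n by simp
  have "L (n + i + m) (br (n + i) m F K) (cm d v)" by (rule L_cm[OF d v])
  then have dv: "L (n + m + i) (br (n + i) m F K) (cm d v)" by (simp add: ac_simps)
  have "L (n + m + i) (br (n + i) m F K + 0) (cm d v \<otimes> (v \<otimes> cm d e \<otimes> inv v))"
    by (rule L_mult[OF dv L_conj[OF de c(2)]])
  from L_conj[OF this c(1)]
  have X1: "L (n + m + i) (br (n + i) m F K) (u \<otimes> (cm d v \<otimes> (v \<otimes> cm d e \<otimes> inv v)) \<otimes> inv u)"
    by simp
  have "L (n + (m + i)) (br n (m + i) E H) (cm u e)" by (rule L_cm[OF u e])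
  then have "L (n + m + i) (br n (m + i) E H) (cm u e)" by (simp add: ac_simps)
  from L_conj[OF this c(2)]
  have "L (n + m + i) (br n (m + i) E H) (v \<otimes> cm u e \<otimes> inv v)" .
  from L_conj[OF this, of "cm u v"]
  have X2: "L (n + m + i) (br n (m + i) E H) (cm u v \<otimes> (v \<otimes> cm u e \<otimes> inv v) \<otimes> inv (cm u v))"
    by simp
  have ia: "inv a \<otimes> (a \<otimes> b) = b" "a \<otimes> (inv a \<otimes> b) = b" if "a \<in> carrier G" "b \<in> carrier G" for a b
    using that by (simp_all flip: m_assoc)
  have "cm (u \<otimes> d) (v \<otimes> e) =
      (u \<otimes> (cm d v \<otimes> (v \<otimes> cm d e \<otimes> inv v)) \<otimes> inv u) \<otimes> (cm u v \<otimes> (v \<otimes> cm u e \<otimes> inv v))"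
    by (simp add: cm_def m_assoc inv_mult_group ia)
  then have "cm (u \<otimes> d) (v \<otimes> e) \<otimes> inv (cm u v) =
      (u \<otimes> (cm d v \<otimes> (v \<otimes> cm d e \<otimes> inv v)) \<otimes> inv u) \<otimes>
      (cm u v \<otimes> (v \<otimes> cm u e \<otimes> inv v) \<otimes> inv (cm u v))"
    by (simp add: m_assoc)
  then show ?thesis using L_mult[OF X1 X2] by simp
qed

subsection \<open>Leading terms of subgroups\<close>

definition lead :: "'a set \<Rightarrow> nat \<Rightarrow> 'v set" where
  "lead H k = {A. \<exists>f\<in>H. L k A f}"

lemma leadI: "f \<in> H \<Longrightarrow> L k A f \<Longrightarrow> A \<in> lead H k"
  by (auto simp: lead_def)

lemma lead_add:
  assumes H: "subgroup H G" and "A \<in> lead H k" "B \<in> lead H k"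
  shows "A + B \<in> lead H k"
proof -
  obtain f g where "f \<in> H" "L k A f" "g \<in> H" "L k B g" using assms(2,3) unfolding lead_def by auto
  then show ?thesis using L_mult subgroup.m_closed[OF H] by (intro leadI[of "f \<otimes> g"]) auto
qed

lemma cm_in_subgroup: "subgroup H G \<Longrightarrow> f \<in> H \<Longrightarrow> g \<in> H \<Longrightarrow> cm f g \<in> H"
  unfolding cm_def by (simp add: subgroup.m_closed subgroup.m_inv_closed)

lemma lead_br:
  assumes H: "subgroup H G" and "A \<in> lead H k" "B \<in> lead H l"
  shows "br k l A B \<in> lead H (k + l)"
proof -
  obtain f g where "f \<in> H" "L k A f" "g \<in> H" "L l B g" using assms(2,3) unfolding lead_def by auto
  then show ?thesis using L_cm cm_in_subgroup[OF H] by (intro leadI[of "cm f g"]) auto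
qed

lemma lead_multiple:
  assumes "subgroup H G" "A \<in> lead H k"
  shows "((+) A ^^ n) 0 \<in> lead H k"
proof -
  obtain f where f: "f \<in> H" "L k A f" using assms(2) unfolding lead_def by blast
  have "f [^] n \<in> H"
    by (induction n) (use f assms(1) in \<open>auto intro: subgroup.m_closed subgroup.one_closed\<close>)
  then show ?thesis using L_multiple[OF f(2)] by (rule leadI)
qed

text \<open>The cosets of the filtration terms form a neighbourhood basis, so the closure consists
  of the elements that \<open>H\<close> approximates to every depth.\<close>

lemma in_closure_iff:
  assumes "H \<subseteq> carrier G"
  shows "x \<in> T closure_of H \<longleftrightarrow>
    x \<in> carrier G \<and> (\<forall>k\<ge>1. \<exists>h\<in>H. \<exists>A. L k A (inv x \<otimes> h))"
proof (intro iffI conjI allI impI)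
  assume x: "x \<in> T closure_of H"
  show xc: "x \<in> carrier G" using x closure_of_subset_topspace[of T H] unfolding topspace_T by auto
  fix k :: nat assume k: "1 \<le> k"
  have cl: "\<exists>y. y \<in> H \<and> y \<in> U" if "x \<in> U" "openin T U" for U
    using x that unfolding in_closure_of by blast
  let ?U = "{x \<otimes> g |g A. L k A g}"
  have "openin T ?U"
    unfolding open_iff
  proof (intro conjI ballI)
    show "?U \<subseteq> carrier G" using xc L_carrier by auto
    fix y assume "y \<in> ?U"
    then obtain g A where g: "y = x \<otimes> g" "L k A g" by blast
    have "y \<otimes> g' \<in> ?U" if "L k A' g'" for g' A'
      using L_mult[OF g(2) that] g that xc L_carrier by (fastforce simp: m_assoc)
    then show "\<exists>k\<ge>1. \<forall>g A. L k A g \<longrightarrow> y \<otimes> g \<in> ?U" using k by blast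
  qed
  moreover have "x \<in> ?U" using L_one[OF k] xc by force
  ultimately obtain h g A where "h \<in> H" and h: "h = x \<otimes> g" "L k A g" using cl[of ?U] by auto
  moreover have "inv x \<otimes> (x \<otimes> g) = g" using xc L_carrier[OF h(2)] by (simp flip: m_assoc)
  ultimately show "\<exists>h\<in>H. \<exists>A. L k A (inv x \<otimes> h)"
    by (intro bexI[of _ h] exI[of _ A]) auto
next
  assume r: "x \<in> carrier G \<and> (\<forall>k\<ge>1. \<exists>h\<in>H. \<exists>A. L k A (inv x \<otimes> h))"
  show "x \<in> T closure_of H"
    unfolding in_closure_of topspace_T
  proof (intro conjI allI impI)
    show "x \<in> carrier G" using r by simp
    fix U assume "x \<in> U \<and> openin T U"
    then obtain k where k: "k \<ge> 1" "\<And>g A. L k A g \<Longrightarrow> x \<otimes> g \<in> U" unfolding open_iff by blast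
    then obtain h A where h: "h \<in> H" "L k A (inv x \<otimes> h)" using r by blast
    have "h \<in> carrier G" using h(1) assms by blast
    with r have "x \<otimes> (inv x \<otimes> h) = h" by (simp flip: m_assoc)
    then show "\<exists>y. y \<in> H \<and> y \<in> U" using k(2)[OF h(2)] h(1) by (intro exI[of _ h]) simp
  qed
qed

text \<open>Successive approximation: an element of a deep filtration term is matched by
  \<open>H\<close> degree by degree, the leading term of each error being cancelled by an element of
  \<open>H\<close>. The closure thus absorbs a whole filtration term.\<close>

lemma open_closure:
  assumes H: "subgroup H G" and K: "\<And>k. K \<le> k \<Longrightarrow> lead H k = UNIV"
  shows "openin T (T closure_of H)"
proof -
  \<comment> \<open>The successor guarantees an index of at least 1, which \<open>L_Suc\<close> and
    \<open>open_iff\<close> demand.\<close>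
  define K' where "K' = Suc K"
  note Hc = subgroup.subset[OF H]
  have appr: "\<exists>h\<in>H. \<exists>A. L (K' + j) A (inv g \<otimes> h)" if g: "L K' A0 g" for g A0 j
  proof (induction j)
    case 0
    show ?case using L_inv[OF g] L_carrier[OF g] subgroup.one_closed[OF H] by force
  next
    case (Suc j)
    then obtain h A where h: "h \<in> H" "L (K' + j) A (inv g \<otimes> h)" by blast
    have "- A \<in> lead H (K' + j)" using K K'_def by simp
    then obtain h' where h': "h' \<in> H" "L (K' + j) (- A) h'" unfolding lead_def by blast
    have "L (K' + j) (A + - A) (inv g \<otimes> h \<otimes> h')" by (rule L_mult[OF h(2) h'(2)])
    moreover have "inv g \<otimes> h \<otimes> h' = inv g \<otimes> (h \<otimes> h')"
      using L_carrier[OF g] h h' Hc by (simp add: m_assoc subsetD)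
    ultimately have "L (K' + j) 0 (inv g \<otimes> (h \<otimes> h'))" by simp
    then have "\<exists>A. L (K' + Suc j) A (inv g \<otimes> (h \<otimes> h'))"
      using L_Suc[of "K' + j"] K'_def by simp
    then show ?case using h h' subgroup.m_closed[OF H] by blast
  qed
  have appr': "\<exists>h\<in>H. \<exists>A. L k A (inv g \<otimes> h)" if g: "L K' A0 g" and "1 \<le> k" for g A0 k
    using appr[OF g, of k] L_lower_ex[of "K' + k" _ _ k] that by force
  show ?thesis
    unfolding open_iff
  proof (intro conjI ballI)
    show "T closure_of H \<subseteq> carrier G" using closure_of_subset_topspace[of T H] unfolding topspace_T .
    fix x assume x: "x \<in> T closure_of H"
    have xc: "x \<in> carrier G" using x in_closure_iff[OF Hc] by blast
    have "x \<otimes> g \<in> T closure_of H" if g: "L K' A g" for g A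
      unfolding in_closure_iff[OF Hc]
    proof (intro conjI allI impI)
      note gc = L_carrier[OF g]
      show "x \<otimes> g \<in> carrier G" using xc gc by simp
      fix k :: nat assume k: "1 \<le> k"
      obtain h B where h: "h \<in> H" "L k B (inv x \<otimes> h)" using x k in_closure_iff[OF Hc] by blast
      obtain h' B' where h': "h' \<in> H" "L k B' (inv g \<otimes> h')" using appr'[OF g k] by blast
      have hc: "h \<in> carrier G" "h' \<in> carrier G" using h h' Hc by auto
      \<comment> \<open>The error of \<open>h\<close> against \<open>x\<close> becomes an error
        against \<open>x \<otimes> g\<close> after conjugation, which leaves its depth unchanged;
        the error of \<open>h'\<close> against \<open>g\<close> is then multiplied on.\<close>
      have "L k B (inv g \<otimes> (inv x \<otimes> h) \<otimes> inv (inv g))" by (rule L_conj[OF h(2)]) (use gc in simp)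
      then have "L k (B + B') (inv g \<otimes> (inv x \<otimes> h) \<otimes> inv (inv g) \<otimes> (inv g \<otimes> h'))"
        using h'(2) L_mult by blast
      moreover have "inv g \<otimes> (inv x \<otimes> h) \<otimes> inv (inv g) \<otimes> (inv g \<otimes> h') = inv (x \<otimes> g) \<otimes> (h \<otimes> h')"
      proof -
        have "g \<otimes> (inv g \<otimes> h') = h'" using gc hc by (simp flip: m_assoc)
        then show ?thesis using gc xc hc by (simp add: m_assoc inv_mult_group)
      qed
      ultimately show "\<exists>h\<in>H. \<exists>A. L k A (inv (x \<otimes> g) \<otimes> h)"
        using h h' subgroup.m_closed[OF H] by metis
    qed
    then show "\<exists>k\<ge>1. \<forall>g A. L k A g \<longrightarrow> x \<otimes> g \<in> T closure_of H"
      by (intro exI[of _ K']) (auto simp: K'_def)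
  qed
qed

lemma generate_commute:
  assumes S: "S \<subseteq> carrier G" and c: "\<And>x y. x \<in> S \<Longrightarrow> y \<in> S \<Longrightarrow> x \<otimes> y = y \<otimes> x"
    and g: "g \<in> generate G S" and h: "h \<in> generate G S"
  shows "g \<otimes> h = h \<otimes> g"
proof -
  \<comment> \<open>Applied twice below: generators commute with \<open>g\<close>, hence so does
    everything they generate.\<close>
  have gen: "a \<otimes> x = x \<otimes> a"
    if "a \<in> generate G S" "x \<in> carrier G" "\<And>y. y \<in> S \<Longrightarrow> y \<otimes> x = x \<otimes> y" for a x
    using that(1)
  proof (induction rule: generate.induct)
    case one
    then show ?case using that by simp
  next
    case (incl h)
    then show ?case using that by blast
  next
    case (inv h)
    then have "h \<in> carrier G" using S by blast
    then show ?case using that(2) that(3)[OF inv]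
      by (metis inv_closed inv_solve_left inv_solve_right m_assoc m_closed)
  next
    case (eng h1 h2)
    then have "h1 \<in> carrier G" "h2 \<in> carrier G" using S generate_in_carrier by blast+
    then show ?case using eng that(2) by (metis m_assoc)
  qed
  have gc: "g \<in> carrier G" using g S generate_in_carrier by blast
  have "y \<otimes> g = g \<otimes> y" if "y \<in> S" for y
    using gen[OF g, of y] c that S by (metis subsetD)
  from gen[OF h gc this] show ?thesis by simp
qed

text \<open>Were the closure open, it would contain a filtration term, so the abelian group
  \<open>H\<close> would show every class in all large degrees. By \<open>br_nonzero\<close> two of
  its elements would then have a nontrivial commutator.\<close>

lemma commute_not_open:
  assumes x: "x \<in> carrier G" "y \<in> carrier G" and c: "x \<otimes> y = y \<otimes> x"
  shows "\<not> openin T (top_generate G T {x, y})"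
proof
  define H where "H = generate G {x, y}"
  have H: "subgroup H G" unfolding H_def by (rule generate_is_subgroup) (use x in auto)
  note Hc = subgroup.subset[OF H]
  assume "openin T (top_generate G T {x, y})"
  then have op: "openin T (T closure_of H)" unfolding top_generate_def H_def .
  have "\<one> \<in> T closure_of H"
    using closure_of_subset[of H T] Hc topspace_T subgroup.one_closed[OF H] by auto
  then obtain k where k: "1 \<le> k" "\<And>g A. L k A g \<Longrightarrow> \<one> \<otimes> g \<in> T closure_of H"
    using op unfolding open_iff by blast
  obtain i j A B where ij: "i \<ge> k" "j \<ge> k" "br i j A B \<noteq> 0" using br_nonzero by blast
  \<comment> \<open>Agreement one degree beyond \<open>i\<close> transfers the leading term from the
    closure to an element of \<open>H\<close> itself.\<close>
  have ap: "\<exists>h\<in>H. L i A h" if i: "i \<ge> k" for i A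
  proof -
    obtain f where f: "L i A f" using L_surj i k by (meson le_trans)
    obtain A' where "L k A' f" using L_lower_ex[OF f] k i by blast
    then have "f \<in> T closure_of H" using k(2) L_carrier[OF f] by fastforce
    then obtain h B where h: "h \<in> H" "L (Suc i) B (inv f \<otimes> h)"
      unfolding in_closure_iff[OF Hc] by (metis le_add1 plus_1_eq_Suc)
    then have "L i 0 (inv f \<otimes> h)" using L_Suc[of i] i k by auto
    with L_mult[OF f this] have "L i A (f \<otimes> (inv f \<otimes> h))" by simp
    moreover have "f \<otimes> (inv f \<otimes> h) = h" using L_carrier[OF f] h Hc by (simp flip: m_assoc add: subsetD)
    ultimately show ?thesis using h by auto
  qed
  obtain f where f: "f \<in> H" "L i A f" using ap ij by blast
  obtain g where g: "g \<in> H" "L j B g" using ap ij by blast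
  have fg: "f \<otimes> g = g \<otimes> f"
    by (rule generate_commute[of "{x, y}"]) (use f g x c H_def in auto)
  have fgc: "f \<in> carrier G" "g \<in> carrier G" using f g Hc by auto
  have "cm f g = \<one>"
  proof -
    have "cm f g = g \<otimes> f \<otimes> inv f \<otimes> inv g" unfolding cm_def fg ..
    also have "\<dots> = \<one>" using fgc by (simp add: m_assoc)
    finally show ?thesis .
  qed
  with L_cm[OF f(2) g(2)] have "br i j A B = 0" using L_one_unique by simp
  with ij show False by simp
qed

subsection \<open>The diameter\<close>

text \<open>The hypothesis with \<open>x1 = x2\<close> shows that only the identity is isolated. The
  lower bound comes from \<open>x\<close> and its inverse: they commute, hence are not adjacent, and
  \<open>no_2_torsion\<close> keeps them distinct.\<close>

lemma diameter_2:
  assumes common: "\<And>x1 x2. x1 \<in> carrier G \<Longrightarrow> x1 \<noteq> \<one> \<Longrightarrow> x2 \<in> carrier G \<Longrightarrow> x2 \<noteq> \<one> \<Longrightarrow>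
      \<exists>y\<in>carrier G. openin T (top_generate G T {x1, y}) \<and> openin T (top_generate G T {x2, y})"
  shows "graph_diameter (proper_virt_gen_graph G T) = 2"
proof -
  let ?O = "\<lambda>x y. openin T (top_generate G T {x, y})"
  define \<Gamma> where "\<Gamma> = proper_virt_gen_graph G T"
  have isol: "virt_isolated G T x \<longleftrightarrow> x = \<one>" if "x \<in> carrier G" for x
  proof
    assume "virt_isolated G T x"
    then show "x = \<one>" using common[OF that _ that] unfolding virt_isolated_def by blast
  next
    assume "x = \<one>"
    then show "virt_isolated G T x" using commute_not_open[of \<one>] unfolding virt_isolated_def by simp
  qed
  have V: "verts \<Gamma> = carrier G - {\<one>}"
    using isol by (auto simp: \<Gamma>_def proper_virt_gen_graph_def virt_gen_graph_def Let_def)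
  have A: "arcs \<Gamma> = {(x, y). x \<in> carrier G - {\<one>} \<and> y \<in> carrier G - {\<one>} \<and> x \<noteq> y \<and> ?O x y}"
    using isol by (auto simp: \<Gamma>_def proper_virt_gen_graph_def virt_gen_graph_def Let_def)
  have th: "tail \<Gamma> = fst" "head \<Gamma> = snd"
    by (auto simp: \<Gamma>_def proper_virt_gen_graph_def virt_gen_graph_def Let_def)
  interpret wf_digraph \<Gamma>
    by standard (auto simp: V A th)
  have len: "awalk_cost (\<lambda>_. 1) p = real (length p)" for p :: "('a \<times> 'a) list"
    by (induction p) auto
  have le: "\<mu> (\<lambda>_. 1) u v \<le> 2" if uv: "u \<in> verts \<Gamma>" "v \<in> verts \<Gamma>" for u v
  proof -
    have "\<exists>p. awalk u p v \<and> length p \<le> 2"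
    proof (cases "u = v \<or> (u, v) \<in> arcs \<Gamma>")
      case True
      then show ?thesis
      proof
        assume "u = v"
        then show ?thesis using uv by (intro exI[of _ "[]"]) (auto simp: awalk_def)
      next
        assume "(u, v) \<in> arcs \<Gamma>"
        then show ?thesis using uv by (intro exI[of _ "[(u, v)]"]) (auto simp: awalk_def th)
      qed
    next
      case False
      obtain y where y: "y \<in> carrier G" "?O u y" "?O v y" using common uv V by blast
      have comm: "?O y v" using y by (simp add: insert_commute)
      have uc: "u \<in> carrier G" "v \<in> carrier G" using uv V by auto
      \<comment> \<open>If \<open>y\<close> were \<open>u\<close> or \<open>v\<close>, then
        \<open>u\<close> and \<open>v\<close> would be adjacent.\<close>
      have "\<not> ?O u v" using False uv V A by auto
      then have yu: "y \<noteq> u" "y \<noteq> v" using y(2) y(3) comm by metis+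
      have y1: "y \<noteq> \<one>" using y(2) commute_not_open[of u \<one>] uc by auto
      have un: "u \<noteq> \<one>" "v \<noteq> \<one>" using uv V by auto
      have a1: "(u, y) \<in> arcs \<Gamma>"
        unfolding A using uc(1) un(1) y(1) y1 yu(1) y(2) by (intro CollectI) (simp add: eq_commute)
      have a2: "(y, v) \<in> arcs \<Gamma>"
        unfolding A using uc(2) un(2) y(1) y1 yu(2) comm by (intro CollectI) simp
      show ?thesis
        using uv a1 a2 by (intro exI[of _ "[(u, y), (y, v)]"]) (simp add: awalk_def th)
    qed
    then obtain p where p: "awalk u p v" "length p \<le> 2" by blast
    have "\<mu> (\<lambda>_. 1) u v \<le> awalk_cost (\<lambda>_. 1) p" by (rule min_cost_le_walk_cost[OF p(1)])
    also have "\<dots> \<le> 2" using p(2) len by simp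
    finally show ?thesis .
  qed
  obtain A0 :: 'v where A0: "A0 + A0 \<noteq> 0" using no_2_torsion by blast
  obtain x where x: "L 1 A0 x" using L_surj[of 1] by blast
  note xc = L_carrier[OF x]
  have xi: "x \<noteq> inv x"
  proof
    assume "x = inv x"
    with x L_inv[OF x] have "A0 = - A0" using L_unique by metis
    then have "A0 + A0 = A0 + - A0" by simp
    with A0 show False by simp
  qed
  have x1: "x \<noteq> \<one>" using x L_one_unique[of 1 A0] A0 by auto
  have ix1: "inv x \<noteq> \<one>" using x1 xc inv_eq_1_iff by blast
  have nO: "\<not> ?O x (inv x)" using commute_not_open[of x "inv x"] xc by simp
  have "2 \<le> ereal (awalk_cost (\<lambda>_. 1) p)" if p: "awalk x p (inv x)" for p
  proof -
    have "length p \<ge> 2"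
    proof (rule ccontr)
      assume "\<not> length p \<ge> 2"
      then consider "p = []" | a where "p = [a]" by (cases p) (auto simp: Suc_le_eq)
      then show False
      proof cases
        case 1
        then show False using p xi by (simp add: awalk_def)
      next
        case 2
        then have "(x, inv x) \<in> arcs \<Gamma>" using p by (cases a) (simp add: awalk_def th)
        then show False using nO unfolding A by simp
      qed
    qed
    then show ?thesis by (simp add: len)
  qed
  then have ge: "2 \<le> \<mu> (\<lambda>_. 1) x (inv x)"
    unfolding \<mu>_def by (intro INF_greatest) simp
  have xv: "x \<in> verts \<Gamma>" "inv x \<in> verts \<Gamma>"
    using V xc x1 ix1 by auto
  have "graph_diameter \<Gamma> = 2"
    unfolding graph_diameter_def
  proof (rule antisym)
    show "(SUP u\<in>verts \<Gamma>. SUP v\<in>verts \<Gamma>. \<mu> (\<lambda>_. 1) u v) \<le> 2"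
      using le by (intro SUP_least)
    show "2 \<le> (SUP u\<in>verts \<Gamma>. SUP v\<in>verts \<Gamma>. \<mu> (\<lambda>_. 1) u v)"
      using ge by (rule SUP_upper2[OF xv(1) SUP_upper2[OF xv(2)]])
  qed
  then show ?thesis by (simp add: \<Gamma>_def)
qed

end

section \<open>Sets of depths closed under incongruent sums\<close>

locale depth_set =
  fixes p :: nat and D :: "nat set"
  assumes p: "prime p" "5 \<le> p"
    and closed: "u \<in> D \<Longrightarrow> v \<in> D \<Longrightarrow> \<not> int p dvd int u - int v \<Longrightarrow> u + v \<in> D"
begin

lemma p_dvd_double: "int p dvd 2 * x \<Longrightarrow> int p dvd x"
  using p prime_dvd_mult_iff[of "int p" 2 x] zdvd_imp_le[of "int p" 2] by auto

text \<open>If both splittings of \<open>n\<close> had congruent summands, both differences would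
  vanish mod \<open>p\<close>, and so would the difference of the differences.\<close>

lemma one_of_two_sums:
  assumes "u \<in> D" "v \<in> D" "u' \<in> D" "v' \<in> D" "u + v = n" "u' + v' = n"
    and "\<not> int p dvd (int u - int v) - (int u' - int v')"
  shows "n \<in> D"
  using assms closed by (metis dvd_diff)

text \<open>A staircase along the diagonal: each new point has two splittings into earlier ones
  whose differences differ by \<open>2 a\<close> or \<open>2 b\<close> up to sign, so one of them is
  always permitted.\<close>

lemma diagonal:
  assumes a: "a \<in> D" and b: "b \<in> D" and na: "\<not> int p dvd int a" and nb: "\<not> int p dvd int b"
    and ab: "\<not> int p dvd int a - int b" and k: "1 \<le> k"
  shows "k * a + k * b \<in> D \<and> (k + 1) * a + k * b \<in> D \<and> k * a + (k + 1) * b \<in> D"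
  using k
proof (induction k rule: nat_induct_at_least)
  case base
  have 1: "a + b \<in> D" using closed[OF a b ab] .
  moreover have "(a + b) + a \<in> D" by (rule closed[OF 1 a]) (use nb in simp)
  moreover have "(a + b) + b \<in> D" by (rule closed[OF 1 b]) (use na in simp)
  ultimately show ?case by (simp add: algebra_simps)
next
  case (Suc k)
  have ab1: "a + b \<in> D" using closed[OF a b ab] .
  note k1 = Suc.IH[THEN conjunct1] and k2 = Suc.IH[THEN conjunct2, THEN conjunct1]
    and k3 = Suc.IH[THEN conjunct2, THEN conjunct2]
  have d1: "Suc k * a + Suc k * b \<in> D"
  proof (rule one_of_two_sums[OF k1 ab1 k2 b])
    have "(int (k * a + k * b) - int (a + b)) - (int ((k + 1) * a + k * b) - int b) = - (2 * int a)"
      by (simp add: algebra_simps)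
    then show "\<not> int p dvd (int (k * a + k * b) - int (a + b)) - (int ((k + 1) * a + k * b) - int b)"
      using na p_dvd_double by (metis dvd_minus_iff)
  qed (simp_all add: algebra_simps)
  have d2: "(Suc k + 1) * a + Suc k * b \<in> D"
  proof (rule one_of_two_sums[OF d1 a k2 ab1])
    have "(int (Suc k * a + Suc k * b) - int a) - (int ((k + 1) * a + k * b) - int (a + b)) = 2 * int b"
      by (simp add: algebra_simps)
    then show "\<not> int p dvd (int (Suc k * a + Suc k * b) - int a) - (int ((k + 1) * a + k * b) - int (a + b))"
      using nb p_dvd_double by metis
  qed (simp_all add: algebra_simps)
  have d3: "Suc k * a + (Suc k + 1) * b \<in> D"
  proof (rule one_of_two_sums[OF d1 b k3 ab1])
    have "(int (Suc k * a + Suc k * b) - int b) - (int (k * a + (k + 1) * b) - int (a + b)) = 2 * int a"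
      by (simp add: algebra_simps)
    then show "\<not> int p dvd (int (Suc k * a + Suc k * b) - int b) - (int (k * a + (k + 1) * b) - int (a + b))"
      using na p_dvd_double by metis
  qed (simp_all add: algebra_simps)
  show ?case using d1 d2 d3 by simp
qed

text \<open>Off the diagonal the two available splittings have differences that differ by
  \<open>2 (a + b)\<close> up to sign; hence the condition on \<open>a + b\<close>.\<close>

lemma cone:
  assumes a: "a \<in> D" and b: "b \<in> D" and na: "\<not> int p dvd int a" and nb: "\<not> int p dvd int b"
    and ab: "\<not> int p dvd int a - int b" and ab': "\<not> int p dvd int a + int b"
    and jk: "j \<le> k" "1 \<le> k"
  shows "(k + j) * a + k * b \<in> D"
  using jk
proof (induction j arbitrary: k)
  case 0
  then show ?case using diagonal[OF a b na nb ab] by simp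
next
  case (Suc j)
  have one: "(l + 1) * a + l * b \<in> D" for l
    using diagonal[OF a b na nb ab, of l] a by (cases "l = 0") auto
  show ?case
  proof (cases "j = 0")
    case True
    then show ?thesis using one[of k] by simp
  next
    case False
    define l where "l = k - Suc j"
    have k: "k = l + Suc j" using Suc.prems l_def by simp
    show ?thesis
    proof (rule one_of_two_sums[OF Suc.IH[of j] one[of "Suc l"] Suc.IH[of "Suc j"] one[of l]])
      have "(int ((j + j) * a + j * b) - int ((Suc l + 1) * a + Suc l * b))
          - (int ((Suc j + j) * a + Suc j * b) - int ((l + 1) * a + l * b)) = - (2 * (int a + int b))"
        by (simp add: algebra_simps)
      then show "\<not> int p dvd (int ((j + j) * a + j * b) - int ((Suc l + 1) * a + Suc l * b))
          - (int ((Suc j + j) * a + Suc j * b) - int ((l + 1) * a + l * b))"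
        using ab' p_dvd_double by (metis dvd_minus_iff)
    qed (use False in \<open>simp_all add: k algebra_simps\<close>)
  qed
qed

text \<open>Solving \<open>a e = n\<close> modulo \<open>a + b\<close> with \<open>e < a + b\<close>
  gives \<open>n = a e + (a + b) k\<close>. The size of \<open>n\<close> forces
  \<open>k \<ge> a + b > e\<close>, so \<open>n = (k + e) a + k b\<close> lies in the cone.\<close>

lemma multiples_of_gcd:
  assumes a: "a \<in> D" and b: "b \<in> D" and na: "\<not> int p dvd int a" and nb: "\<not> int p dvd int b"
    and ab: "\<not> int p dvd int a - int b" and ab': "\<not> int p dvd int a + int b"
    and n: "gcd a b dvd n" "(a + b) * a + (a + b) * (a + b) \<le> n"
  shows "n \<in> D"
proof -
  have a0: "a \<noteq> 0" using na by (cases a) auto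
  obtain x where x: "[a * x = gcd a (a + b)] (mod (a + b))" using cong_solve_nat by blast
  have g: "gcd a (a + b) = gcd a b" by (metis gcd_add2 add.commute)
  obtain m where m: "n = gcd a b * m" using n(1) by blast
  define e where "e = (x * m) mod (a + b)"
  have e: "e < a + b" using a0 by (simp add: e_def)
  have "[a * (x * m) = n] (mod (a + b))"
    using cong_mult[OF x cong_refl[of m]] by (simp add: g m mult.assoc)
  moreover have "[a * e = a * (x * m)] (mod (a + b))"
    by (intro cong_mult) (simp_all add: e_def)
  ultimately have "[a * e = n] (mod (a + b))" using cong_trans by blast
  moreover have "a * e \<le> (a + b) * a" using e by (simp add: mult.commute)
  ultimately obtain k where k: "n = a * e + (a + b) * k"
    using n(2) by (metis cong_le_nat cong_sym le_add1 le_trans add.commute mult.commute)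
  have "k \<ge> a + b"
  proof (rule ccontr)
    assume "\<not> ?thesis"
    then have "(a + b) * k < (a + b) * (a + b)" using a0 by simp
    then show False using k \<open>a * e \<le> (a + b) * a\<close> n(2) by linarith
  qed
  then have "(k + e) * a + k * b \<in> D"
    using e a0 by (intro cone[OF a b na nb ab ab']) auto
  then show ?thesis using k by (simp add: algebra_simps)
qed

text \<open>The pair \<open>a\<close>, \<open>b\<close> reaches only multiples of
  \<open>g = gcd a b\<close>. It is traded for a coprime pair: \<open>b1 = d + g y\<close> leaves
  the multiples of \<open>g\<close> with the help of \<open>d\<close>, and a multiple
  \<open>a1\<close> of \<open>g\<close> is chosen with \<open>2 a1\<close> congruent to
  \<open>b1\<close>, so that \<open>a1 - b1\<close> and \<open>a1 + b1\<close> are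
  \<open>- a1\<close> and \<open>3 a1\<close> mod \<open>p\<close>.\<close>

lemma cofinite:
  assumes a: "a \<in> D" and b: "b \<in> D" and na: "\<not> int p dvd int a" and nb: "\<not> int p dvd int b"
    and ab: "\<not> int p dvd int a - int b" and ab': "\<not> int p dvd int a + int b"
    and d: "d \<in> D" and gd: "gcd (gcd a b) d = 1"
  shows "\<exists>M. \<forall>n\<ge>M. n \<in> D"
proof -
  define g where "g = gcd a b"
  define M where "M = (a + b) * a + (a + b) * (a + b)"
  have mult: "n \<in> D" if "g dvd n" "M \<le> n" for n
    using multiples_of_gcd[OF a b na nb ab ab'] that by (simp add: g_def M_def)
  have "a \<noteq> 0" using na by (cases a) auto
  then have g1: "1 \<le> g" by (simp add: g_def Suc_le_eq)
  have pg: "\<not> int p dvd int g"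
    using na dvd_trans[of "int p" "int g" "int a"] by (auto simp: g_def)
  \<comment> \<open>As \<open>g\<close> is invertible mod \<open>p\<close>, each of the two
    conditions excludes at most one of \<open>M\<close>, \<open>M + 1\<close>, \<open>M + 2\<close>.
    The first permits the sum \<open>g y + d\<close>, the second keeps it prime to
    \<open>p\<close>.\<close>
  have "\<exists>y\<ge>M. \<not> int p dvd int (g * y) - int d \<and> \<not> int p dvd int (d + g * y)"
  proof (rule ccontr)
    assume no: "\<not> ?thesis"
    have diff: "\<not> (int p dvd x + i * int g \<and> int p dvd x + j * int g)"
      if "0 \<le> i" "i < j" "j \<le> 2" for x i j :: int
    proof
      assume "int p dvd x + i * int g \<and> int p dvd x + j * int g"
      then have "int p dvd (x + j * int g) - (x + i * int g)" using dvd_diff by blast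
      also have "(x + j * int g) - (x + i * int g) = (j - i) * int g" by (simp add: algebra_simps)
      finally have "int p dvd (j - i) * int g" .
      then have "int p dvd j - i" using pg p by (simp add: prime_dvd_mult_iff)
      then show False using that p zdvd_imp_le[of "int p" "j - i"] by auto
    qed
    define u v where "u = int (g * M) - int d" and "v = int (g * M) + int d"
    have "int p dvd u + i * int g \<or> int p dvd v + i * int g" if "i \<in> {0, 1, 2}" for i
    proof -
      have "M \<le> M + nat i" by simp
      with no have "int p dvd int (g * (M + nat i)) - int d \<or> int p dvd int (d + g * (M + nat i))"
        by blast
      moreover have "int (g * (M + nat i)) - int d = u + i * int g"
        "int (d + g * (M + nat i)) = v + i * int g"
        using that by (auto simp: u_def v_def algebra_simps)
      ultimately show ?thesis by simp
    qed
    from this[of 0] this[of 1] this[of 2] diff[of 0 1 u] diff[of 0 2 u] diff[of 1 2 u]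
      diff[of 0 1 v] diff[of 0 2 v] diff[of 1 2 v]
    show False by auto
  qed
  then obtain y where y: "M \<le> y" "\<not> int p dvd int (g * y) - int d" "\<not> int p dvd int (d + g * y)"
    by blast
  define b1 where "b1 = d + g * y"
  have "M \<le> g * y" using y(1) g1 by (metis le_trans mult_le_mono1 mult_1)
  then have "g * y + d \<in> D" by (intro closed mult d y(2)) simp_all
  then have b1: "b1 \<in> D" by (simp add: b1_def add.commute)
  have pb1: "\<not> int p dvd int b1" using y(3) by (simp add: b1_def)
  then have b10: "b1 \<noteq> 0" by (cases b1) auto
  have "gcd g (y * g + d) = gcd g d" by (rule gcd_add_mult)
  then have "gcd b1 g = gcd g d" unfolding b1_def by (metis gcd.commute add.commute mult.commute)
  then have cg: "coprime b1 g" using gd by (simp add: g_def coprime_iff_gcd_eq_1)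
  have "\<not> p dvd 2 * g"
    using pg p_dvd_double[of "int g"] by (metis int_dvd_int_iff of_nat_mult of_nat_numeral)
  then have "coprime (2 * g) p" using prime_imp_coprime[OF p(1)] coprime_commute by blast
  \<comment> \<open>An inverse of \<open>2 g\<close> mod \<open>p\<close>; scaled by
    \<open>b1\<close> it gives the residue of \<open>x\<close> that makes \<open>2 g x\<close>
    congruent to \<open>b1\<close>.\<close>
  then obtain c0 where "[2 * g * c0 = Suc 0] (mod p)" using cong_solve_coprime_nat by blast
  then have "[2 * g * c0 * b1 = Suc 0 * b1] (mod p)" by (intro cong_mult cong_refl)
  then have c: "[2 * g * (c0 * b1) = b1] (mod p)" by (simp add: mult.assoc)
  define c where "c = c0 * b1"
  note c = c[folded c_def]
  have "\<not> p dvd b1" using pb1 by simp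
  then have cop: "coprime b1 p" using prime_imp_coprime[OF p(1)] coprime_commute by blast
  obtain x0 where x0: "[x0 = 1] (mod b1)" "[x0 = c] (mod p)"
    using binary_chinese_remainder_nat[OF cop] by blast
  \<comment> \<open>The residue 1 mod \<open>b1\<close> keeps \<open>g x\<close> coprime to
    \<open>b1\<close>; the multiple of \<open>b1 p\<close> preserves both residues and lifts
    \<open>x\<close> above \<open>M\<close>.\<close>
  define x where "x = x0 + b1 * p * M"
  have x1: "[x = 1] (mod b1)"
    using x0(1) by (simp add: x_def cong_def mult.assoc)
  have x2: "[x = c] (mod p)"
    using x0(2) by (simp add: x_def cong_def mult.assoc mult.left_commute[of _ p])
  have "1 * M \<le> b1 * p * M" using b10 p by (intro mult_le_mono1) auto
  then have xM: "M \<le> x" unfolding x_def by linarith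
  define a1 where "a1 = g * x"
  have "M \<le> g * x" using xM g1 by (metis le_trans mult_le_mono1 mult_1)
  then have a1: "a1 \<in> D" using mult by (simp add: a1_def)
  have "coprime x b1" using x1 by (metis cong_imp_coprime coprime_1_left cong_sym)
  then have cop1: "gcd a1 b1 = 1" using cg by (simp add: a1_def coprime_commute coprime_iff_gcd_eq_1[symmetric])
  have "[2 * g * x = 2 * g * c] (mod p)" using x2 by (intro cong_mult) auto
  then have "[2 * a1 = b1] (mod p)" using c cong_trans by (fastforce simp: a1_def mult.assoc)
  then have "[int (2 * a1) = int b1] (mod int p)" by (simp only: cong_int_iff)
  then have two: "int p dvd 2 * int a1 - int b1" by (simp add: cong_iff_dvd_diff)
  have pa1: "\<not> int p dvd int a1"
  proof
    assume "int p dvd int a1"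
    then have "int p dvd 2 * int a1 - (2 * int a1 - int b1)" by (intro dvd_diff[OF dvd_mult two])
    moreover have "2 * int a1 - (2 * int a1 - int b1) = int b1" by simp
    ultimately show False using pb1 by metis
  qed
  have 1: "\<not> int p dvd int a1 - int b1"
  proof
    assume "int p dvd int a1 - int b1"
    then have "int p dvd (2 * int a1 - int b1) - (int a1 - int b1)" by (rule dvd_diff[OF two])
    moreover have "(2 * int a1 - int b1) - (int a1 - int b1) = int a1" by simp
    ultimately show False using pa1 by metis
  qed
  have 2: "\<not> int p dvd int a1 + int b1"
  proof
    assume "int p dvd int a1 + int b1"
    then have "int p dvd (2 * int a1 - int b1) + (int a1 + int b1)" by (rule dvd_add[OF two])
    moreover have "(2 * int a1 - int b1) + (int a1 + int b1) = 3 * int a1" by simp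
    ultimately have "int p dvd 3 * int a1" by metis
    then have "int p dvd 3" using pa1 p by (simp add: prime_dvd_mult_iff del: of_nat_dvd_iff)
    then show False using p zdvd_imp_le[of "int p" 3] by auto
  qed
  show ?thesis
    using multiples_of_gcd[OF a1 b1 pa1 pb1 1 2] cop1 by auto
qed

end

unbundle fps_syntax

section \<open>Substitution of power series\<close>

lemma X_power_dvd_iff: "fps_X ^ n dvd (f :: 'a::field fps) \<longleftrightarrow> (\<forall>i<n. f $ i = 0)"
proof
  assume "fps_X ^ n dvd f"
  then obtain g where "f = fps_X ^ n * g" by (auto elim: dvdE)
  then show "\<forall>i<n. f $ i = 0" by (simp add: fps_X_power_mult_nth)
next
  assume "\<forall>i<n. f $ i = 0"
  then have "f = fps_X ^ n * fps_shift n f"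
    by (intro fps_ext) (simp add: fps_X_power_mult_nth)
  then show "fps_X ^ n dvd f" by (metis dvd_triv_left)
qed

lemma X_power_dvd_Suc_iff: "fps_X ^ Suc n dvd (f :: 'a::field fps) \<longleftrightarrow> fps_X ^ n dvd f \<and> f $ n = 0"
  unfolding X_power_dvd_iff by (auto simp: less_Suc_eq)

lemma X_power_dvd_mult:
  "fps_X ^ m dvd (f :: 'a::field fps) \<Longrightarrow> fps_X ^ n dvd g \<Longrightarrow> fps_X ^ (m + n) dvd f * g"
  by (simp add: power_add mult_dvd_mono)

lemma X_power_dvd_mono: "fps_X ^ n dvd (f :: 'a::field fps) \<Longrightarrow> m \<le> n \<Longrightarrow> fps_X ^ m dvd f"
  by (meson dvd_trans le_imp_power_dvd)

lemma X_power_dvd_diff_power: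
  fixes f g :: "'a::field fps"
  assumes "fps_X ^ d dvd f - g" "f $ 0 = 0" "g $ 0 = 0"
  shows "fps_X ^ (d + n) dvd f ^ Suc n - g ^ Suc n"
proof -
  have f: "fps_X dvd f" "fps_X dvd g" using X_power_dvd_iff[of 1] assms by auto
  have "f ^ Suc n - g ^ Suc n = (f - g) * (\<Sum>i<Suc n. g ^ (Suc n - Suc i) * f ^ i)"
    by (rule power_diff_sumr2)
  moreover have "fps_X ^ n dvd (\<Sum>i<Suc n. g ^ (Suc n - Suc i) * f ^ i)"
  proof (rule dvd_sum)
    fix i assume "i \<in> {..<Suc n}"
    then have "n = (Suc n - Suc i) + i" by simp
    then show "fps_X ^ n dvd g ^ (Suc n - Suc i) * f ^ i"
      using X_power_dvd_mult[OF dvd_power_same[OF f(2)] dvd_power_same[OF f(1)]] by metis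
  qed
  ultimately show ?thesis by (simp only: X_power_dvd_mult[OF assms(1)])
qed

lemma compose_near_id:
  fixes r w :: "'a::field fps"
  assumes "fps_X ^ Suc d dvd w - fps_X" "w $ 0 = 0"
  shows "fps_X ^ Suc d dvd (r oo w) - r"
  unfolding X_power_dvd_iff
proof (intro allI impI)
  fix i assume i: "i < Suc d"
  have eq: "(w ^ j) $ i = (fps_X ^ j :: 'a fps) $ i" for j
  proof (cases j)
    case (Suc m)
    have "fps_X ^ (Suc d + m) dvd w ^ Suc m - fps_X ^ Suc m"
      by (rule X_power_dvd_diff_power) (use assms in simp_all)
    then show ?thesis using Suc i unfolding X_power_dvd_iff by auto
  qed simp
  then have "(r oo w) $ i = (r oo fps_X) $ i" by (simp only: fps_compose_nth eq)
  then show "((r oo w) - r) $ i = 0" by simp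
qed

lemma compose_factor:
  fixes r w :: "'a::field fps"
  assumes "w $ 0 = 0"
  shows "(fps_X ^ n * r) oo w = w ^ n * (r oo w)"
  using assms by (simp add: fps_compose_mult_distrib fps_compose_power[symmetric])

lemma X_power_dvd_compose:
  fixes h w :: "'a::field fps"
  assumes "fps_X ^ n dvd h" "w $ 0 = 0"
  shows "fps_X ^ n dvd h oo w"
proof -
  obtain r where r: "h = fps_X ^ n * r" using assms(1) by (auto elim: dvdE)
  have "fps_X dvd w" using X_power_dvd_iff[of 1 w] assms by auto
  then show ?thesis unfolding r compose_factor[OF assms(2)] by (simp add: dvd_power_same)
qed

text \<open>With \<open>h = X^n r\<close> the difference splits into the change of
  \<open>X^n\<close> and the change of \<open>r\<close>, and each gains \<open>d\<close>
  orders.\<close>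

lemma compose_diff:
  fixes h w :: "'a::field fps"
  assumes h: "fps_X ^ n dvd h" and w: "fps_X ^ Suc d dvd w - fps_X" "w $ 0 = 0"
  shows "fps_X ^ (n + d) dvd (h oo w) - h"
proof -
  obtain r where r: "h = fps_X ^ n * r" using h by (auto elim: dvdE)
  have "(h oo w) - h = (w ^ n - fps_X ^ n) * (r oo w) + fps_X ^ n * ((r oo w) - r)"
    unfolding r compose_factor[OF w(2)] by (simp add: algebra_simps)
  moreover have "fps_X ^ (n + d) dvd (w ^ n - fps_X ^ n) * (r oo w)"
  proof (cases n)
    case (Suc m)
    then show ?thesis
      using X_power_dvd_diff_power[OF w(1) w(2), of m] by (simp add: add.commute)
  qed simp
  moreover have "fps_X ^ (n + d) dvd fps_X ^ n * ((r oo w) - r)"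
    using X_power_dvd_mult[OF dvd_refl X_power_dvd_mono[OF compose_near_id[OF w, of r]], of d n] by simp
  ultimately show ?thesis by simp
qed

lemma power_one_plus:
  fixes y :: "'a::field fps"
  assumes "fps_X ^ l dvd y" "1 \<le> l"
  shows "fps_X ^ Suc l dvd (1 + y) ^ m - 1 - of_nat m * y"
proof (induction m)
  case (Suc m)
  have "(1 + y) ^ Suc m - 1 - of_nat (Suc m) * y = (1 + y) * ((1 + y) ^ m - 1 - of_nat m * y) + of_nat m * (y * y)"
    by (simp add: algebra_simps)
  moreover have "fps_X ^ Suc l dvd y * y"
    by (rule X_power_dvd_mono[OF X_power_dvd_mult[OF assms(1) assms(1)]]) (use assms(2) in simp)
  ultimately show ?case using Suc by (simp add: dvd_add dvd_mult)
qed simp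

text \<open>Taylor expansion: \<open>h(w) - h\<close> is \<open>h' (w - t)\<close> up to higher
  terms, and differentiating the leading monomial of \<open>h\<close> yields the factor
  \<open>n\<close>.\<close>

lemma compose_diff_leading:
  fixes h w :: "'a::field fps"
  assumes h: "fps_X ^ n dvd h" and w: "fps_X ^ Suc l dvd w - fps_X" "w $ 0 = 0" and l: "1 \<le> l"
  shows "((h oo w) - h) $ (n + l) = of_nat n * h $ n * w $ Suc l"
proof -
  obtain r where r: "h = fps_X ^ n * r" using h by (auto elim: dvdE)
  obtain s where s: "w - fps_X = fps_X ^ Suc l * s" using w by (auto elim: dvdE)
  define y where "y = fps_X ^ l * s"
  have wy: "w = fps_X * (1 + y)" using s by (simp add: y_def algebra_simps)
  have y: "fps_X ^ l dvd y" by (simp add: y_def)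
  have r0: "r $ 0 = h $ n" by (simp add: r fps_X_power_mult_nth)
  have s0: "s $ 0 = w $ Suc l"
  proof -
    have "(w - fps_X) $ Suc l = s $ 0" unfolding s by (simp add: fps_X_power_mult_nth del: power_Suc)
    then show ?thesis using l by simp
  qed
  have wn: "w ^ n = fps_X ^ n * (1 + y) ^ n" by (simp add: wy power_mult_distrib)
  have "(h oo w) - h = fps_X ^ n * (((1 + y) ^ n - 1) * (r oo w) + ((r oo w) - r))"
    unfolding r compose_factor[OF w(2)] wn by (simp add: algebra_simps)
  then have "((h oo w) - h) $ (n + l) = (((1 + y) ^ n - 1) * (r oo w) + ((r oo w) - r)) $ l"
    by (simp add: fps_X_power_mult_nth)
  also have "((r oo w) - r) $ l = 0"
    using compose_near_id[OF w, of r] unfolding X_power_dvd_iff by blast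
  then have "(((1 + y) ^ n - 1) * (r oo w) + ((r oo w) - r)) $ l = (((1 + y) ^ n - 1) * (r oo w)) $ l"
    by (metis add.right_neutral fps_add_nth)
  also have "((1 + y) ^ n - 1) * (r oo w) =
      ((1 + y) ^ n - 1 - of_nat n * y) * (r oo w) + fps_X ^ l * (of_nat n * (s * (r oo w)))"
    by (simp add: y_def algebra_simps)
  also have "\<dots> $ l = (of_nat n * (s * (r oo w))) $ 0"
  proof -
    have "fps_X ^ Suc l dvd ((1 + y) ^ n - 1 - of_nat n * y) * (r oo w)"
      using power_one_plus[OF y l] by simp
    then have "(((1 + y) ^ n - 1 - of_nat n * y) * (r oo w)) $ l = 0"
      unfolding X_power_dvd_iff by blast
    then show ?thesis by (simp only: fps_add_nth fps_X_power_mult_nth) simp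
  qed
  also have "\<dots> = of_nat n * h $ n * w $ Suc l" by (simp add: r0 s0 fps_of_nat[symmetric] del: fps_of_nat)
  finally show ?thesis .
qed

lemma compose_leading:
  fixes h w :: "'a::field fps"
  assumes h: "fps_X ^ n dvd h" and w: "w $ 0 = 0" "w $ 1 = 1"
  shows "(h oo w) $ n = h $ n"
proof -
  have "fps_X ^ Suc 1 dvd w - fps_X"
    unfolding X_power_dvd_iff using w by (auto simp: less_Suc_eq)
  from compose_diff[OF h this w(1)] have "((h oo w) - h) $ n = 0"
    unfolding X_power_dvd_iff by simp
  then show ?thesis by simp
qed

section \<open>The Nottingham group as a graded group\<close>

lemma carrier_nottingham: "f \<in> carrier nottingham \<longleftrightarrow> f $ 0 = 0 \<and> f $ 1 = 1"
  by (simp add: nottingham_def)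

lemma mult_nottingham: "f \<otimes>\<^bsub>nottingham\<^esub> g = f oo g"
  by (simp add: nottingham_def)

lemma one_nottingham: "\<one>\<^bsub>nottingham\<^esub> = fps_X"
  by (simp add: nottingham_def)

lemma compose_nth_1:
  fixes f g :: "'a::field fps"
  assumes "g $ 0 = 0"
  shows "(f oo g) $ 1 = f $ 1 * g $ 1"
  using assms by (simp add: fps_compose_nth)

lemma carrier_nottingham_compose:
  fixes f g :: "'a::field fps"
  shows "f \<in> carrier nottingham \<Longrightarrow> g \<in> carrier nottingham \<Longrightarrow> f oo g \<in> carrier nottingham"
  by (auto simp: carrier_nottingham compose_nth_1 simp del: One_nat_def)

lemma carrier_nottingham_near_id:
  fixes f :: "'a::field fps"
  shows "f \<in> carrier nottingham \<longleftrightarrow> fps_X ^ Suc 1 dvd f - fps_X"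
  unfolding X_power_dvd_iff carrier_nottingham by (auto simp: less_Suc_eq)

lemma fps_inv_nottingham:
  fixes f :: "'a::field fps"
  assumes "f \<in> carrier nottingham"
  shows "fps_inv f \<in> carrier nottingham" "fps_inv f oo f = fps_X" "f oo fps_inv f = fps_X"
proof -
  have f: "f $ 0 = 0" "f $ 1 \<noteq> 0" using assms by (auto simp: carrier_nottingham)
  show c: "fps_inv f oo f = fps_X" using fps_inv[OF f] .
  show "f oo fps_inv f = fps_X" using fps_inv_right[OF f] .
  have "(fps_inv f oo f) $ 1 = fps_inv f $ 1 * f $ 1" using f(1) by (rule compose_nth_1)
  then show "fps_inv f \<in> carrier nottingham"
    using assms c by (simp add: carrier_nottingham fps_inv_def)
qed

lemma group_nottingham: "group (nottingham :: 'a::field fps monoid)"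
proof (rule groupI)
  fix x y z :: "'a fps"
  assume "x \<in> carrier nottingham" "y \<in> carrier nottingham" "z \<in> carrier nottingham"
  then show "x \<otimes>\<^bsub>nottingham\<^esub> y \<otimes>\<^bsub>nottingham\<^esub> z = x \<otimes>\<^bsub>nottingham\<^esub> (y \<otimes>\<^bsub>nottingham\<^esub> z)"
    by (simp add: mult_nottingham carrier_nottingham fps_compose_assoc)
next
  fix x :: "'a fps" assume x: "x \<in> carrier nottingham"
  show "\<exists>y\<in>carrier nottingham. y \<otimes>\<^bsub>nottingham\<^esub> x = \<one>\<^bsub>nottingham\<^esub>"
    using fps_inv_nottingham[OF x] by (auto simp: mult_nottingham one_nottingham)
  show "\<one>\<^bsub>nottingham\<^esub> \<otimes>\<^bsub>nottingham\<^esub> x = x"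
    using x by (simp add: mult_nottingham one_nottingham carrier_nottingham)
qed (auto simp: mult_nottingham one_nottingham carrier_nottingham_compose, auto simp: carrier_nottingham)

lemma inv_nottingham:
  fixes f :: "'a::field fps"
  assumes "f \<in> carrier nottingham"
  shows "inv\<^bsub>nottingham\<^esub> f = fps_inv f"
  using group.inv_equality[OF group_nottingham, of "fps_inv f" f] fps_inv_nottingham[OF assms] assms
  by (simp add: mult_nottingham one_nottingham)

definition nlead :: "nat \<Rightarrow> 'a::field \<Rightarrow> 'a fps \<Rightarrow> bool" where
  "nlead k a f \<longleftrightarrow> 1 \<le> k \<and> f \<in> carrier nottingham \<and> fps_X ^ Suc k dvd f - fps_X \<and> f $ Suc k = a"

text \<open>Up to sign the bracket of the vector fields \<open>a t^(k+1) d/dt\<close> and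
  \<open>b t^(l+1) d/dt\<close>, that is, the positive part of the Witt algebra.\<close>

definition depth_br :: "nat \<Rightarrow> nat \<Rightarrow> 'a::field \<Rightarrow> 'a \<Rightarrow> 'a" where
  "depth_br k l a b = (of_nat k - of_nat l) * a * b"

lemma nlead_mult:
  fixes f g :: "'a::field fps"
  assumes "nlead k a f" "nlead k b g"
  shows "nlead k (a + b) (f oo g)"
proof -
  have k: "1 \<le> k" and f: "f \<in> carrier nottingham" "fps_X ^ Suc k dvd f - fps_X" "f $ Suc k = a"
    and g: "g \<in> carrier nottingham" "fps_X ^ Suc k dvd g - fps_X" "g $ Suc k = b"
    using assms by (auto simp: nlead_def)
  have g0: "g $ 0 = 0" "g $ 1 = 1" using g(1) by (auto simp: carrier_nottingham)
  have e: "(f oo g) - fps_X = ((f - fps_X) oo g) + (g - fps_X)"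
    using g0 by (simp add: fps_compose_sub_distrib)
  have "((f - fps_X) oo g) $ Suc k = (f - fps_X) $ Suc k" by (rule compose_leading[OF f(2) g0])
  then have "((f oo g) - fps_X) $ Suc k = a + b" unfolding e using f(3) g(3) k by simp
  then have "(f oo g) $ Suc k = a + b" using k by simp
  moreover have "fps_X ^ Suc k dvd (f oo g) - fps_X"
    unfolding e by (intro dvd_add X_power_dvd_compose f g g0)
  ultimately show ?thesis using k carrier_nottingham_compose[OF f(1) g(1)] by (simp add: nlead_def)
qed

lemma nlead_inv:
  fixes f :: "'a::field fps"
  assumes "nlead k a f"
  shows "nlead k (- a) (fps_inv f)"
proof -
  have k: "1 \<le> k" and f: "f \<in> carrier nottingham" "fps_X ^ Suc k dvd f - fps_X" "f $ Suc k = a"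
    using assms by (auto simp: nlead_def)
  define h where "h = fps_inv f"
  have h: "h \<in> carrier nottingham" "f oo h = fps_X" unfolding h_def using fps_inv_nottingham f by blast+
  have h0: "h $ 0 = 0" "h $ 1 = 1" using h(1) by (auto simp: carrier_nottingham)
  have e: "h - fps_X = - ((f - fps_X) oo h)"
    using h0 h(2) by (simp add: fps_compose_sub_distrib)
  have "((f - fps_X) oo h) $ Suc k = (f - fps_X) $ Suc k" by (rule compose_leading[OF f(2) h0])
  then have "(h - fps_X) $ Suc k = - a" unfolding e using f(3) k by simp
  moreover have "fps_X ^ Suc k dvd h - fps_X"
    unfolding e by (simp only: dvd_minus_iff) (intro X_power_dvd_compose f h0)
  ultimately show ?thesis using k h by (simp add: nlead_def h_def)
qed

text \<open>The difference \<open>E\<close> of \<open>f oo g\<close> and \<open>g oo f\<close> has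
  leading coefficient \<open>(k + 1) a b - (l + 1) a b\<close> by
  \<open>compose_diff_leading\<close>. Substituting the inverse of \<open>g oo f\<close> turns
  \<open>E\<close> into the commutator minus \<open>t\<close> and keeps that coefficient.\<close>

lemma nlead_comm:
  fixes f g :: "'a::field fps"
  assumes "nlead k a f" "nlead l b g"
  shows "nlead (k + l) (depth_br k l a b) ((f oo g) oo fps_inv (g oo f))"
proof -
  have k: "1 \<le> k" and f: "f \<in> carrier nottingham" "fps_X ^ Suc k dvd f - fps_X" "f $ Suc k = a"
    and l: "1 \<le> l" and g: "g \<in> carrier nottingham" "fps_X ^ Suc l dvd g - fps_X" "g $ Suc l = b"
    using assms by (auto simp: nlead_def)
  have f0: "f $ 0 = 0" and g0: "g $ 0 = 0" using f g by (auto simp: carrier_nottingham)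
  define v where "v = fps_inv (g oo f)"
  have v: "v \<in> carrier nottingham" "(g oo f) oo v = fps_X"
    unfolding v_def using fps_inv_nottingham carrier_nottingham_compose f(1) g(1) by blast+
  have v0: "v $ 0 = 0" "v $ 1 = 1" using v(1) by (auto simp: carrier_nottingham)
  define F H where "F = f - fps_X" and "H = g - fps_X"
  have F: "fps_X ^ Suc k dvd F" "F $ Suc k = a" and H: "fps_X ^ Suc l dvd H" "H $ Suc l = b"
    using f g k l by (auto simp: F_def H_def)
  define E where "E = (f oo g) - (g oo f)"
  have E: "E = ((F oo g) - F) - ((H oo f) - H)"
    using f0 g0 by (simp add: E_def F_def H_def fps_compose_sub_distrib)
  have 1: "fps_X ^ Suc (k + l) dvd (F oo g) - F" using compose_diff[OF F(1) g(2) g0] by simp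
  have 2: "fps_X ^ Suc (k + l) dvd (H oo f) - H"
    using compose_diff[OF H(1) f(2) f0] by (simp add: add.commute)
  have "((F oo g) - F) $ (Suc k + l) = of_nat (Suc k) * F $ Suc k * g $ Suc l"
    by (rule compose_diff_leading[OF F(1) g(2) g0 l])
  moreover have "((H oo f) - H) $ (Suc l + k) = of_nat (Suc l) * H $ Suc l * f $ Suc k"
    by (rule compose_diff_leading[OF H(1) f(2) f0 k])
  then have "((H oo f) - H) $ (Suc k + l) = of_nat (Suc l) * H $ Suc l * f $ Suc k"
    by (simp add: add.commute)
  ultimately have "E $ (Suc k + l) = depth_br k l a b"
    unfolding E fps_sub_nth using F H f g by (simp add: depth_br_def algebra_simps)
  then have Ec: "E $ Suc (k + l) = depth_br k l a b" by simp
  have Ed: "fps_X ^ Suc (k + l) dvd E" unfolding E using 1 2 by (rule dvd_diff)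
  have "((f oo g) oo v) - fps_X = E oo v"
    unfolding E_def fps_compose_sub_distrib v(2) ..
  then show ?thesis
    using k carrier_nottingham_compose[OF carrier_nottingham_compose[OF f(1) g(1)] v(1)]
      X_power_dvd_compose[OF Ed v0(1)] compose_leading[OF Ed v0] Ec
    by (auto simp: nlead_def v_def[symmetric] dest!: arg_cong[of _ _ "\<lambda>h. h $ Suc (k + l)"])
qed

lemma nlead_iff_filtration:
  "1 \<le> k \<Longrightarrow> (\<exists>a. nlead k a f) \<longleftrightarrow> f \<in> nottingham_filtration k"
  by (simp add: nlead_def nottingham_filtration_def)

text \<open>Filtration terms are closed under composition, so a coset is a neighbourhood of each of
  its points; they are nested, so intersections keep the property.\<close>

lemma openin_nottingham_iff:
  fixes U :: "'a::field fps set"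
  shows "openin nottingham_topology U \<longleftrightarrow> U \<subseteq> carrier nottingham \<and>
    (\<forall>x\<in>U. \<exists>k\<ge>1. \<forall>g\<in>nottingham_filtration k. x oo g \<in> U)"
proof -
  interpret group "nottingham :: 'a fps monoid" by (rule group_nottingham)
  have filt_mult: "g oo h \<in> nottingham_filtration k"
    if "1 \<le> k" "g \<in> nottingham_filtration k" "h \<in> nottingham_filtration k" for g h :: "'a fps" and k
    using that nlead_iff_filtration nlead_mult by metis
  have filt_carrier: "nottingham_filtration k \<subseteq> carrier (nottingham :: 'a fps monoid)" for k
    by (auto simp: nottingham_filtration_def)
  have coset: "f <#\<^bsub>nottingham\<^esub> nottingham_filtration k = (\<lambda>g. f oo g) ` nottingham_filtration k"
    for f :: "'a fps" and k by (auto simp: l_coset_def mult_nottingham)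
  let ?P = "\<lambda>U. U \<subseteq> carrier nottingham \<and>
      (\<forall>x\<in>U. \<exists>k\<ge>1. \<forall>g\<in>nottingham_filtration k. x oo g \<in> (U :: 'a fps set))"
  have mono: "nottingham_filtration n \<subseteq> nottingham_filtration m" if "m \<le> n" for m n
    using that by (auto simp: nottingham_filtration_def simp del: power_Suc intro: X_power_dvd_mono)
  show ?thesis
  proof
    assume "openin nottingham_topology U"
    then have "generate_topology_on
        {f <#\<^bsub>nottingham\<^esub> nottingham_filtration k |f k. f \<in> carrier nottingham \<and> 1 \<le> k} U"
      unfolding nottingham_topology_def openin_topology_generated_by_iff .
    then show "?P U"
    proof (induction rule: generate_topology_on.induct)
      case (Int a b)
      show ?case
      proof (intro conjI ballI)
        show "a \<inter> b \<subseteq> carrier nottingham" using Int by blast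
        fix x assume "x \<in> a \<inter> b"
        then obtain k l where "k \<ge> 1" "\<forall>g\<in>nottingham_filtration k. x oo g \<in> a"
          "l \<ge> 1" "\<forall>g\<in>nottingham_filtration l. x oo g \<in> b" using Int by blast
        then show "\<exists>k\<ge>1. \<forall>g\<in>nottingham_filtration k. x oo g \<in> a \<inter> b"
          using mono[of k "max k l"] mono[of l "max k l"] by (intro exI[of _ "max k l"]) auto
      qed
    next
      case (UN K)
      show ?case
      proof (intro conjI ballI)
        show "\<Union> K \<subseteq> carrier nottingham" using UN by blast
        fix x assume "x \<in> \<Union> K"
        then obtain k where k: "k \<in> K" "x \<in> k" by blast
        with UN obtain n where "n \<ge> 1" "\<forall>g\<in>nottingham_filtration n. x oo g \<in> k" by blast
        with k show "\<exists>k\<ge>1. \<forall>g\<in>nottingham_filtration k. x oo g \<in> \<Union> K" by blast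
      qed
    next
      case (Basis s)
      then obtain f k where s: "s = (\<lambda>g. f oo g) ` nottingham_filtration k"
        and f: "f \<in> carrier nottingham" and k: "1 \<le> k" unfolding coset by blast
      show ?case
      proof (intro conjI ballI)
        show "s \<subseteq> carrier nottingham"
          unfolding s using carrier_nottingham_compose[OF f] filt_carrier by blast
        fix x assume "x \<in> s"
        then obtain g where g: "x = f oo g" "g \<in> nottingham_filtration k" unfolding s by blast
        have "x oo h \<in> s" if h: "h \<in> nottingham_filtration k" for h
        proof -
          have "g $ 0 = 0" "h $ 0 = 0"
            using g h filt_carrier carrier_nottingham by blast+
          then have "x oo h = f oo (g oo h)" by (simp add: g fps_compose_assoc)
          then show ?thesis unfolding s using filt_mult[OF k g(2) h] by blast
        qed
        then show "\<exists>k\<ge>1. \<forall>g\<in>nottingham_filtration k. x oo g \<in> s" using k by blast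
      qed
    qed simp
  next
    assume U: "?P U"
    show "openin nottingham_topology U"
    proof (subst openin_subopen, intro ballI)
      fix x assume x: "x \<in> U"
      with U obtain k where k: "k \<ge> 1" "\<forall>g\<in>nottingham_filtration k. x oo g \<in> U" by blast
      have "openin nottingham_topology (x <#\<^bsub>nottingham\<^esub> nottingham_filtration k)"
        unfolding nottingham_topology_def
        by (rule topology_generated_by_Basis) (use k x U in blast)
      moreover have "fps_X \<in> nottingham_filtration k"
        by (simp add: nottingham_filtration_def carrier_nottingham)
      then have "x \<in> x <#\<^bsub>nottingham\<^esub> nottingham_filtration k"
        unfolding coset by (force intro: image_eqI[of _ _ fps_X])
      ultimately show "\<exists>V. openin nottingham_topology V \<and> x \<in> V \<and> V \<subseteq> U"
        using k(2) unfolding coset by blast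
    qed
  qed
qed

lemma graded_group_nottingham:
  assumes two: "(2 :: 'a::field) \<noteq> 0"
  shows "graded_group (nottingham :: 'a fps monoid) nottingham_topology nlead depth_br"
proof -
  interpret group "nottingham :: 'a fps monoid" by (rule group_nottingham)
  show ?thesis
  proof unfold_locales
    fix k :: nat and f :: "'a fps"
    show "1 \<le> k \<Longrightarrow> nlead k 0 f \<longleftrightarrow> (\<exists>A. nlead (Suc k) A f)"
      by (auto simp: nlead_def X_power_dvd_Suc_iff[of "Suc k"] simp del: power_Suc)
    show "1 \<le> k \<Longrightarrow> \<exists>f. nlead k A f" for A :: 'a
      by (intro exI[of _ "fps_X + fps_const A * fps_X ^ Suc k"])
        (simp add: nlead_def carrier_nottingham)
  next
    fix f :: "'a fps"
    show "f \<in> carrier nottingham \<Longrightarrow> \<exists>A. nlead 1 A f"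
      unfolding nlead_def using carrier_nottingham_near_id by auto
    assume f: "f \<in> carrier nottingham" and all: "\<And>k. 1 \<le> k \<Longrightarrow> \<exists>A. nlead k A f"
    have "(f - fps_X) $ i = 0" for i
    proof -
      have "fps_X ^ Suc (Suc i) dvd f - fps_X" using all[of "Suc i"] by (auto simp: nlead_def)
      then show ?thesis unfolding X_power_dvd_iff by auto
    qed
    then have "f - fps_X = 0" by (intro fps_ext) simp
    then show "f = \<one>\<^bsub>nottingham\<^esub>" by (simp add: one_nottingham)
  next
    fix k l a b and f g :: "'a fps"
    assume fg: "nlead k a f" "nlead l b g"
    then have c: "f \<in> carrier nottingham" "g \<in> carrier nottingham" by (auto simp: nlead_def)
    have "f \<otimes>\<^bsub>nottingham\<^esub> g \<otimes>\<^bsub>nottingham\<^esub> inv\<^bsub>nottingham\<^esub> f \<otimes>\<^bsub>nottingham\<^esub> inv\<^bsub>nottingham\<^esub> g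
        = (f \<otimes>\<^bsub>nottingham\<^esub> g) \<otimes>\<^bsub>nottingham\<^esub> inv\<^bsub>nottingham\<^esub> (g \<otimes>\<^bsub>nottingham\<^esub> f)"
      using c by (simp add: m_assoc inv_mult_group)
    also have "\<dots> = (f oo g) oo fps_inv (g oo f)"
      using inv_nottingham[OF carrier_nottingham_compose[OF c(2,1)]] by (simp add: mult_nottingham)
    finally show "nlead (k + l) (depth_br k l a b) (f \<otimes>\<^bsub>nottingham\<^esub> g
        \<otimes>\<^bsub>nottingham\<^esub> inv\<^bsub>nottingham\<^esub> f \<otimes>\<^bsub>nottingham\<^esub> inv\<^bsub>nottingham\<^esub> g)"
      using nlead_comm[OF fg] by simp
  next
    fix k a and f :: "'a fps"
    assume f: "nlead k a f"
    then have "f \<in> carrier nottingham" by (simp add: nlead_def)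
    then show "nlead k (- a) (inv\<^bsub>nottingham\<^esub> f)"
      using nlead_inv[OF f] inv_nottingham by metis
  next
    fix k :: nat
    have "depth_br (Suc k) k 1 (1 :: 'a) \<noteq> 0" by (simp add: depth_br_def)
    then show "\<exists>i\<ge>k. \<exists>j\<ge>k. \<exists>A B. depth_br i j A (B :: 'a) \<noteq> 0" using le_SucI by blast
  next
    show "\<exists>A::'a. A + A \<noteq> 0" using two by (intro exI[of _ 1]) simp
  next
    fix U :: "'a fps set"
    show "openin nottingham_topology U \<longleftrightarrow> U \<subseteq> carrier nottingham \<and>
      (\<forall>x\<in>U. \<exists>k\<ge>1. \<forall>g A. nlead k A g \<longrightarrow> x \<otimes>\<^bsub>nottingham\<^esub> g \<in> U)"
      unfolding openin_nottingham_iff mult_nottingham using nlead_iff_filtration by metis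
  qed (auto simp: nlead_mult mult_nottingham one_nottingham depth_br_def algebra_simps,
      auto simp: nlead_def)
qed

section \<open>The Nottingham group over a prime field\<close>

lemma of_nat_diff_eq_0_iff:
  "(of_nat u :: 'p::prime_card mod_ring) - of_nat v = 0 \<longleftrightarrow> int CARD('p) dvd int u - int v"
proof -
  have "(of_nat u :: 'p mod_ring) - of_nat v = of_int (int u - int v)" by simp
  then show ?thesis by (simp only: of_int_eq_0_iff_char_dvd semiring_char_mod_ring)
qed

lemma of_nat_eq_0_iff_dvd: "(of_nat u :: 'p::prime_card mod_ring) = 0 \<longleftrightarrow> CARD('p) dvd u"
  using of_nat_diff_eq_0_iff[of u 0, where 'p='p] by simp

lemma funpow_add: "((+) a ^^ n) 0 = of_nat n * (a :: 'a::comm_ring_1)"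
  by (induction n) (simp_all add: algebra_simps)

text \<open>\<open>p\<close> may divide \<open>N\<close>: its \<open>p\<close>-part is handled by
  \<open>\<rho>\<close> being prime to \<open>p\<close>, the remaining factor by the residue 1 and
  the Chinese remainder theorem.\<close>

lemma exists_coprime_residue:
  fixes p N \<rho> :: nat
  assumes p: "prime p" and N: "N \<noteq> 0" and \<rho>: "\<not> p dvd \<rho>"
  shows "\<exists>m. coprime m N \<and> [m = \<rho>] (mod p)"
proof -
  obtain N' where N': "N = p ^ multiplicity p N * N'" "\<not> p dvd N'"
    using multiplicity_decompose'[of N p] N p by (metis prime_gt_1_nat nat_dvd_1_iff_1 less_irrefl)
  have cp: "coprime p N'" using prime_imp_coprime[OF p N'(2)] .
  obtain m where m: "[m = \<rho>] (mod p)" "[m = 1] (mod N')"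
    using binary_chinese_remainder_nat[OF cp] by blast
  have "coprime m N'" using m(2) by (metis cong_imp_coprime coprime_1_left cong_sym)
  moreover have "\<not> p dvd m" using m(1) \<rho> cong_dvd_iff by blast
  then have "coprime m p" using prime_imp_coprime[OF p] coprime_commute by blast
  ultimately have "coprime m (p ^ multiplicity p N * N')" by simp
  then show ?thesis using m(1) N'(1) by metis
qed

locale nottingham_prime =
  fixes p :: nat and ty :: "'p::prime_card itself"
  assumes p_card: "p = CARD('p)" and p5: "5 \<le> p"
begin

abbreviation N :: "'p mod_ring fps monoid" where "N \<equiv> nottingham"

abbreviation gen_open :: "'p mod_ring fps \<Rightarrow> 'p mod_ring fps \<Rightarrow> bool" where
  "gen_open x y \<equiv> openin nottingham_topology (top_generate N nottingham_topology {x, y})"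

lemma p_prime: "prime p"
  using prime_card p_card by metis

lemma two_nonzero: "(2 :: 'p mod_ring) \<noteq> 0"
proof -
  have "\<not> CARD('p) dvd 2" using p5 p_card by (auto dest: dvd_imp_le)
  then show ?thesis using of_nat_eq_0_iff_dvd[of 2, where 'p='p] by simp
qed

sublocale graded_group N nottingham_topology nlead depth_br
  by (rule graded_group_nottingham[OF two_nonzero])

text \<open>Over a prime field the multiples of one nonzero class fill the layer, so depths alone
  decide openness.\<close>

lemma lead_UNIV:
  fixes H :: "'p mod_ring fps set"
  assumes H: "subgroup H N" and a: "a \<in> lead H k" "a \<noteq> 0"
  shows "lead H k = UNIV"
proof -
  have "b \<in> lead H k" for b :: "'p mod_ring"
  proof -
    obtain j where "b / a = of_nat j" using surj_of_nat_mod_ring by blast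
    then have "b = of_nat j * a" using a(2) by (simp add: field_simps)
    then show ?thesis using lead_multiple[OF H a(1), of j] by (simp add: funpow_add)
  qed
  then show ?thesis by blast
qed

definition depths :: "'p mod_ring fps set \<Rightarrow> nat set" where
  "depths H = {n. \<exists>a\<in>lead H n. a \<noteq> 0}"

lemma depthsI: "f \<in> H \<Longrightarrow> nlead n a f \<Longrightarrow> a \<noteq> 0 \<Longrightarrow> n \<in> depths H"
  unfolding depths_def using leadI by blast

lemma depth_set_depths:
  assumes H: "subgroup H N"
  shows "depth_set p (depths H)"
proof
  show "prime p" by (rule p_prime)
  show "5 \<le> p" by (rule p5)
  fix u v assume uv: "u \<in> depths H" "v \<in> depths H" "\<not> int p dvd int u - int v"
  then obtain a b where ab: "a \<in> lead H u" "a \<noteq> 0" "b \<in> lead H v" "b \<noteq> 0"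
    unfolding depths_def by blast
  have "depth_br u v a b \<noteq> 0"
    using uv(3) ab of_nat_diff_eq_0_iff[of u v, where 'p='p] p_card by (simp add: depth_br_def)
  then show "u + v \<in> depths H" using lead_br[OF H ab(1) ab(3)] unfolding depths_def by blast
qed

lemma open_criterion:
  assumes x: "x \<in> carrier N" "y \<in> carrier N"
    and D: "u \<in> depths (generate N {x, y})" "v \<in> depths (generate N {x, y})"
      "w \<in> depths (generate N {x, y})"
    and uv: "\<not> int p dvd int u" "\<not> int p dvd int v" "\<not> int p dvd int u - int v"
      "\<not> int p dvd int u + int v" and g: "gcd (gcd u v) w = 1"
  shows "gen_open x y"
proof -
  have H: "subgroup (generate N {x, y}) N" by (rule generate_is_subgroup) (use x in auto)
  interpret depth_set p "depths (generate N {x, y})" by (rule depth_set_depths[OF H])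
  obtain M where M: "\<And>n. M \<le> n \<Longrightarrow> n \<in> depths (generate N {x, y})"
    using cofinite[OF D(1,2) uv D(3) g] by blast
  show ?thesis
    unfolding top_generate_def
  proof (rule open_closure[OF H])
    fix k assume "M \<le> k"
    then show "lead (generate N {x, y}) k = UNIV"
      using M lead_UNIV[OF H] unfolding depths_def by blast
  qed
qed

text \<open>Modulo \<open>p\<close> the three numbers are \<open>3 u\<close>, \<open>- 2 u\<close>
  and \<open>4 u\<close>, and 2, 3, 4 are invertible because \<open>p \<ge> 5\<close>.\<close>

lemma triple_residue:
  assumes "\<not> int p dvd int u" "int p dvd int v - 3 * int u"
  shows "\<not> int p dvd int v" "\<not> int p dvd int u - int v" "\<not> int p dvd int u + int v"
proof -
  have small: "\<not> int p dvd c * int u" if "c \<in> {2, 3, 4}" for c :: int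
  proof
    assume "int p dvd c * int u"
    then have "int p dvd c" using assms(1) p_prime by (simp add: prime_dvd_mult_iff del: of_nat_dvd_iff)
    then show False using that p5 zdvd_imp_le[of "int p" c] by auto
  qed
  have c: "False" if "int p dvd z" "z + s * (int v - 3 * int u) = c * int u" "c \<in> {2, 3, 4, -2, -3}"
    for z s c
  proof -
    have "int p dvd z + s * (int v - 3 * int u)" using that(1) assms(2) by simp
    then have "int p dvd c * int u" using that(2) by simp
    moreover from this have "int p dvd (- c) * int u" by simp
    ultimately show False using small that(3) by auto
  qed
  show "\<not> int p dvd int v" using c[of "int v" "-1" 3] by auto
  show "\<not> int p dvd int u - int v" using c[of "int u - int v" 1 "-2"] by auto
  show "\<not> int p dvd int u + int v" using c[of "int u + int v" "-1" 4] by auto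
qed

lemma generates_open_generic:
  assumes x: "nlead n a x" "a \<noteq> 0" and y: "nlead m b y" "b \<noteq> 0"
    and n: "\<not> int p dvd int n" "\<not> int p dvd int m" "\<not> int p dvd int n - int m"
      "\<not> int p dvd int n + int m" and g: "coprime m n"
  shows "gen_open x y"
proof (rule open_criterion[where u = n and v = m and w = n, OF L_carrier[OF x(1)] L_carrier[OF y(1)] _ _ _ n])
  show n: "n \<in> depths (generate N {x, y})" by (rule depthsI[OF generate.incl x]) simp
  show "n \<in> depths (generate N {x, y})" by (rule n)
  show "m \<in> depths (generate N {x, y})" by (rule depthsI[OF generate.incl y]) simp
  show "gcd (gcd n m) n = 1" using g by (simp add: coprime_iff_gcd_eq_1 gcd.commute)
qed

lemma cm_generate: "f \<in> generate N S \<Longrightarrow> g \<in> generate N S \<Longrightarrow> S \<subseteq> carrier N \<Longrightarrow> cm f g \<in> generate N S"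
  using cm_in_subgroup generate_is_subgroup by blast

text \<open>For \<open>m\<close> congruent to \<open>n\<close> the bracket of the leading terms
  vanishes. If the commutator nevertheless shows up at distance \<open>i\<close> congruent to
  \<open>n\<close>, its depth is \<open>3 n\<close> mod \<open>p\<close>, a residue suitable for
  \<open>triple_residue\<close>.\<close>

lemma generates_open_equal:
  assumes x: "nlead n a x" "a \<noteq> 0" and y: "nlead m b y" "b \<noteq> 0"
    and n: "\<not> int p dvd int n" "int p dvd int m - int n" "int p dvd int i - int n" and g: "coprime m n"
    and c: "nlead (n + m + i) c (cm x y)" "c \<noteq> 0"
  shows "gen_open x y"
proof (rule open_criterion[where u = n and v = "n + m + i" and w = m, OF L_carrier[OF x(1)] L_carrier[OF y(1)] _ _ _ n(1)])
  have S: "{x, y} \<subseteq> carrier N" using L_carrier x y by blast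
  show "n \<in> depths (generate N {x, y})" by (rule depthsI[OF generate.incl x]) simp
  show "m \<in> depths (generate N {x, y})" by (rule depthsI[OF generate.incl y]) simp
  have "cm x y \<in> generate N {x, y}" by (intro cm_generate S generate.incl) simp_all
  then show "n + m + i \<in> depths (generate N {x, y})" using depthsI[OF _ c] by blast
  have "int p dvd (int m - int n) + (int i - int n)" using n by (intro dvd_add)
  then have t: "int p dvd int (n + m + i) - 3 * int n" by (simp add: algebra_simps)
  show "\<not> int p dvd int (n + m + i)" "\<not> int p dvd int n - int (n + m + i)"
    "\<not> int p dvd int n + int (n + m + i)"
    using triple_residue[OF n(1) t] by blast+
  have "gcd n m = 1" using g by (simp add: coprime_iff_gcd_eq_1 gcd.commute)
  then show "gcd (gcd n (n + m + i)) m = 1" by (metis gcd.assoc gcd.commute gcd_1_nat One_nat_def)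
qed

text \<open>If \<open>p\<close> divides \<open>n\<close>, then \<open>y\<close> and
  \<open>cm x y\<close> have congruent depths and their bracket vanishes to leading order.
  Reappearing at distance \<open>i\<close> congruent to \<open>m\<close>, it has depth
  \<open>3 m\<close> mod \<open>p\<close>.\<close>

lemma generates_open_divisible:
  assumes x: "nlead n a x" "a \<noteq> 0" and y: "nlead m b y" "b \<noteq> 0"
    and n: "int p dvd int n" "\<not> int p dvd int m" "int p dvd int i - int m" and g: "coprime m n"
    and c: "nlead (m + (n + m) + i) c (cm y (cm x y))" "c \<noteq> 0"
  shows "gen_open x y"
proof (rule open_criterion[where u = m and v = "m + (n + m) + i" and w = n, OF L_carrier[OF x(1)] L_carrier[OF y(1)] _ _ _ n(2)])
  have S: "{x, y} \<subseteq> carrier N" using L_carrier x y by blast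
  show "n \<in> depths (generate N {x, y})" by (rule depthsI[OF generate.incl x]) simp
  show "m \<in> depths (generate N {x, y})" by (rule depthsI[OF generate.incl y]) simp
  have "cm y (cm x y) \<in> generate N {x, y}" by (intro cm_generate S generate.incl) simp_all
  then show "m + (n + m) + i \<in> depths (generate N {x, y})" using depthsI[OF _ c] by blast
  have "int p dvd int n + (int i - int m)" using n by (intro dvd_add)
  then have t: "int p dvd int (m + (n + m) + i) - 3 * int m" by (simp add: algebra_simps)
  show "\<not> int p dvd int (m + (n + m) + i)" "\<not> int p dvd int m - int (m + (n + m) + i)"
    "\<not> int p dvd int m + int (m + (n + m) + i)"
    using triple_residue[OF n(2) t] by blast+
  have "gcd m n = 1" using g by (simp add: coprime_iff_gcd_eq_1)
  then show "gcd (gcd m (m + (n + m) + i)) n = 1"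
    by (metis gcd.assoc gcd.commute gcd_1_nat One_nat_def)
qed

subsection \<open>Adjusting coefficients\<close>

text \<open>
  \<open>W\<close> depends on the coefficient of its argument at distance \<open>i\<close> behind the leading one in an affine
  way, with slope \<open>\<kappa> i\<close>, as long as only the coefficient at distance \<open>i\<close> of \<open>W\<close> is looked at.
\<close>

definition adjustable ::
  "nat \<Rightarrow> 'p mod_ring \<Rightarrow> nat \<Rightarrow> (nat \<Rightarrow> 'p mod_ring) \<Rightarrow> ('p mod_ring fps \<Rightarrow> 'p mod_ring fps) \<Rightarrow> bool" where
  "adjustable m b t \<kappa> W \<longleftrightarrow>
    (\<forall>y. nlead m b y \<longrightarrow> W y \<in> carrier N \<and> (\<exists>A. nlead (t + 1) A (W y))) \<and>
    (\<forall>y e i s. nlead m b y \<longrightarrow> 1 \<le> i \<longrightarrow> nlead (m + i) s e \<longrightarrow>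
      nlead (t + i) (\<kappa> i * s) (W (y \<otimes>\<^bsub>N\<^esub> e) \<otimes>\<^bsub>N\<^esub> inv\<^bsub>N\<^esub> (W y)))"

lemma lead_mult_deeper:
  "nlead m b y \<Longrightarrow> nlead (m + i) s e \<Longrightarrow> 1 \<le> i \<Longrightarrow> nlead m b (y \<otimes>\<^bsub>N\<^esub> e)"
  using L_mult[of m b y 0 e] L_lower[of "m + i" s e m] L_pos by fastforce

lemma adjust:
  assumes W: "adjustable m b t \<kappa> W" and y: "nlead m b y" and i: "1 \<le> i"
    and e: "nlead (m + i) s e" and A: "nlead (t + i) A (W y)"
  shows "nlead (t + i) (\<kappa> i * s + A) (W (y \<otimes>\<^bsub>N\<^esub> e))"
proof -
  have "nlead (t + i) (\<kappa> i * s + A) (W (y \<otimes>\<^bsub>N\<^esub> e) \<otimes>\<^bsub>N\<^esub> inv\<^bsub>N\<^esub> (W y) \<otimes>\<^bsub>N\<^esub> W y)"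
    using W y i e A unfolding adjustable_def by (intro L_mult) blast+
  moreover have "W (y \<otimes>\<^bsub>N\<^esub> e) \<in> carrier N" "W y \<in> carrier N"
    using W lead_mult_deeper[OF y e i] y unfolding adjustable_def by blast+
  ultimately show ?thesis by (simp add: m_assoc)
qed

text \<open>The coefficients of \<open>W y\<close> at distances below \<open>I\<close> are cancelled
  one after the other; the one at \<open>I\<close> is then made nonzero. Each change of
  \<open>y\<close> acts only at its own distance and beyond. Slopes are invertible only up to
  \<open>p - 1\<close>, whence \<open>I < p\<close>.\<close>

lemma adjust_depth:
  assumes W: "adjustable m b t \<kappa> W" and \<kappa>: "\<And>i. 1 \<le> i \<Longrightarrow> i < p \<Longrightarrow> \<kappa> i \<noteq> 0" and m: "1 \<le> m"
    and I: "1 \<le> I" "I < p"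
  shows "\<exists>y c. nlead m b y \<and> nlead (t + I) c (W y) \<and> c \<noteq> 0"
proof -
  have "i < p \<Longrightarrow> \<exists>y A. nlead m b y \<and> nlead (t + i) A (W y)" if "1 \<le> i" for i
    using that
  proof (induction i rule: nat_induct_at_least)
    case base
    obtain y where y: "nlead m b y" using L_surj m by blast
    then show ?case using W unfolding adjustable_def by blast
  next
    case (Suc i)
    then obtain y A where y: "nlead m b y" "nlead (t + i) A (W y)" by auto
    have "\<exists>e. nlead (m + i) (- A / \<kappa> i) e" by (rule L_surj) (use m in simp)
    then obtain e where e: "nlead (m + i) (- A / \<kappa> i) e" by blast
    have "nlead (t + i) 0 (W (y \<otimes>\<^bsub>N\<^esub> e))"
      using adjust[OF W y(1) Suc.hyps e y(2)] \<kappa>[OF Suc.hyps] Suc.prems by simp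
    then have "\<exists>A. nlead (t + Suc i) A (W (y \<otimes>\<^bsub>N\<^esub> e))"
      using L_Suc[of "t + i"] Suc.hyps by simp
    then show ?case using lead_mult_deeper[OF y(1) e Suc.hyps] by blast
  qed
  from this[OF I] obtain y A where y: "nlead m b y" "nlead (t + I) A (W y)" by blast
  show ?thesis
  proof (cases "A = 0")
    case True
    have "\<exists>e :: 'p mod_ring fps. nlead (m + I) 1 e" by (rule L_surj) (use m in simp)
    then obtain e :: "'p mod_ring fps" where e: "nlead (m + I) 1 e" by blast
    show ?thesis
      using adjust[OF W y(1) I(1) e y(2)] lead_mult_deeper[OF y(1) e I(1)] True \<kappa>[OF I] by auto
  qed (use y in blast)
qed

text \<open>At distance 1 nothing has to be cancelled beforehand, so each of \<open>W1\<close>,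
  \<open>W2\<close> merely forbids one value of \<open>s\<close>, and the field has more than two
  elements.\<close>

lemma adjust_two:
  assumes W1: "adjustable m b t1 \<kappa>1 W1" "\<kappa>1 1 \<noteq> 0" and W2: "adjustable m b t2 \<kappa>2 W2" "\<kappa>2 1 \<noteq> 0"
    and m: "1 \<le> m"
  shows "\<exists>y c1 c2. nlead m b y \<and> nlead (t1 + 1) c1 (W1 y) \<and> c1 \<noteq> 0 \<and>
    nlead (t2 + 1) c2 (W2 y) \<and> c2 \<noteq> 0"
proof -
  obtain y where y: "nlead m b y" using L_surj m by blast
  obtain A1 A2 where A: "nlead (t1 + 1) A1 (W1 y)" "nlead (t2 + 1) A2 (W2 y)"
    using W1 W2 y unfolding adjustable_def by blast
  have "\<exists>s. s \<noteq> - A1 / \<kappa>1 1 \<and> s \<noteq> - A2 / \<kappa>2 1"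
  proof (rule ccontr)
    assume "\<not> ?thesis"
    then have "UNIV = {- A1 / \<kappa>1 1, - A2 / \<kappa>2 1}" by blast
    then have "CARD('p mod_ring) = card (set [- A1 / \<kappa>1 1, - A2 / \<kappa>2 1])" by simp
    also have "\<dots> \<le> 2" by (rule order_trans[OF card_length]) simp
    finally have "CARD('p mod_ring) \<le> 2" .
    then show False using p5 p_card by simp
  qed
  then obtain s where s: "s \<noteq> - A1 / \<kappa>1 1" "s \<noteq> - A2 / \<kappa>2 1" by blast
  have "\<exists>e. nlead (m + 1) s e" by (rule L_surj) simp
  then obtain e where e: "nlead (m + 1) s e" by blast
  have nz: "\<kappa> * s + A \<noteq> 0" if "s \<noteq> - A / \<kappa>" "\<kappa> \<noteq> 0" for \<kappa> A
  proof
    assume "\<kappa> * s + A = 0"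
    then have "s * \<kappa> = - A" by (simp add: eq_neg_iff_add_eq_0 mult.commute)
    with that show False by (metis nonzero_eq_divide_eq)
  qed
  have "nlead (t1 + 1) (\<kappa>1 1 * s + A1) (W1 (y \<otimes>\<^bsub>N\<^esub> e))"
    by (rule adjust[OF W1(1) y _ e A(1)]) simp
  moreover have "nlead (t2 + 1) (\<kappa>2 1 * s + A2) (W2 (y \<otimes>\<^bsub>N\<^esub> e))"
    by (rule adjust[OF W2(1) y _ e A(2)]) simp
  moreover have "nlead m b (y \<otimes>\<^bsub>N\<^esub> e)" by (rule lead_mult_deeper[OF y e]) simp
  ultimately show ?thesis using nz[OF s(1) W1(2)] nz[OF s(2) W2(2)] by blast
qed

text \<open>The factor \<open>n - (m + i)\<close> of the bracket with the new term reduces to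
  \<open>- i\<close>, because \<open>m\<close> and \<open>n\<close> agree mod
  \<open>p\<close>.\<close>

lemma adjustable_cm:
  assumes x: "nlead n a x" and mn: "int p dvd int m - int n"
  shows "adjustable m b (n + m) (\<lambda>i. - of_nat i * a) (cm x)"
  unfolding adjustable_def
proof (intro conjI allI impI)
  note xc = L_carrier[OF x]
  have mn0: "(of_nat m :: 'p mod_ring) - of_nat n = 0"
    using mn of_nat_diff_eq_0_iff[of m n, where 'p='p] p_card by simp
  fix y assume y: "nlead m b y"
  show "cm x y \<in> carrier N" using xc L_carrier[OF y] by simp
  have "nlead (n + m) 0 (cm x y)"
    using L_cm[OF x y] mn0 by (simp add: depth_br_def)
  then show "\<exists>A. nlead (n + m + 1) A (cm x y)"
    using L_Suc[of "n + m"] L_pos[OF x] by simp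
  fix e :: "'p mod_ring fps" and i s assume i: "1 \<le> i" and e: "nlead (m + i) s e"
  have "nlead (n + m + i) (depth_br (n + i) m 0 b + depth_br n (m + i) a s)
      (cm (x \<otimes>\<^bsub>N\<^esub> \<one>\<^bsub>N\<^esub>) (y \<otimes>\<^bsub>N\<^esub> e) \<otimes>\<^bsub>N\<^esub> inv\<^bsub>N\<^esub> (cm x y))"
    by (rule perturb[OF x y L_one e i]) (use i in simp)
  moreover have "depth_br (n + i) m 0 b + depth_br n (m + i) a s = - of_nat i * a * s"
    using mn0 by (simp add: depth_br_def algebra_simps)
  ultimately show "nlead (n + m + i) (- of_nat i * a * s)
      (cm x (y \<otimes>\<^bsub>N\<^esub> e) \<otimes>\<^bsub>N\<^esub> inv\<^bsub>N\<^esub> (cm x y))"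
    using xc by simp
qed

text \<open>The new term enters twice, through the outer and the inner \<open>y\<close>. With
  \<open>n = 0\<close> mod \<open>p\<close> the contributions are \<open>- i m\<close> and
  \<open>i (m + i)\<close>, whose sum \<open>i^2\<close> does not depend on
  \<open>m\<close>.\<close>

lemma adjustable_cm_cm:
  assumes x: "nlead n a x" and n: "int p dvd int n"
  shows "adjustable m b (m + (n + m)) (\<lambda>i. of_nat i ^ 2 * a * b) (\<lambda>y. cm y (cm x y))"
  unfolding adjustable_def
proof (intro conjI allI impI)
  note xc = L_carrier[OF x]
  have n0: "(of_nat n :: 'p mod_ring) = 0"
    using n of_nat_eq_0_iff_dvd[of n, where 'p='p] p_card by simp
  fix y assume y: "nlead m b y"
  note yc = L_carrier[OF y]
  show "cm y (cm x y) \<in> carrier N" using xc yc by simp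
  have w: "nlead (n + m) (depth_br n m a b) (cm x y)" by (rule L_cm[OF x y])
  have "nlead (m + (n + m)) 0 (cm y (cm x y))"
    using L_cm[OF y w] n0 by (simp add: depth_br_def)
  then show "\<exists>A. nlead (m + (n + m) + 1) A (cm y (cm x y))"
    using L_Suc[of "m + (n + m)"] L_pos[OF x] by simp
  fix e :: "'p mod_ring fps" and i s assume i: "1 \<le> i" and e: "nlead (m + i) s e"
  note ec = L_carrier[OF e]
  define w where "w = cm x y"
  define w' where "w' = cm x (y \<otimes>\<^bsub>N\<^esub> e)"
  \<comment> \<open>\<open>perturb\<close> wants the change as a right factor; conjugating
    \<open>w'\<close> times the inverse of \<open>w\<close> achieves this without altering its
    leading term.\<close>
  define \<epsilon> where "\<epsilon> = inv\<^bsub>N\<^esub> w \<otimes>\<^bsub>N\<^esub> (w' \<otimes>\<^bsub>N\<^esub> inv\<^bsub>N\<^esub> w) \<otimes>\<^bsub>N\<^esub> inv\<^bsub>N\<^esub> (inv\<^bsub>N\<^esub> w)"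
  have wc: "w \<in> carrier N" "w' \<in> carrier N" using xc yc ec by (simp_all add: w_def w'_def)
  have "nlead (n + m + i) (depth_br (n + i) m 0 b + depth_br n (m + i) a s)
      (cm (x \<otimes>\<^bsub>N\<^esub> \<one>\<^bsub>N\<^esub>) (y \<otimes>\<^bsub>N\<^esub> e) \<otimes>\<^bsub>N\<^esub> inv\<^bsub>N\<^esub> (cm x y))"
    by (rule perturb[OF x y L_one e i]) (use i in simp)
  then have "nlead (n + m + i) (depth_br n (m + i) a s) (w' \<otimes>\<^bsub>N\<^esub> inv\<^bsub>N\<^esub> w)"
    using xc by (simp add: w_def w'_def)
  then have eps: "nlead (n + m + i) (depth_br n (m + i) a s) \<epsilon>"
    unfolding \<epsilon>_def using wc by (intro L_conj) simp_all
  have w\<epsilon>: "w \<otimes>\<^bsub>N\<^esub> \<epsilon> = w'"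
  proof -
    have "w \<otimes>\<^bsub>N\<^esub> \<epsilon> = (w \<otimes>\<^bsub>N\<^esub> inv\<^bsub>N\<^esub> w) \<otimes>\<^bsub>N\<^esub> w' \<otimes>\<^bsub>N\<^esub> (inv\<^bsub>N\<^esub> w \<otimes>\<^bsub>N\<^esub> w)"
      using wc by (simp only: \<epsilon>_def inv_inv m_assoc m_closed inv_closed)
    then show ?thesis using wc by simp
  qed
  have "nlead (m + (n + m) + i)
      (depth_br (m + i) (n + m) s (depth_br n m a b) + depth_br m (n + m + i) b (depth_br n (m + i) a s))
      (cm (y \<otimes>\<^bsub>N\<^esub> e) (w \<otimes>\<^bsub>N\<^esub> \<epsilon>) \<otimes>\<^bsub>N\<^esub> inv\<^bsub>N\<^esub> (cm y w))"
    by (rule perturb[OF y L_cm[OF x y, folded w_def] e eps i])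
  moreover have "depth_br (m + i) (n + m) s (depth_br n m a b) + depth_br m (n + m + i) b (depth_br n (m + i) a s)
      = of_nat i ^ 2 * a * b * s"
    using n0 by (simp add: depth_br_def algebra_simps power2_eq_square)
  ultimately show "nlead (m + (n + m) + i) (of_nat i ^ 2 * a * b * s)
      (cm (y \<otimes>\<^bsub>N\<^esub> e) (cm x (y \<otimes>\<^bsub>N\<^esub> e)) \<otimes>\<^bsub>N\<^esub> inv\<^bsub>N\<^esub> (cm y (cm x y)))"
    by (simp add: w\<epsilon>) (simp add: w_def w'_def)
qed

lemma of_nat_nonzero: "1 \<le> i \<Longrightarrow> i < p \<Longrightarrow> (of_nat i :: 'p mod_ring) \<noteq> 0"
  using of_nat_eq_0_iff_dvd[of i, where 'p='p] p_card by (auto dest: dvd_imp_le)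

subsection \<open>Common neighbours\<close>

lemma int_p_dvd_2: "int p dvd 2 * z \<Longrightarrow> int p dvd z"
  using p_prime p5 prime_dvd_mult_iff[of "int p" 2 z] zdvd_imp_le[of "int p" 2] by auto

lemma exists_depth:
  assumes "n1 \<noteq> 0" "n2 \<noteq> 0" "\<not> int p dvd int \<rho>"
  obtains m where "coprime m n1" "coprime m n2" "int p dvd int m - int \<rho>" "\<not> int p dvd int m" "1 \<le> m"
proof -
  have "\<not> p dvd \<rho>" using assms(3) by simp
  then obtain m where m: "coprime m (n1 * n2)" "[m = \<rho>] (mod p)"
    using exists_coprime_residue[OF p_prime, of "n1 * n2" \<rho>] assms by auto
  have d: "int p dvd int m - int \<rho>"
    using m(2) by (metis cong_int_iff cong_iff_dvd_diff)
  have nd: "\<not> int p dvd int m"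
  proof
    assume "int p dvd int m"
    then have "int p dvd int m - (int m - int \<rho>)" using d by (rule dvd_diff)
    then show False using assms(3) by simp
  qed
  then have "1 \<le> m" by (cases m) auto
  moreover have "coprime m n1" "coprime m n2" using m(1) by simp_all
  ultimately show thesis using that d nd by blast
qed

lemma exists_residue: "\<not> int p dvd int \<rho> \<Longrightarrow> \<exists>i. 1 \<le> i \<and> i < p \<and> int p dvd int i - int \<rho>"
proof -
  assume "\<not> int p dvd int \<rho>"
  then have "\<rho> mod p \<noteq> 0" by (metis dvd_eq_mod_eq_0 of_nat_dvd_iff)
  moreover have "[int (\<rho> mod p) = int \<rho>] (mod int p)" by (simp add: cong_def zmod_int)
  then have "int p dvd int (\<rho> mod p) - int \<rho>" by (simp only: cong_iff_dvd_diff)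
  ultimately show ?thesis using p5 by (intro exI[of _ "\<rho> mod p"]) (simp add: Suc_le_eq)
qed

lemma dvd_combine:
  "int p dvd x \<Longrightarrow> int p dvd y \<Longrightarrow> z = s * x + t * y \<Longrightarrow> int p dvd z"
  by simp

text \<open>For \<open>m\<close> congruent to \<open>2 n\<close> the two numbers are
  \<open>- n\<close> and \<open>3 n\<close> mod \<open>p\<close>.\<close>

lemma double_residue:
  assumes n: "\<not> int p dvd int n" and m: "int p dvd int m - int (2 * n)"
  shows "\<not> int p dvd int n - int m" "\<not> int p dvd int n + int m"
proof -
  have nd: "\<not> int p dvd z" if "z = s * int n + t * (int m - int (2 * n))" "s \<in> {-1, 3}" for z s t
  proof
    assume "int p dvd z"
    from dvd_combine[OF this m, of "s * int n" 1 "- t"] that(1)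
    have "int p dvd s * int n" by simp
    then have "int p dvd s" using n p_prime by (simp add: prime_dvd_mult_iff del: of_nat_dvd_iff)
    then show False using that(2) p5 zdvd_imp_le[of "int p" s] zdvd_imp_le[of "int p" "- s"] by auto
  qed
  show "\<not> int p dvd int n - int m" using nd[of _ "-1" "-1"] by simp
  show "\<not> int p dvd int n + int m" using nd[of _ "3" "1"] by simp
qed

text \<open>If \<open>n2\<close> is congruent to \<open>n1\<close> or \<open>- n1\<close>, the
  residue \<open>2 n1\<close> for \<open>y\<close> suits both elements. Otherwise no residue need be
  left: for \<open>p = 5\<close> the four nonzero ones are \<open>n1\<close>, \<open>- n1\<close>,
  \<open>n2\<close>, \<open>- n2\<close>. So \<open>y\<close> takes the residue of \<open>n1\<close>
  and is adjusted for \<open>x1\<close>, while leading terms suffice for \<open>x2\<close>.\<close>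

lemma common_neighbour_coprime:
  assumes x1: "nlead n1 a1 x1" "a1 \<noteq> 0" and x2: "nlead n2 a2 x2" "a2 \<noteq> 0"
    and n: "\<not> int p dvd int n1" "\<not> int p dvd int n2"
  shows "\<exists>y\<in>carrier N. gen_open x1 y \<and> gen_open x2 y"
proof (cases "int p dvd int n1 - int n2 \<or> int p dvd int n1 + int n2")
  case True
  have "\<not> int p dvd int (2 * n1)" using n(1) int_p_dvd_2[of "int n1"] by (metis of_nat_mult of_nat_numeral)
  then obtain m where m: "coprime m n1" "coprime m n2" "int p dvd int m - int (2 * n1)"
    "\<not> int p dvd int m" "1 \<le> m"
    using exists_depth[of n1 n2 "2 * n1"] L_pos[OF x1(1)] L_pos[OF x2(1)] by auto
  obtain y where y: "nlead m (1 :: 'p mod_ring) y" using L_surj m(5) by blast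
  have a: "\<not> int p dvd int n1 - int m" by (rule double_residue(1)[OF n(1) m(3)])
  have b: "\<not> int p dvd int n1 + int m" by (rule double_residue(2)[OF n(1) m(3)])
  have c: "\<not> int p dvd int n2 - int m" "\<not> int p dvd int n2 + int m"
  proof -
    have "int p dvd int n1 + int m \<or> int p dvd int n1 - int m"
      if h: "int p dvd int n2 - int m \<or> int p dvd int n2 + int m"
    proof -
      consider "int p dvd int n1 - int n2" "int p dvd int n2 - int m"
        | "int p dvd int n1 - int n2" "int p dvd int n2 + int m"
        | "int p dvd int n1 + int n2" "int p dvd int n2 - int m"
        | "int p dvd int n1 + int n2" "int p dvd int n2 + int m" using h True by blast
      then show ?thesis
      proof cases
        case 1
        from dvd_combine[OF this, of "int n1 - int m" 1 1] show ?thesis by simp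
      next
        case 2
        from dvd_combine[OF this, of "int n1 + int m" 1 1] show ?thesis by simp
      next
        case 3
        from dvd_combine[OF this, of "int n1 + int m" 1 "-1"] show ?thesis by simp
      next
        case 4
        from dvd_combine[OF this, of "int n1 - int m" 1 "-1"] show ?thesis by simp
      qed
    qed
    then show "\<not> int p dvd int n2 - int m" "\<not> int p dvd int n2 + int m" using a b by blast+
  qed
  show ?thesis
    using generates_open_generic[OF x1 y _ n(1) m(4) a b m(1)]
      generates_open_generic[OF x2 y _ n(2) m(4) c m(2)] L_carrier[OF y] by auto
next
  case False
  obtain m where m: "coprime m n1" "coprime m n2" "int p dvd int m - int n1" "\<not> int p dvd int m" "1 \<le> m"
    using exists_depth[of n1 n2 n1] L_pos[OF x1(1)] L_pos[OF x2(1)] n(1) by auto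
  obtain i where i: "1 \<le> i" "i < p" "int p dvd int i - int n1" using exists_residue[OF n(1)] by blast
  obtain y c where y: "nlead m (1 :: 'p mod_ring) y" and c: "nlead (n1 + m + i) c (cm x1 y)" "c \<noteq> 0"
    using adjust_depth[OF adjustable_cm[OF x1(1) m(3)] _ m(5) i(1,2), of 1] of_nat_nonzero x1(2) by auto
  have 1: "\<not> int p dvd int n2 - int m"
    using False dvd_combine[OF _ m(3), of "int n2 - int m" "int n1 - int n2" "-1" "-1"] by auto
  have 2: "\<not> int p dvd int n2 + int m"
    using False dvd_combine[OF _ m(3), of "int n2 + int m" "int n1 + int n2" "1" "-1"] by auto
  show ?thesis
    using generates_open_equal[OF x1 y _ n(1) m(3) i(3) m(1) c]
      generates_open_generic[OF x2 y _ n(2) m(4) 1 2 m(2)] L_carrier[OF y] by auto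
qed

text \<open>The residue \<open>2 n2\<close> settles \<open>x2\<close> by leading terms alone, which
  leaves the later coefficients of \<open>y\<close> free to be adjusted for
  \<open>x1\<close>.\<close>

lemma common_neighbour_mixed:
  assumes x1: "nlead n1 a1 x1" "a1 \<noteq> 0" and x2: "nlead n2 a2 x2" "a2 \<noteq> 0"
    and n: "int p dvd int n1" "\<not> int p dvd int n2"
  shows "\<exists>y\<in>carrier N. gen_open x1 y \<and> gen_open x2 y"
proof -
  have "\<not> int p dvd int (2 * n2)" using n(2) int_p_dvd_2[of "int n2"] by (metis of_nat_mult of_nat_numeral)
  then obtain m where m: "coprime m n1" "coprime m n2" "int p dvd int m - int (2 * n2)"
    "\<not> int p dvd int m" "1 \<le> m"
    using exists_depth[of n1 n2 "2 * n2"] L_pos[OF x1(1)] L_pos[OF x2(1)] by auto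
  have a: "\<not> int p dvd int n2 - int m" by (rule double_residue(1)[OF n(2) m(3)])
  have b: "\<not> int p dvd int n2 + int m" by (rule double_residue(2)[OF n(2) m(3)])
  obtain i where i: "1 \<le> i" "i < p" "int p dvd int i - int m" using exists_residue[OF m(4)] by blast
  obtain y c where y: "nlead m (1 :: 'p mod_ring) y"
    and c: "nlead (m + (n1 + m) + i) c (cm y (cm x1 y))" "c \<noteq> 0"
    using adjust_depth[OF adjustable_cm_cm[OF x1(1) n(1)] _ m(5) i(1,2), of 1] of_nat_nonzero x1(2) by auto
  show ?thesis
    using generates_open_divisible[OF x1 y _ n(1) m(4) i(3) m(1) c]
      generates_open_generic[OF x2 y _ n(2) m(4) a b m(2)] L_carrier[OF y] by auto
qed

text \<open>Both elements need the adjustment. At larger distances earlier coefficients would have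
  to be cancelled for both at once; the residue 1 for \<open>m\<close> makes distance 1
  sufficient.\<close>

lemma common_neighbour_divisible:
  assumes x1: "nlead n1 a1 x1" "a1 \<noteq> 0" and x2: "nlead n2 a2 x2" "a2 \<noteq> 0"
    and n: "int p dvd int n1" "int p dvd int n2"
  shows "\<exists>y\<in>carrier N. gen_open x1 y \<and> gen_open x2 y"
proof -
  have "\<not> int p dvd int 1" using p5 zdvd_imp_le[of "int p" 1] by auto
  then obtain m where m: "coprime m n1" "coprime m n2" "int p dvd int m - int 1" "\<not> int p dvd int m" "1 \<le> m"
    using exists_depth[of n1 n2 1] L_pos[OF x1(1)] L_pos[OF x2(1)] by auto
  have i: "int p dvd int 1 - int m" using m(3) by (metis dvd_diff_commute)
  obtain y c1 c2 where y: "nlead m (1 :: 'p mod_ring) y"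
    and c1: "nlead (m + (n1 + m) + 1) c1 (cm y (cm x1 y))" "c1 \<noteq> 0"
    and c2: "nlead (m + (n2 + m) + 1) c2 (cm y (cm x2 y))" "c2 \<noteq> 0"
    using adjust_two[OF adjustable_cm_cm[OF x1(1) n(1)] _ adjustable_cm_cm[OF x2(1) n(2)] _ m(5), of 1]
      x1(2) x2(2) by auto
  show ?thesis
    using generates_open_divisible[OF x1 y _ n(1) m(4) i m(1) c1]
      generates_open_divisible[OF x2 y _ n(2) m(4) i m(2) c2] L_carrier[OF y] by auto
qed

theorem diameter_nottingham: "graph_diameter (proper_virt_gen_graph N nottingham_topology) = 2"
proof (rule diameter_2)
  fix x1 x2 assume "x1 \<in> carrier N" "x1 \<noteq> \<one>\<^bsub>N\<^esub>" "x2 \<in> carrier N" "x2 \<noteq> \<one>\<^bsub>N\<^esub>"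
  then obtain n1 a1 n2 a2 where x: "nlead n1 a1 x1" "a1 \<noteq> 0" "nlead n2 a2 x2" "a2 \<noteq> 0"
    using depth_exists by meson
  show "\<exists>y\<in>carrier N. gen_open x1 y \<and> gen_open x2 y"
    using common_neighbour_coprime[OF x] common_neighbour_mixed[OF x]
      common_neighbour_mixed[OF x(3,4,1,2)] common_neighbour_divisible[OF x] by blast
qed

end

section \<open>Loop algebras of traceless matrices\<close>

text \<open>The triple \<open>(a, b, c)\<close> stands for the matrix with rows \<open>(a, b)\<close> and \<open>(c, -a)\<close>.\<close>

type_synonym 'f sl2 = "'f \<times> 'f \<times> 'f"

text \<open>The commutator of the two matrices.\<close>

fun sl_br :: "'f::field sl2 \<Rightarrow> 'f sl2 \<Rightarrow> 'f sl2" where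
  "sl_br (a, b, c) (a', b', c') = (b * c' - b' * c, 2 * (a * b' - a' * b), 2 * (c * a' - c' * a))"

text \<open>The trace of the product of the two matrices, an invariant symmetric form.\<close>

fun sl_tr :: "'f::field sl2 \<Rightarrow> 'f sl2 \<Rightarrow> 'f" where
  "sl_tr (a, b, c) (a', b', c') = 2 * a * a' + b * c' + b' * c"

fun sl_scale :: "'f::field \<Rightarrow> 'f sl2 \<Rightarrow> 'f sl2" where
  "sl_scale s (a, b, c) = (s * a, s * b, s * c)"

lemma sl_br_add_left: "sl_br (A + A') B = sl_br A B + sl_br A' B"
  by (cases A; cases A'; cases B) (simp add: algebra_simps)

lemma sl_br_add_right: "sl_br A (B + B') = sl_br A B + sl_br A B'"
  by (cases A; cases B'; cases B) (simp add: algebra_simps)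

lemma sl_br_scale_left: "sl_br (sl_scale s A) B = sl_scale s (sl_br A B)"
  by (cases A; cases B) (simp add: algebra_simps)

lemma sl_br_scale_right: "sl_br A (sl_scale s B) = sl_scale s (sl_br A B)"
  by (cases A; cases B) (simp add: algebra_simps)

lemma sl_br_swap: "sl_br B A = sl_scale (- 1) (sl_br A B)"
  by (cases A; cases B) (simp add: algebra_simps)

lemma sl_scale_scale: "sl_scale s (sl_scale t A) = sl_scale (s * t) A"
  by (cases A) simp

lemma sl_scale_add_left: "sl_scale (s + t) A = sl_scale s A + sl_scale t A"
  by (cases A) (simp add: algebra_simps)

lemma sl_scale_add_right: "sl_scale s (A + B) = sl_scale s A + sl_scale s B"
  by (cases A; cases B) (simp add: algebra_simps)

lemma sl_scale_1 [simp]: "sl_scale 1 A = A"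
  by (cases A) simp

lemma sl_scale_0 [simp]: "sl_scale 0 A = 0"
  by (cases A) (simp add: zero_prod_def)

lemma sl_tr_commute: "sl_tr A B = sl_tr B A"
  by (cases A; cases B) (simp add: algebra_simps)

lemma sl_tr_add_left: "sl_tr (A + A') B = sl_tr A B + sl_tr A' B"
  by (cases A; cases A'; cases B) (simp add: algebra_simps)

lemma sl_tr_scale_left: "sl_tr (sl_scale s A) B = s * sl_tr A B"
  by (cases A; cases B) (simp add: algebra_simps)

text \<open>Up to sign the Gram determinant of \<open>A\<close>, \<open>B\<close> for the trace
  form. If it and 2 are nonzero, \<open>A\<close>, \<open>B\<close> and their bracket form a basis,
  by \<open>sl_basis\<close>.\<close>

definition sl_disc :: "'f::field sl2 \<Rightarrow> 'f sl2 \<Rightarrow> 'f" where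
  "sl_disc A B = sl_tr A B ^ 2 - sl_tr A A * sl_tr B B"

lemma sl_disc_commute: "sl_disc A B = sl_disc B A"
  by (simp add: sl_disc_def sl_tr_commute[of A B])

lemma sl_tr_br_br: "sl_tr (sl_br A B) (sl_br A B) = 2 * sl_disc A B"
  by (cases A; cases B) (simp add: sl_disc_def algebra_simps power2_eq_square)

text \<open>The bracket of \<open>A\<close> and \<open>B\<close> is orthogonal to both, so
  coordinates are obtained from traces as for a Gram matrix; the denominators are cleared.\<close>

lemma sl_basis:
  "sl_scale (2 * sl_disc A B) E = sl_scale (sl_tr E (sl_br A B)) (sl_br A B)
    + sl_scale (2 * (sl_tr A B * sl_tr E B - sl_tr B B * sl_tr E A)) A
    + sl_scale (2 * (sl_tr A B * sl_tr E A - sl_tr A A * sl_tr E B)) B"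
  by (cases A; cases B; cases E) (simp add: sl_disc_def algebra_simps power2_eq_square)

subsection \<open>Words\<close>

text \<open>The elements of bidegree \<open>(a, b)\<close> of the graded Lie ring generated by \<open>A\<close> and \<open>B\<close>.\<close>

inductive bihom :: "'f::field sl2 \<Rightarrow> 'f sl2 \<Rightarrow> nat \<Rightarrow> nat \<Rightarrow> 'f sl2 \<Rightarrow> bool" for A B where
  fst: "bihom A B 1 0 A"
| snd: "bihom A B 0 1 B"
| br: "bihom A B a b E \<Longrightarrow> bihom A B a' b' E' \<Longrightarrow> bihom A B (a + a') (b + b') (sl_br E E')"
| add: "bihom A B a b E \<Longrightarrow> bihom A B a b E' \<Longrightarrow> bihom A B a b (E + E')"

text \<open>Scalars of the prime field are repeated sums. \<open>bihom\<close> has no rule for 0, so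
  the sum starts with one copy of \<open>E\<close> and adds \<open>s - 1\<close> further
  ones.\<close>

lemma bihom_scale:
  fixes A :: "'p::prime_card mod_ring sl2"
  assumes "bihom A B a b E"
  shows "bihom A B a b (sl_scale s E)"
proof -
  obtain j where j: "s - 1 = of_nat j" using surj_of_nat_mod_ring by blast
  have "bihom A B a b (sl_scale (1 + of_nat i) E)" for i
  proof (induction i)
    case (Suc i)
    have "E + sl_scale (1 + of_nat i) E = sl_scale (1 + of_nat (Suc i)) E"
      by (simp only: of_nat_Suc sl_scale_add_left sl_scale_1)
    then show ?case using bihom.add[OF assms Suc] by simp
  qed (use assms in simp)
  moreover have "s = 1 + of_nat j" using j by (simp add: algebra_simps)
  ultimately show ?thesis by metis
qed

lemma bihom_swap: "bihom A B a b E \<Longrightarrow> bihom B A b a E"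
proof (induction rule: bihom.induct)
  case fst
  show ?case by (rule bihom.snd)
next
  case snd
  show ?case by (rule bihom.fst)
qed (rule bihom.intros; assumption)+

lemma bihom_unscale:
  fixes A :: "'p::prime_card mod_ring sl2"
  assumes "bihom A B a b (sl_scale s E)" "s \<noteq> 0"
  shows "bihom A B a b E"
  using bihom_scale[OF assms(1), of "1 / s"] assms(2) by (simp add: sl_scale_scale)

context
  fixes A B :: "'p::prime_card mod_ring sl2"
  assumes two: "(2 :: 'p mod_ring) \<noteq> 0"
    and g: "sl_tr A B \<noteq> 0" and d: "sl_disc A B \<noteq> 0" and b: "sl_tr B B \<noteq> 0"
begin

private abbreviation "C \<equiv> sl_br A B"

text \<open>\<open>C\<close> is an eigenvector of \<open>ad B ad B\<close> and of
  \<open>ad A ad B\<close>, with eigenvalues \<open>2 tr(B B)\<close> and \<open>2 tr(A B)\<close>.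
  It therefore reappears after shifts of the bidegree by (0, 2) and (1, 1).\<close>

lemma bihom_C: "bihom A B (1 + i) (1 + i + 2 * j) C"
proof -
  have step_b: "bihom A B a (b + 2) C" if "bihom A B a b C" for a b
  proof -
    have "bihom A B (0 + (0 + a)) (1 + (1 + b)) (sl_br B (sl_br B C))"
      by (intro bihom.intros that)
    moreover have "sl_br B (sl_br B C) = sl_scale (2 * sl_tr B B) C"
      by (cases A; cases B) (simp add: algebra_simps)
    ultimately show ?thesis
      using bihom_unscale[of A B a "b + 2" "2 * sl_tr B B" C] two b by simp
  qed
  have step_ab: "bihom A B (a + 1) (b + 1) C" if "bihom A B a b C" for a b
  proof -
    have "bihom A B (1 + (0 + a)) (0 + (1 + b)) (sl_br A (sl_br B C))"
      by (intro bihom.intros that)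
    moreover have "sl_br A (sl_br B C) = sl_scale (2 * sl_tr A B) C"
      by (cases A; cases B) (simp add: algebra_simps)
    ultimately show ?thesis
      using bihom_unscale[of A B "a + 1" "b + 1" "2 * sl_tr A B" C] two g by simp
  qed
  have "bihom A B (1 + 0) (0 + 1) C" by (intro bihom.intros)
  then have "bihom A B (1 + i) (1 + i) C"
    by (induction i) (use step_ab in \<open>simp_all add: add.commute\<close>)
  then show ?thesis
  proof (induction j)
    case (Suc j)
    then show ?case using step_b[of "1 + i" "1 + i + 2 * j"] by (simp add: algebra_simps)
  qed simp
qed

lemma bihom_even:
  assumes "1 \<le> a" "a \<le> b'" "even (a + b')"
  shows "bihom A B a b' C"
proof -
  have "even (b' - a)" using assms by simp
  then obtain j where "b' - a = 2 * j" by blast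
  then have "a = 1 + (a - 1)" "b' = 1 + (a - 1) + 2 * j" using assms by auto
  then show ?thesis using bihom_C[of "a - 1" j] by metis
qed

text \<open>The brackets of \<open>C\<close> with \<open>A\<close> and with \<open>B\<close> both
  lie in the span of \<open>A\<close> and \<open>B\<close>. Solving this linear system for
  \<open>A\<close> and \<open>B\<close> costs a division by \<open>2 sl_disc A B\<close>.\<close>

lemma bihom_odd:
  assumes "2 \<le> a" "a < b'" "odd (a + b')"
  shows "bihom A B a b' A" "bihom A B a b' B"
proof -
  obtain b1 where b1: "b' = b1 + 1" using assms by (cases b') auto
  obtain a1 where a1: "a = a1 + 1" using assms by (cases a) auto
  have "bihom A B (a + 0) (b1 + 1) (sl_br C B)"
    by (intro bihom.intros bihom_even) (use assms b1 in auto)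
  then have X: "bihom A B a b' (sl_br C B)" using b1 by simp
  have "bihom A B (a1 + 1) (b' + 0) (sl_br C A)"
    by (intro bihom.intros bihom_even) (use assms a1 in auto)
  then have Y: "bihom A B a b' (sl_br C A)" using a1 by simp
  have "sl_scale (sl_tr A A) (sl_br C B) + sl_scale (- sl_tr A B) (sl_br C A)
      = sl_scale (- 2 * sl_disc A B) A"
    by (cases A; cases B) (simp add: sl_disc_def algebra_simps power2_eq_square)
  then have "bihom A B a b' (sl_scale (- 2 * sl_disc A B) A)"
    using bihom.add[OF bihom_scale[OF X, of "sl_tr A A"] bihom_scale[OF Y, of "- sl_tr A B"]] by simp
  then show "bihom A B a b' A" by (rule bihom_unscale) (use two d in simp)
  have "sl_scale (sl_tr B B) (sl_br C A) + sl_scale (- sl_tr A B) (sl_br C B)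
      = sl_scale (2 * sl_disc A B) B"
    by (cases A; cases B) (simp add: sl_disc_def algebra_simps power2_eq_square)
  then have "bihom A B a b' (sl_scale (2 * sl_disc A B) B)"
    using bihom.add[OF bihom_scale[OF Y, of "sl_tr B B"] bihom_scale[OF X, of "- sl_tr A B"]] by simp
  then show "bihom A B a b' B" by (rule bihom_unscale) (use two d in simp)
qed

end

text \<open>\<open>C\<close> occurs in even bidegrees, \<open>A\<close> and \<open>B\<close> in odd
  ones. As \<open>l\<close> is even, trading one \<open>B\<close> for \<open>l\<close> copies of
  \<open>A\<close> keeps the total degree but flips the parity, so each large degree hosts all
  three. If the square of \<open>B\<close> has trace 0, the roles of \<open>A\<close> and
  \<open>B\<close> are swapped.\<close>

lemma bihom_span:
  fixes A :: "'p::prime_card mod_ring sl2"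
  assumes two: "(2 :: 'p mod_ring) \<noteq> 0" and d: "sl_disc A B \<noteq> 0"
    and g: "sl_tr A B \<noteq> 0" and ab: "sl_tr A A \<noteq> 0 \<or> sl_tr B B \<noteq> 0"
    and l: "even l" "2 \<le> (l::nat)"
  shows "\<exists>J. \<forall>n\<ge>J. \<exists>a b a' b'. a + b * l = n \<and> a' + b' * l = n \<and>
    bihom A B a b A \<and> bihom A B a b B \<and> bihom A B a' b' (sl_br A B)"
proof (cases "sl_tr B B = 0")
  case False
  have "\<exists>a b a' b'. a + b * l = n \<and> a' + b' * l = n \<and>
    bihom A B a b A \<and> bihom A B a b B \<and> bihom A B a' b' (sl_br A B)"
    if n: "(2 * l + 5) * l + 2 \<le> n" for n
  proof -
    \<comment> \<open>The shift by 2 meets the bound \<open>2 \<le> a\<close> of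
      \<open>bihom_odd\<close>; the threshold on \<open>n\<close> makes \<open>b\<close> large
      enough that even \<open>a + l\<close> stays below \<open>b - 1\<close>.\<close>
    define a where "a = 2 + (n - 2) mod l"
    define b where "b = (n - 2) div l"
    have a: "2 \<le> a" "a < l + 2" using l by (auto simp: a_def)
    have "(n - 2) mod l + (n - 2) div l * l = n - 2" by simp
    then have nab: "a + b * l = n" using n by (simp add: a_def b_def)
    have "(2 * l + 5) * l \<le> n - 2" using n by simp
    then have b: "2 * l + 5 \<le> b" unfolding b_def using l by (simp add: less_eq_div_iff_mult_less_eq)
    have nab': "(a + l) + (b - 1) * l = n"
      using nab b by (simp add: algebra_simps diff_mult_distrib)
    note bo = bihom_odd[OF two g d False] and be = bihom_even[OF two g d False]
    show ?thesis
    proof (cases "odd (a + b)")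
      case True
      then have "even ((a + l) + (b - 1))" using b l(1) by (cases b) auto
      then have "bihom A B (a + l) (b - 1) (sl_br A B)" using a b by (intro be) auto
      moreover have "bihom A B a b A" "bihom A B a b B"
        using a b by (intro bo[OF _ _ True]; simp)+
      ultimately show ?thesis using nab nab' by blast
    next
      case ev: False
      then have o: "odd ((a + l) + (b - 1))" using b l(1) by (cases b) auto
      have "bihom A B a b (sl_br A B)" using a b ev by (intro be) auto
      moreover have "bihom A B (a + l) (b - 1) A" "bihom A B (a + l) (b - 1) B"
        using a b by (intro bo[OF _ _ o]; simp)+
      ultimately show ?thesis using nab nab' by blast
    qed
  qed
  then show ?thesis by blast
next
  case True
  then have a: "sl_tr A A \<noteq> 0" using ab by blast
  have g': "sl_tr B A \<noteq> 0" and d': "sl_disc B A \<noteq> 0"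
    using g d by (simp_all add: sl_tr_commute[of B A] sl_disc_commute[of B A])
  note bo = bihom_odd[OF two g' d' a, THEN bihom_swap] and be = bihom_even[OF two g' d' a, THEN bihom_swap]
  have C: "bihom A B a b (sl_br A B)" if "bihom A B a b (sl_br B A)" for a b
    using bihom_scale[OF that, of "- 1"] sl_br_swap[of A B] by simp
  have "\<exists>a b a' b'. a + b * l = n \<and> a' + b' * l = n \<and>
    bihom A B a b A \<and> bihom A B a b B \<and> bihom A B a' b' (sl_br A B)"
    if n: "3 * l + 4 \<le> n" for n
  proof -
    \<comment> \<open>With the roles swapped the degree in \<open>B\<close> is the small one: of 2
      and 3 one gives an odd bidegree and the other an even one.\<close>
    have e: "(n - b * l) + b * l = n" "even ((n - b * l) + b) \<longleftrightarrow> even (n + b)" "b < n - b * l"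
      if "b \<in> {2, 3}" for b
      using that n l by auto
    show ?thesis
    proof (cases "odd n")
      case True
      show ?thesis
        using e[of 2] e[of 3] bo[of 2 "n - 2 * l"] C[OF be[of 3 "n - 3 * l"]] True
        by (intro exI[of _ "n - 2 * l"] exI[of _ 2] exI[of _ "n - 3 * l"] exI[of _ 3])
          (auto simp: add.commute)
    next
      case False
      show ?thesis
        using e[of 2] e[of 3] bo[of 3 "n - 3 * l"] C[OF be[of 2 "n - 2 * l"]] False
        by (intro exI[of _ "n - 3 * l"] exI[of _ 3] exI[of _ "n - 2 * l"] exI[of _ 2])
          (auto simp: add.commute)
    qed
  qed
  then show ?thesis by blast
qed

text \<open>The two words have equal total degree, but their degrees in \<open>B\<close> differ by
  2. A difference of 1 would change the parity, whereas \<open>C\<close> is found in even bidegrees;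
  and 2 is still nonzero mod \<open>p\<close>.\<close>

lemma bihom_coincidence:
  fixes A :: "'p::prime_card mod_ring sl2"
  assumes two: "(2 :: 'p mod_ring) \<noteq> 0" and d: "sl_disc A B \<noteq> 0"
    and g: "sl_tr A B \<noteq> 0" and ab: "sl_tr A A \<noteq> 0 \<or> sl_tr B B \<noteq> 0"
    and l: "even l"
  shows "\<exists>a b. bihom A B a (b + 2) (sl_br A B) \<and> bihom A B (a + 2 * l) b (sl_br A B)"
proof (cases "sl_tr B B = 0")
  case False
  have "bihom A B 1 (2 * l + 1 + 2) (sl_br A B)" by (rule bihom_even[OF two g d False]) auto
  moreover have "bihom A B (1 + 2 * l) (2 * l + 1) (sl_br A B)"
    by (rule bihom_even[OF two g d False]) auto
  ultimately show ?thesis by blast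
next
  case True
  then have a: "sl_tr A A \<noteq> 0" using ab by blast
  have g': "sl_tr B A \<noteq> 0" and d': "sl_disc B A \<noteq> 0"
    using g d by (simp_all add: sl_tr_commute[of B A] sl_disc_commute[of B A])
  have C: "bihom A B a b (sl_br A B)" if "bihom B A b a (sl_br B A)" for a b
    using bihom_scale[OF bihom_swap[OF that], of "- 1"] sl_br_swap[of A B] by simp
  have "bihom A B 3 (1 + 2) (sl_br A B)" by (rule C, rule bihom_even[OF two g' d' a]) auto
  moreover have "bihom A B (3 + 2 * l) 1 (sl_br A B)" by (rule C, rule bihom_even[OF two g' d' a]) auto
  ultimately show ?thesis by blast
qed

subsection \<open>Choice of a leading matrix\<close>

lemma exists_nonroot:
  fixes f :: "'p::prime_card mod_ring poly"
  assumes "f \<noteq> 0" "degree f < CARD('p)"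
  shows "\<exists>x. poly f x \<noteq> 0"
proof (rule ccontr)
  assume "\<not> ?thesis"
  then have "{x. poly f x = 0} = UNIV" by auto
  then have "CARD('p mod_ring) \<le> degree f" using card_poly_roots_bound[OF assms(1)] by metis
  then show False using assms(2) by simp
qed

text \<open>On the nilpotent matrices \<open>(u, 1, - u * u)\<close> the trace against a fixed
  nonzero matrix is a nonzero polynomial in \<open>u\<close> of degree at most 2. The product for
  \<open>A1\<close> and \<open>A2\<close> has degree at most 4, hence a nonroot.\<close>

lemma exists_nilpotent:
  fixes A1 A2 :: "'p::prime_card mod_ring sl2"
  assumes p: "5 \<le> CARD('p)" and two: "(2 :: 'p mod_ring) \<noteq> 0" and A: "A1 \<noteq> 0" "A2 \<noteq> 0"
  shows "\<exists>B. sl_tr B B = 0 \<and> sl_tr A1 B \<noteq> 0 \<and> sl_tr A2 B \<noteq> 0"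
proof -
  define q :: "'p mod_ring sl2 \<Rightarrow> 'p mod_ring poly" where "q = (\<lambda>(a, b, c). [:c, 2 * a, - b:])"
  have q0: "q A \<noteq> 0" if "A \<noteq> 0" for A
    using that two by (cases A) (auto simp: q_def zero_prod_def)
  have dq: "degree (q A) \<le> 2" for A
    by (cases A) (auto simp: q_def intro: degree_pCons_le order_trans[OF degree_pCons_le])
  have tr: "sl_tr A (u, 1, - u * u) = poly (q A) u" for A u
    by (cases A) (simp add: q_def algebra_simps)
  have "degree (q A1 * q A2) \<le> 4"
    using order_trans[OF degree_mult_le add_mono[OF dq dq]] by simp
  then obtain u where "poly (q A1 * q A2) u \<noteq> 0"
    using exists_nonroot[of "q A1 * q A2"] q0 A p by (auto simp del: mult_pCons_left mult_pCons_right)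
  then have "sl_tr A1 (u, 1, - u * u) \<noteq> 0" "sl_tr A2 (u, 1, - u * u) \<noteq> 0"
    using tr[of A1 u] tr[of A2 u] by auto
  moreover have "sl_tr (u, 1, - u * u) (u, 1, - u * u) = 0" by (simp add: algebra_simps)
  ultimately show ?thesis by blast
qed

text \<open>What \<open>bihom_span\<close> and \<open>bihom_coincidence\<close> ask of a pair. The
  last clause excludes, in odd characteristic, that both matrices are nilpotent.\<close>

definition generic_pair :: "'f::field sl2 \<Rightarrow> 'f sl2 \<Rightarrow> bool" where
  "generic_pair A B \<longleftrightarrow> sl_tr A B \<noteq> 0 \<and> sl_disc A B \<noteq> 0 \<and> (sl_tr A A \<noteq> 0 \<or> sl_tr B B \<noteq> 0)"

text \<open>For nilpotent \<open>A1\<close> a nilpotent \<open>B0\<close> will not do, so it is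
  moved along the line \<open>B0 + s A1\<close>. The bad \<open>s\<close> are roots of a polynomial
  of degree at most 4: the factor \<open>s\<close> stands for the square of \<open>B\<close>,
  \<open>f1\<close> for the trace with \<open>A2\<close>, \<open>f2\<close> for the discriminant
  with \<open>A2\<close>.\<close>

lemma exists_generic_nilpotent:
  fixes A1 A2 :: "'p::prime_card mod_ring sl2"
  assumes p: "5 \<le> CARD('p)" and two: "(2 :: 'p mod_ring) \<noteq> 0" and A: "A1 \<noteq> 0" "A2 \<noteq> 0"
    and nil: "sl_tr A1 A1 = 0"
  shows "\<exists>B. generic_pair A1 B \<and> generic_pair A2 B"
proof -
  obtain B0 where B0: "sl_tr B0 B0 = 0" "sl_tr A1 B0 \<noteq> 0" "sl_tr A2 B0 \<noteq> 0"
    using exists_nilpotent[OF p two A] by blast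
  define B where "B = (\<lambda>s. B0 + sl_scale s A1)"
  define g1 g2 t \<alpha> where "g1 = sl_tr A1 B0" and "g2 = sl_tr A2 B0" and "t = sl_tr A2 A1"
    and "\<alpha> = sl_tr A2 A2"
  have sc: "sl_tr X (B s) = sl_tr X B0 + s * sl_tr X A1" for X s
    unfolding B_def by (metis sl_tr_add_left sl_tr_commute sl_tr_scale_left)
  have A1B: "sl_tr A1 (B s) = g1" for s using sc[of A1 s] nil by (simp add: g1_def)
  have BB: "sl_tr (B s) (B s) = 2 * s * g1" for s
  proof -
    have "sl_tr (B s) B0 = sl_tr B0 (B s)" "sl_tr (B s) A1 = sl_tr A1 (B s)" "sl_tr B0 A1 = g1"
      unfolding g1_def by (rule sl_tr_commute)+
    then show ?thesis using sc[of "B s" s] sc[of B0 s] A1B[of s] B0(1) by simp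
  qed
  have A2B: "sl_tr A2 (B s) = g2 + s * t" for s using sc[of A2 s] by (simp add: g2_def t_def)
  define f1 where "f1 = [:g2, t:]"
  define f2 where "f2 = f1 * f1 - [:0, 2 * \<alpha> * g1:]"
  define f where "f = [:0, 1:] * (f1 * f2)"
  have f1d: "degree f1 \<le> 1" by (simp add: f1_def)
  have "degree (f1 * f1) \<le> 2" using order_trans[OF degree_mult_le add_mono[OF f1d f1d]] by simp
  then have f2d: "degree f2 \<le> 2" unfolding f2_def by (intro degree_diff_le) auto
  have "degree (f1 * f2) \<le> 3" using order_trans[OF degree_mult_le add_mono[OF f1d f2d]] by simp
  then have "degree f \<le> 4"
    unfolding f_def using degree_mult_le[of "[:0, 1:]" "f1 * f2"] by simp
  \<comment> \<open>Nonvanishing at \<open>s = 0\<close>, where \<open>B\<close> is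
    \<open>B0\<close>, shows that neither factor is the zero polynomial.\<close>
  moreover have f1z: "poly f1 0 \<noteq> 0" "poly f2 0 \<noteq> 0" using B0 by (simp_all add: f1_def f2_def g2_def)
  then have "f \<noteq> 0" unfolding f_def by (metis mult_eq_0_iff one_neq_zero pCons_eq_0_iff poly_0)
  ultimately obtain s where s: "poly f s \<noteq> 0" using exists_nonroot[of f] p by auto
  then have s0: "s \<noteq> 0" and s1: "g2 + s * t \<noteq> 0" and s2: "(g2 + s * t) * (g2 + s * t) - s * (2 * \<alpha> * g1) \<noteq> 0"
  proof -
    have p1: "poly f1 s = g2 + s * t" by (simp add: f1_def)
    have p2: "poly f2 s = (g2 + s * t) * (g2 + s * t) - s * (2 * \<alpha> * g1)"
      unfolding f2_def poly_diff poly_mult p1 by simp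
    have "poly f s = s * (poly f1 s * poly f2 s)"
      unfolding f_def poly_mult by simp
    with s show "s \<noteq> 0" "g2 + s * t \<noteq> 0" "(g2 + s * t) * (g2 + s * t) - s * (2 * \<alpha> * g1) \<noteq> 0"
      unfolding p1 p2 by auto
  qed
  have "generic_pair A1 (B s)"
    using s0 two B0 nil by (simp add: generic_pair_def sl_disc_def A1B BB g1_def)
  moreover have "generic_pair A2 (B s)"
    using s0 s1 s2 two B0(2)
    by (simp add: generic_pair_def sl_disc_def A2B BB \<alpha>_def[symmetric] g1_def[symmetric] power2_eq_square
        algebra_simps)
  ultimately show ?thesis by blast
qed

text \<open>If neither matrix is nilpotent, a nilpotent \<open>B\<close> works, since then the
  discriminant reduces to the square of the trace with \<open>B\<close>.\<close>

lemma exists_generic: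
  fixes A1 A2 :: "'p::prime_card mod_ring sl2"
  assumes p: "5 \<le> CARD('p)" and two: "(2 :: 'p mod_ring) \<noteq> 0" and A: "A1 \<noteq> 0" "A2 \<noteq> 0"
  shows "\<exists>B. generic_pair A1 B \<and> generic_pair A2 B"
proof (cases "sl_tr A1 A1 = 0 \<or> sl_tr A2 A2 = 0")
  case True
  then show ?thesis using exists_generic_nilpotent[OF p two] A by blast
next
  case False
  obtain B where "sl_tr B B = 0" "sl_tr A1 B \<noteq> 0" "sl_tr A2 B \<noteq> 0"
    using exists_nilpotent[OF p two A] by blast
  then show ?thesis using False by (intro exI[of _ B]) (simp add: generic_pair_def sl_disc_def)
qed

subsection \<open>Graded groups with traceless matrices as leading terms\<close>

lemma sl_scale_of_nat: "((+) A ^^ n) 0 = sl_scale (of_nat n) A"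
  by (induction n) (simp_all add: sl_scale_add_left)

locale sl2_graded_group =
  graded_group G T L "\<lambda>_ _. sl_br"
  for G :: "('a, 'm) monoid_scheme" (structure) and T and L :: "nat \<Rightarrow> 'p::prime_card mod_ring sl2 \<Rightarrow> 'a \<Rightarrow> bool" +
  assumes p5: "5 \<le> CARD('p)" and two: "(2 :: 'p mod_ring) \<noteq> 0"
begin

lemma lead_scale:
  assumes H: "subgroup H G" and A: "A \<in> lead H k"
  shows "sl_scale s A \<in> lead H k"
proof -
  obtain j where "s = of_nat j" using surj_of_nat_mod_ring by blast
  then show ?thesis using lead_multiple[OF H A, of j] by (simp add: sl_scale_of_nat)
qed

lemma lead_bihom:
  assumes H: "subgroup H G" and A: "A \<in> lead H k" and B: "B \<in> lead H l" and E: "bihom A B a b E"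
  shows "E \<in> lead H (a * k + b * l)"
  using E
proof (induction rule: bihom.induct)
  case (br a b E a' b' E')
  then show ?case using lead_br[OF H br.IH] by (simp add: algebra_simps)
qed (use A B in \<open>auto intro: lead_add[OF H]\<close>)

text \<open>\<open>c\<close> is not confined to values below \<open>k\<close>, so residue classes
  add without reduction.\<close>

definition ev_lead :: "'a set \<Rightarrow> nat \<Rightarrow> nat \<Rightarrow> 'p mod_ring sl2 \<Rightarrow> bool" where
  "ev_lead H k c X \<longleftrightarrow> (\<exists>J. \<forall>n\<ge>J. X \<in> lead H (k * n + c))"

lemma ev_lead_add:
  "subgroup H G \<Longrightarrow> ev_lead H k c X \<Longrightarrow> ev_lead H k c Y \<Longrightarrow> ev_lead H k c (X + Y)"
  unfolding ev_lead_def by (meson lead_add le_trans nat_le_linear)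

lemma ev_lead_scale:
  "subgroup H G \<Longrightarrow> ev_lead H k c X \<Longrightarrow> ev_lead H k c (sl_scale s X)"
  unfolding ev_lead_def by (meson lead_scale)

lemma ev_lead_unscale:
  "subgroup H G \<Longrightarrow> ev_lead H k c (sl_scale s X) \<Longrightarrow> s \<noteq> 0 \<Longrightarrow> ev_lead H k c X"
  using ev_lead_scale[of H k c "sl_scale s X" "1 / s"] by (simp add: sl_scale_scale)

lemma ev_lead_br:
  assumes H: "subgroup H G" and Y: "ev_lead H k c Y" and X: "X \<in> lead H (k * n0 + c')"
  shows "ev_lead H k (c + c') (sl_br Y X)"
proof -
  obtain J where J: "\<And>n. J \<le> n \<Longrightarrow> Y \<in> lead H (k * n + c)"
    using Y unfolding ev_lead_def by blast
  have "sl_br Y X \<in> lead H (k * n + (c + c'))" if "J + n0 \<le> n" for n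
  proof -
    have "sl_br Y X \<in> lead H ((k * (n - n0) + c) + (k * n0 + c'))"
      by (rule lead_br[OF H J X]) (use that in simp)
    moreover have "k * n = k * (n - n0) + k * n0"
      using that by (simp flip: add_mult_distrib2)
    then have "(k * (n - n0) + c) + (k * n0 + c') = k * n + (c + c')" by simp
    ultimately show ?thesis by metis
  qed
  then show ?thesis unfolding ev_lead_def by blast
qed

lemma ev_lead_br':
  assumes H: "subgroup H G" and Y: "ev_lead H k c Y" and X: "ev_lead H k c' X"
  shows "ev_lead H k (c + c') (sl_br Y X)"
  using ev_lead_br[OF H Y] X unfolding ev_lead_def[of H k c'] by blast

lemma ev_lead_all:
  assumes H: "subgroup H G" and e: "ev_lead H k c (0, 1, 0)"
    and f: "ev_lead H k c (0, 0, 1)" and h: "ev_lead H k c (1, 0, 0)"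
  shows "ev_lead H k c X"
proof -
  obtain a b d where X: "X = (a, b, d)" by (cases X)
  have "X = sl_scale a (1, 0, 0) + (sl_scale b (0, 1, 0) + sl_scale d (0, 0, 1))" by (simp add: X)
  then show ?thesis
    using ev_lead_add[OF H ev_lead_scale[OF H h]
        ev_lead_add[OF H ev_lead_scale[OF H e] ev_lead_scale[OF H f]]] by metis
qed

text \<open>The Lie algebra is perfect in odd characteristic: each standard basis vector is, up to a
  unit, a bracket of the other two.\<close>

lemma ev_lead_products:
  assumes H: "subgroup H G" and X: "\<And>X. ev_lead H k c X" and Y: "\<And>X. ev_lead H k c' X"
  shows "ev_lead H k (c + c') Z"
proof (rule ev_lead_all[OF H])
  have "ev_lead H k (c + c') (sl_br (1, 0, 0) (0, 1, 0))" by (rule ev_lead_br'[OF H X Y])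
  then show "ev_lead H k (c + c') (0, 1, 0)"
    using ev_lead_unscale[OF H, of k "c + c'" 2 "(0, 1, 0)"] two by simp
  have "ev_lead H k (c + c') (sl_br (1, 0, 0) (0, 0, 1))" by (rule ev_lead_br'[OF H X Y])
  then show "ev_lead H k (c + c') (0, 0, 1)"
    using ev_lead_unscale[OF H, of k "c + c'" "- 2" "(0, 0, 1)"] two by simp
  have "ev_lead H k (c + c') (sl_br (0, 1, 0) (0, 0, 1))" by (rule ev_lead_br'[OF H X Y])
  then show "ev_lead H k (c + c') (1, 0, 0)" by simp
qed

text \<open>The Lie algebra is simple in odd characteristic, so brackets with full layers extract
  everything from \<open>F\<close>. They also spread its single occurrence over all large degrees of
  the class.\<close>

lemma ev_lead_ideal:
  assumes H: "subgroup H G" and full: "\<And>X. ev_lead H k 0 X"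
    and F: "F \<in> lead H (k * n0 + c)" "F \<noteq> 0"
  shows "ev_lead H k c Z"
proof -
  obtain a b d where Fe: "F = (a, b, d)" by (cases F)
  have br: "ev_lead H k c (sl_br Y X)" if "ev_lead H k c X" for X Y
    using ev_lead_br'[OF H full that] by simp
  have br1: "ev_lead H k c (sl_br Y F)" for Y
    using ev_lead_br[OF H full F(1)] by simp
  note un = ev_lead_unscale[OF H, of k c]
  have fe: "ev_lead H k c (0, 1, 0)" if "ev_lead H k c (0, 0, 1)"
    using br[OF br[OF that, of "(0, 1, 0)"], of "(0, 1, 0)"] un[of "- 2" "(0, 1, 0)"] two by simp
  have ef: "ev_lead H k c (0, 0, 1)" if "ev_lead H k c (0, 1, 0)"
    using br[OF br[OF that, of "(0, 0, 1)"], of "(0, 0, 1)"] un[of "- 2" "(0, 0, 1)"] two by simp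
  have four: "(4 :: 'p mod_ring) \<noteq> 0"
  proof -
    have "(4 :: 'p mod_ring) = 2 * 2" by simp
    then show ?thesis using two by (metis mult_eq_0_iff)
  qed
  have "ev_lead H k c (0, 1, 0)"
  proof -
    consider "a \<noteq> 0" | "b \<noteq> 0" | "d \<noteq> 0" using F(2) Fe by (auto simp: zero_prod_def)
    then show ?thesis
    proof cases
      case 1
      have "ev_lead H k c (sl_br (1, 0, 0) (sl_br (0, 1, 0) F))" by (rule br[OF br1])
      then show ?thesis using un[of "- 4 * a" "(0, 1, 0)"] 1 four by (simp add: Fe)
    next
      case 2
      have "ev_lead H k c (sl_br (0, 0, 1) (sl_br (0, 0, 1) F))" by (rule br[OF br1])
      then show ?thesis using un[of "- 2 * b" "(0, 0, 1)"] 2 two by (intro fe) (simp add: Fe)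
    next
      case 3
      have "ev_lead H k c (sl_br (0, 1, 0) (sl_br (0, 1, 0) F))" by (rule br[OF br1])
      then show ?thesis using un[of "- 2 * d" "(0, 1, 0)"] 3 two by (simp add: Fe)
    qed
  qed
  note e = this
  from ef[OF this] have f: "ev_lead H k c (0, 0, 1)" .
  have "ev_lead H k c (1, 0, 0)" using br[OF f, of "(0, 1, 0)"] by simp
  with e f show ?thesis by (rule ev_lead_all[OF H])
qed

text \<open>The class of 1 generates all residues mod \<open>k\<close>: one nonzero term there fills
  that class, and brackets with it pass from \<open>c\<close> to \<open>c + 1\<close>.\<close>

lemma open_of_ev_lead:
  assumes H: "subgroup H G" and k: "1 \<le> k" and full: "\<And>X. ev_lead H k 0 X"
    and F: "F \<in> lead H (k * n0 + 1)" "F \<noteq> 0"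
  shows "openin T (T closure_of H)"
proof -
  have one: "ev_lead H k 1 X" for X by (rule ev_lead_ideal[OF H full F])
  have ev: "ev_lead H k c X" for c X
  proof (induction c arbitrary: X)
    case 0
    show ?case by (rule full)
  next
    case (Suc c)
    then show ?case using ev_lead_products[OF H Suc one] by simp
  qed
  have "\<exists>J. \<forall>n\<ge>J. lead H (k * n + c) = UNIV" for c
  proof -
    obtain J1 J2 J3 where J: "\<forall>n\<ge>J1. (1, 0, 0) \<in> lead H (k * n + c)"
      "\<forall>n\<ge>J2. (0, 1, 0) \<in> lead H (k * n + c)" "\<forall>n\<ge>J3. (0, 0, 1) \<in> lead H (k * n + c)"
      using ev[of c] unfolding ev_lead_def by metis
    have "X \<in> lead H (k * n + c)" if n: "J1 + J2 + J3 \<le> n" for n X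
    proof -
      obtain a b d where X: "X = (a, b, d)" by (cases X)
      have "X = sl_scale a (1, 0, 0) + (sl_scale b (0, 1, 0) + sl_scale d (0, 0, 1))" by (simp add: X)
      moreover have "sl_scale a (1, 0, 0) + (sl_scale b (0, 1, 0) + sl_scale d (0, 0, 1)) \<in> lead H (k * n + c)"
        by (intro lead_add[OF H] lead_scale[OF H]) (use J n in auto)
      ultimately show ?thesis by metis
    qed
    then show ?thesis by blast
  qed
  then obtain J where J: "\<And>c n. J c \<le> n \<Longrightarrow> lead H (k * n + c) = UNIV" by metis
  define M where "M = Max (J ` {..<k})"
  show ?thesis
  proof (rule open_closure[OF H])
    fix d assume d: "k * (M + 1) \<le> d"
    have c: "d mod k < k" using k by simp
    then have "J (d mod k) \<le> M" unfolding M_def by (intro Max_ge) auto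
    moreover have "M + 1 \<le> d div k"
      using d k by (simp add: less_eq_div_iff_mult_less_eq mult.commute)
    ultimately have "lead H (k * (d div k) + d mod k) = UNIV" by (intro J) simp
    then show "lead H d = UNIV" by simp
  qed
qed

text \<open>
  Passing from \<open>y\<close> to \<open>y e\<close>, where \<open>e\<close> has leading term \<open>\<sigma> B\<close> one degree behind that of \<open>y\<close>, acts on
  leading terms like the substitution of \<open>B t\<^sup>l (1 + \<sigma> t)\<close> for \<open>B t\<^sup>l\<close>; it multiplies a word of degree
  \<open>b\<close> in \<open>B\<close> by \<open>1 + \<sigma> b t\<close> up to higher terms.
\<close>

definition word_shift where
  "word_shift x y l B n b E w \<longleftrightarrow> L n E w \<and> (\<forall>\<sigma> e. L (l + 1) (sl_scale \<sigma> B) e \<longrightarrow>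
    (\<exists>w'\<in>generate G {x, y \<otimes> e}. L n E w' \<and> L (n + 1) (sl_scale (\<sigma> * of_nat b) E) (w' \<otimes> inv w)))"

lemma word_shift_lead: "word_shift x y l B n b E w \<Longrightarrow> L n E w"
  by (simp add: word_shift_def)

lemma word_shift_word:
  "word_shift x y l B n b E w \<Longrightarrow> L (l + 1) (sl_scale \<sigma> B) e \<Longrightarrow>
    \<exists>w'\<in>generate G {x, y \<otimes> e}. L n E w' \<and> L (n + 1) (sl_scale (\<sigma> * of_nat b) E) (w' \<otimes> inv w)"
  unfolding word_shift_def by blast

text \<open>\<open>w\<close> and \<open>w'\<close> are one group word evaluated at \<open>x\<close>,
  \<open>y\<close> and at \<open>x\<close>, \<open>y \<otimes> e\<close>. By \<open>perturb\<close>
  the relative change adds up under brackets, so it counts the occurrences of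
  \<open>y\<close>.\<close>

lemma bihom_word:
  assumes x: "L k A x" and y: "L l B y" and E: "bihom A B a b E"
  shows "\<exists>w. word_shift x y l B (a * k + b * l) b E w"
  using E
proof (induction rule: bihom.induct)
  case fst
  have "L (k + 1) 0 (x \<otimes> inv x)" using L_one[of "k + 1"] L_carrier[OF x] by simp
  then show ?case unfolding word_shift_def using x by (intro exI[of _ x]) (auto intro!: bexI[of _ x] generate.incl)
next
  case snd
  show ?case
    unfolding word_shift_def
  proof (intro exI[of _ y] conjI allI impI)
    show "L (0 * k + 1 * l) B y" using y by simp
    fix \<sigma> e assume e: "L (l + 1) (sl_scale \<sigma> B) e"
    have "L l B (y \<otimes> e)" using L_mult[OF y L_lower[OF e L_pos[OF y]]] by simp
    moreover have "L (l + 1) (sl_scale \<sigma> B) (y \<otimes> e \<otimes> inv y)" by (rule L_conj[OF e L_carrier[OF y]])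
    ultimately show "\<exists>w'\<in>generate G {x, y \<otimes> e}. L (0 * k + 1 * l) B w' \<and>
      L (0 * k + 1 * l + 1) (sl_scale (\<sigma> * of_nat 1) B) (w' \<otimes> inv y)"
      by (intro bexI[of _ "y \<otimes> e"] generate.incl) auto
  qed
next
  case (br a b E a' b' E')
  obtain u where u0: "word_shift x y l B (a * k + b * l) b E u" using br.IH(1) by blast
  obtain v where v0: "word_shift x y l B (a' * k + b' * l) b' E' v" using br.IH(2) by blast
  note u = word_shift_lead[OF u0] and v = word_shift_lead[OF v0]
    and u' = word_shift_word[OF u0] and v' = word_shift_word[OF v0]
  note uc = L_carrier[OF u] and vc = L_carrier[OF v]
  have deg: "(a + a') * k + (b + b') * l = (a * k + b * l) + (a' * k + b' * l)" by (simp add: algebra_simps)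
  show ?case
    unfolding deg word_shift_def
  proof (intro exI[of _ "cm u v"] conjI allI impI)
    show "L ((a * k + b * l) + (a' * k + b' * l)) (sl_br E E') (cm u v)" by (rule L_cm[OF u v])
    fix \<sigma> e assume e: "L (l + 1) (sl_scale \<sigma> B) e"
    obtain w1 where w1: "w1 \<in> generate G {x, y \<otimes> e}" "L (a * k + b * l) E w1"
      "L (a * k + b * l + 1) (sl_scale (\<sigma> * of_nat b) E) (w1 \<otimes> inv u)" using u'[OF e] by blast
    obtain w2 where w2: "w2 \<in> generate G {x, y \<otimes> e}" "L (a' * k + b' * l) E' w2"
      "L (a' * k + b' * l + 1) (sl_scale (\<sigma> * of_nat b') E') (w2 \<otimes> inv v)" using v'[OF e] by blast
    note w1c = L_carrier[OF w1(2)] and w2c = L_carrier[OF w2(2)]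
    define d where "d = inv u \<otimes> (w1 \<otimes> inv u) \<otimes> inv (inv u)"
    define d' where "d' = inv v \<otimes> (w2 \<otimes> inv v) \<otimes> inv (inv v)"
    have d: "L (a * k + b * l + 1) (sl_scale (\<sigma> * of_nat b) E) d"
      unfolding d_def by (rule L_conj[OF w1(3)]) (use uc in simp)
    have d': "L (a' * k + b' * l + 1) (sl_scale (\<sigma> * of_nat b') E') d'"
      unfolding d'_def by (rule L_conj[OF w2(3)]) (use vc in simp)
    have ud: "u \<otimes> d = w1" "v \<otimes> d' = w2"
      unfolding d_def d'_def using uc vc w1c w2c by (simp_all add: m_assoc) (simp_all flip: m_assoc)
    have "L ((a * k + b * l) + (a' * k + b' * l) + 1)
      (sl_br (sl_scale (\<sigma> * of_nat b) E) E' + sl_br E (sl_scale (\<sigma> * of_nat b') E'))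
      (cm w1 w2 \<otimes> inv (cm u v))"
      using perturb[OF u v d d' order_refl] unfolding ud .
    moreover have "sl_br (sl_scale (\<sigma> * of_nat b) E) E' + sl_br E (sl_scale (\<sigma> * of_nat b') E')
      = sl_scale (\<sigma> * of_nat (b + b')) (sl_br E E')"
      by (simp add: sl_br_scale_left sl_br_scale_right sl_scale_add_left algebra_simps)
    moreover have "subgroup (generate G {x, y \<otimes> e}) G"
      by (rule generate_is_subgroup) (use L_carrier[OF x] L_carrier[OF y] L_carrier[OF e] in simp)
    then have cw: "cm w1 w2 \<in> generate G {x, y \<otimes> e}" using w1(1) w2(1) by (rule cm_in_subgroup)
    ultimately have "L ((a * k + b * l) + (a' * k + b' * l) + 1) (sl_scale (\<sigma> * of_nat (b + b')) (sl_br E E'))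
        (cm w1 w2 \<otimes> inv (cm u v))" by simp
    then show "\<exists>w'\<in>generate G {x, y \<otimes> e}.
      L ((a * k + b * l) + (a' * k + b' * l)) (sl_br E E') w' \<and>
      L ((a * k + b * l) + (a' * k + b' * l) + 1) (sl_scale (\<sigma> * of_nat (b + b')) (sl_br E E'))
        (w' \<otimes> inv (cm u v))"
      using L_cm[OF w1(2) w2(2)] cw by (intro bexI[of _ "cm w1 w2"] conjI)
  qed
next
  case (add a b E E')
  obtain u where u0: "word_shift x y l B (a * k + b * l) b E u" using add.IH(1) by blast
  obtain v where v0: "word_shift x y l B (a * k + b * l) b E' v" using add.IH(2) by blast
  note u = word_shift_lead[OF u0] and v = word_shift_lead[OF v0]
    and u' = word_shift_word[OF u0] and v' = word_shift_word[OF v0]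
  note uc = L_carrier[OF u] and vc = L_carrier[OF v]
  show ?case
    unfolding word_shift_def
  proof (intro exI[of _ "u \<otimes> v"] conjI allI impI)
    show "L (a * k + b * l) (E + E') (u \<otimes> v)" by (rule L_mult[OF u v])
    fix \<sigma> e assume e: "L (l + 1) (sl_scale \<sigma> B) e"
    obtain w1 where w1: "w1 \<in> generate G {x, y \<otimes> e}" "L (a * k + b * l) E w1"
      "L (a * k + b * l + 1) (sl_scale (\<sigma> * of_nat b) E) (w1 \<otimes> inv u)" using u'[OF e] by blast
    obtain w2 where w2: "w2 \<in> generate G {x, y \<otimes> e}" "L (a * k + b * l) E' w2"
      "L (a * k + b * l + 1) (sl_scale (\<sigma> * of_nat b) E') (w2 \<otimes> inv v)" using v'[OF e] by blast
    note w1c = L_carrier[OF w1(2)] and w2c = L_carrier[OF w2(2)]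
    have "L (a * k + b * l + 1) (sl_scale (\<sigma> * of_nat b) E + sl_scale (\<sigma> * of_nat b) E')
      (w1 \<otimes> inv u \<otimes> (u \<otimes> (w2 \<otimes> inv v) \<otimes> inv u))"
      by (rule L_mult[OF w1(3) L_conj[OF w2(3) uc]])
    moreover have "w1 \<otimes> inv u \<otimes> (u \<otimes> (w2 \<otimes> inv v) \<otimes> inv u) = w1 \<otimes> w2 \<otimes> inv (u \<otimes> v)"
    proof -
      have "inv u \<otimes> (u \<otimes> (w2 \<otimes> (inv v \<otimes> inv u))) = w2 \<otimes> (inv v \<otimes> inv u)"
        using uc vc w2c by (simp flip: m_assoc)
      then show ?thesis using uc vc w1c w2c by (simp add: m_assoc inv_mult_group)
    qed
    ultimately show "\<exists>w'\<in>generate G {x, y \<otimes> e}. L (a * k + b * l) (E + E') w' \<and>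
      L (a * k + b * l + 1) (sl_scale (\<sigma> * of_nat b) (E + E')) (w' \<otimes> inv (u \<otimes> v))"
      using L_mult[OF w1(2) w2(2)] generate.eng[OF w1(1) w2(1)]
      by (intro bexI[of _ "w1 \<otimes> w2"] conjI) (simp_all add: sl_scale_add_right)
  qed
qed

text \<open>The words \<open>u\<close>, \<open>v\<close> share the leading term \<open>C\<close> but
  contain \<open>y\<close> to degrees \<open>b + 2\<close> and \<open>b\<close>. After the change of
  \<open>y\<close> their quotient has the term \<open>F + 2 \<sigma> C\<close> in degree
  \<open>k n + 1\<close>, and this vanishes for at most one \<open>\<sigma>\<close>.\<close>

lemma open_all_but_one:
  assumes x: "L k A x" and y: "L (k * m) B y" and m: "even m" "2 \<le> m" and gen: "generic_pair A B"
  shows "\<exists>\<sigma>0. \<forall>\<sigma> e. \<sigma> \<noteq> \<sigma>0 \<longrightarrow> L (k * m + 1) (sl_scale \<sigma> B) e \<longrightarrow>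
    openin T (top_generate G T {x, y \<otimes> e})"
proof -
  have k: "1 \<le> k" using L_pos[OF x] .
  have g: "sl_tr A B \<noteq> 0" "sl_disc A B \<noteq> 0" "sl_tr A A \<noteq> 0 \<or> sl_tr B B \<noteq> 0"
    using gen by (simp_all add: generic_pair_def)
  define C where "C = sl_br A B"
  obtain a b where ab: "bihom A B a (b + 2) C" "bihom A B (a + 2 * m) b C"
    using bihom_coincidence[OF two g(2) g(1) g(3) m(1)] unfolding C_def by blast
  define n where "n = a + (b + 2) * m"
  have n1: "a * k + (b + 2) * (k * m) = k * n" and n2: "(a + 2 * m) * k + b * (k * m) = k * n"
    by (simp_all add: n_def algebra_simps)
  obtain u where u0: "word_shift x y (k * m) B (k * n) (b + 2) C u"
    using bihom_word[OF x y ab(1)] unfolding n1 by blast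
  obtain v where v0: "word_shift x y (k * m) B (k * n) b C v"
    using bihom_word[OF x y ab(2)] unfolding n2 by blast
  note u = word_shift_lead[OF u0] and v = word_shift_lead[OF v0]
    and u' = word_shift_word[OF u0] and v' = word_shift_word[OF v0]
  note uc = L_carrier[OF u] and vc = L_carrier[OF v]
  have "L (k * n) (C + - C) (u \<otimes> inv v)" by (rule L_mult[OF u L_inv[OF v]])
  then obtain F where F: "L (k * n + 1) F (u \<otimes> inv v)"
    using L_Suc[of "k * n" "u \<otimes> inv v"] L_pos[OF u] by auto
  have C0: "C \<noteq> 0"
  proof
    assume "C = 0"
    then have "sl_tr C C = 0" by (simp add: zero_prod_def)
    then show False using sl_tr_br_br[of A B] g(2) two by (simp add: C_def)
  qed
  have bad: "\<exists>\<sigma>0. \<forall>\<sigma>. \<sigma> \<noteq> \<sigma>0 \<longrightarrow> F + sl_scale (2 * \<sigma>) C \<noteq> 0"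
  proof (rule ccontr)
    assume no: "\<not> ?thesis"
    then obtain s where s: "F + sl_scale (2 * s) C = 0" by blast
    obtain t where t: "t \<noteq> s" "F + sl_scale (2 * t) C = 0" using no by blast
    have "sl_scale (2 * s) C = sl_scale (2 * t) C" using s t(2) by (metis add_left_cancel)
    moreover have "sl_scale (2 * s - 2 * t) C = sl_scale (2 * s) C - sl_scale (2 * t) C"
      by (cases C) (simp add: algebra_simps)
    ultimately have "sl_scale (2 * s - 2 * t) C = 0" by simp
    then have "sl_scale (1 / (2 * s - 2 * t)) (sl_scale (2 * s - 2 * t) C) = 0"
      by (simp add: zero_prod_def)
    moreover have "2 * s - 2 * t \<noteq> 0" using t(1) two by simp
    ultimately have "C = 0" by (simp add: sl_scale_scale)
    with C0 show False by simp
  qed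
  then obtain \<sigma>0 where \<sigma>0: "\<And>\<sigma>. \<sigma> \<noteq> \<sigma>0 \<Longrightarrow> F + sl_scale (2 * \<sigma>) C \<noteq> 0" by blast
  have "openin T (top_generate G T {x, y \<otimes> e})"
    if \<sigma>: "\<sigma> \<noteq> \<sigma>0" and e: "L (k * m + 1) (sl_scale \<sigma> B) e" for \<sigma> e
  proof -
    note xc = L_carrier[OF x] and yc = L_carrier[OF y] and ec = L_carrier[OF e]
    define H where "H = generate G {x, y \<otimes> e}"
    have H: "subgroup H G" unfolding H_def by (rule generate_is_subgroup) (use xc yc ec in simp)
    have A: "A \<in> lead H k" by (rule leadI[OF _ x]) (simp add: H_def generate.incl)
    have "1 \<le> k * m" using k m by simp
    then have "L (k * m) B (y \<otimes> e)" using L_mult[OF y L_lower[OF e]] by simp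
    then have B: "B \<in> lead H (k * m)" by (rule leadI[rotated]) (simp add: H_def generate.incl)
    have full: "ev_lead H k 0 X" for X
    proof -
      obtain J where J: "\<And>n. J \<le> n \<Longrightarrow> \<exists>a b a' b'. a + b * m = n \<and> a' + b' * m = n \<and>
        bihom A B a b A \<and> bihom A B a b B \<and> bihom A B a' b' C"
        using bihom_span[OF two g(2,1,3) m] unfolding C_def by blast
      have "X \<in> lead H (k * n + 0)" if Jn: "J \<le> n" for n
      proof -
        obtain a b a' b' where n: "a + b * m = n" "a' + b' * m = n"
          and w: "bihom A B a b A" "bihom A B a b B" "bihom A B a' b' C" using J[OF Jn] by blast
        have deg: "a * k + b * (k * m) = k * n" "a' * k + b' * (k * m) = k * n"
          by (simp add: n(1)[symmetric] algebra_simps, simp add: n(2)[symmetric] algebra_simps)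
        have l: "A \<in> lead H (k * n)" "B \<in> lead H (k * n)" "C \<in> lead H (k * n)"
          using lead_bihom[OF H A B w(1)] lead_bihom[OF H A B w(2)] lead_bihom[OF H A B w(3)]
          unfolding deg .
        have "sl_scale (2 * sl_disc A B) X \<in> lead H (k * n)"
          unfolding sl_basis by (intro lead_add[OF H] lead_scale[OF H] l[unfolded C_def])
        then have "sl_scale (1 / (2 * sl_disc A B)) (sl_scale (2 * sl_disc A B) X) \<in> lead H (k * n)"
          by (rule lead_scale[OF H])
        then show ?thesis using g(2) two by (simp add: sl_scale_scale)
      qed
      then show ?thesis unfolding ev_lead_def by blast
    qed
    obtain w1 where w1: "w1 \<in> H" "L (k * n) C w1"
      "L (k * n + 1) (sl_scale (\<sigma> * of_nat (b + 2)) C) (w1 \<otimes> inv u)" using u'[OF e] unfolding H_def by blast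
    obtain w2 where w2: "w2 \<in> H" "L (k * n) C w2"
      "L (k * n + 1) (sl_scale (\<sigma> * of_nat b) C) (w2 \<otimes> inv v)" using v'[OF e] unfolding H_def by blast
    note w1c = L_carrier[OF w1(2)] and w2c = L_carrier[OF w2(2)]
    have "L (k * n + 1) (sl_scale (\<sigma> * of_nat (b + 2)) C + F + - sl_scale (\<sigma> * of_nat b) C)
      (w1 \<otimes> inv u \<otimes> (u \<otimes> inv v) \<otimes> inv (w2 \<otimes> inv v))"
      by (intro L_mult L_inv w1(3) w2(3) F)
    moreover have "w1 \<otimes> inv u \<otimes> (u \<otimes> inv v) \<otimes> inv (w2 \<otimes> inv v) = w1 \<otimes> inv w2"
    proof -
      have "inv u \<otimes> (u \<otimes> (inv v \<otimes> (v \<otimes> inv w2))) = (inv u \<otimes> u) \<otimes> (inv v \<otimes> v) \<otimes> inv w2"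
        using uc vc w2c by (simp only: m_assoc inv_closed m_closed)
      then show ?thesis using uc vc w1c w2c by (simp add: m_assoc inv_mult_group)
    qed
    moreover have "sl_scale (\<sigma> * of_nat (b + 2)) C + F + - sl_scale (\<sigma> * of_nat b) C
        = F + sl_scale (2 * \<sigma>) C"
      by (cases C; cases F) (simp add: algebra_simps)
    ultimately have "L (k * n + 1) (F + sl_scale (2 * \<sigma>) C) (w1 \<otimes> inv w2)" by (simp only:)
    moreover have "w1 \<otimes> inv w2 \<in> H" using w1(1) w2(1) H by (simp add: subgroup.m_closed subgroup.m_inv_closed)
    ultimately have "F + sl_scale (2 * \<sigma>) C \<in> lead H (k * n + 1)" by (intro leadI)
    then show ?thesis
      unfolding top_generate_def H_def[symmetric]
      using open_of_ev_lead[OF H k full _ \<sigma>0[OF \<sigma>]] by blast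
  qed
  then show ?thesis by blast
qed

theorem sl2_diameter: "graph_diameter (proper_virt_gen_graph G T) = 2"
proof (rule diameter_2)
  fix x1 x2 assume "x1 \<in> carrier G" "x1 \<noteq> \<one>" "x2 \<in> carrier G" "x2 \<noteq> \<one>"
  then obtain k1 A1 k2 A2 where x: "L k1 A1 x1" "A1 \<noteq> 0" "L k2 A2 x2" "A2 \<noteq> 0"
    using depth_exists by meson
  obtain B where B: "generic_pair A1 B" "generic_pair A2 B" using exists_generic[OF p5 two x(2,4)] by blast
  have k: "1 \<le> k1" "1 \<le> k2" using L_pos x by blast+
  \<comment> \<open>A common even multiple of both depths, so that the same \<open>y\<close> fits
    \<open>open_all_but_one\<close> for \<open>x1\<close> and for \<open>x2\<close>.\<close>
  define l where "l = 2 * k1 * k2"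
  have l: "l = k1 * (2 * k2)" "l = k2 * (2 * k1)" by (simp_all add: l_def)
  have l1: "1 \<le> l" using k by (simp add: l_def)
  obtain y where y: "L l B y" using L_surj[OF l1] by blast
  obtain s1 where s1: "\<And>\<sigma> e. \<sigma> \<noteq> s1 \<Longrightarrow> L (l + 1) (sl_scale \<sigma> B) e \<Longrightarrow>
    openin T (top_generate G T {x1, y \<otimes> e})"
    using open_all_but_one[OF x(1) y[unfolded l(1)] _ _ B(1)] k unfolding l(1)[symmetric] by auto
  obtain s2 where s2: "\<And>\<sigma> e. \<sigma> \<noteq> s2 \<Longrightarrow> L (l + 1) (sl_scale \<sigma> B) e \<Longrightarrow>
    openin T (top_generate G T {x2, y \<otimes> e})"
    using open_all_but_one[OF x(3) y[unfolded l(2)] _ _ B(2)] k unfolding l(2)[symmetric] by auto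
  have "\<exists>\<sigma>. \<sigma> \<noteq> s1 \<and> \<sigma> \<noteq> s2"
  proof (rule ccontr)
    assume "\<not> ?thesis"
    then have "UNIV = {s1, s2}" by blast
    then have "CARD('p mod_ring) = card (set [s1, s2])" by simp
    also have "\<dots> \<le> 2" by (rule order_trans[OF card_length]) simp
    finally show False using p5 by simp
  qed
  then obtain \<sigma> where \<sigma>: "\<sigma> \<noteq> s1" "\<sigma> \<noteq> s2" by blast
  have "\<exists>e. L (l + 1) (sl_scale \<sigma> B) e" by (rule L_surj) simp
  then obtain e where e: "L (l + 1) (sl_scale \<sigma> B) e" by blast
  show "\<exists>y\<in>carrier G. openin T (top_generate G T {x1, y}) \<and> openin T (top_generate G T {x2, y})"
    using s1[OF \<sigma>(1) e] s2[OF \<sigma>(2) e] L_carrier[OF y] L_carrier[OF e] by (intro bexI[of _ "y \<otimes> e"]) auto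
qed

end

section \<open>Ershov's groups\<close>

lemma CHAR_fps: "CHAR('p::prime_card mod_ring fps) = CARD('p)"
proof (rule CHAR_eqI)
  have z: "(of_nat n :: 'p mod_ring fps) = 0 \<longleftrightarrow> (of_nat n :: 'p mod_ring) = 0" for n
  proof -
    have "(of_nat n :: 'p mod_ring fps) = fps_const (of_nat n)" by (simp add: fps_of_nat)
    then show ?thesis by (simp only: fps_const_eq_0_iff)
  qed
  show "(of_nat CARD('p) :: 'p mod_ring fps) = 0" unfolding z by simp
  fix x assume "(of_nat x :: 'p mod_ring fps) = 0"
  then show "CARD('p) dvd x" unfolding z by (rule of_nat_0_mod_ring_dvd)
qed

lemma mod_ring_power_card:
  fixes a :: "'p::prime_card mod_ring"
  shows "a ^ (CARD('p) ^ s) = a"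
proof -
  have "(of_nat j :: 'p mod_ring) ^ (CARD('p) ^ s) = of_nat j" for j
  proof (induction j)
    case (Suc j)
    have "(1 + of_nat j :: 'p mod_ring) ^ (CARD('p) ^ s) = 1 ^ (CARD('p) ^ s) + of_nat j ^ (CARD('p) ^ s)"
      by (rule freshmans_dream') (simp_all add: prime_card)
    then show ?case using Suc by simp
  qed (simp add: power_0_left prime_gt_0_nat[OF prime_card])
  then show ?thesis using surj_of_nat_mod_ring by metis
qed

text \<open>Frobenius is additive and fixes the coefficients. It is applied to the finite truncation
  \<open>P\<close>, since the tail does not reach the coefficient \<open>m\<close>.\<close>

lemma fps_power_card:
  fixes g :: "'p::prime_card mod_ring fps"
  shows "g ^ (CARD('p) ^ s) = g oo fps_X ^ (CARD('p) ^ s)"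
proof (rule fps_ext)
  fix m
  define q where "q = CARD('p) ^ s"
  have q: "q \<noteq> 0" by (simp add: q_def)
  define P where "P = (\<Sum>i\<le>m. fps_const (g $ i) * fps_X ^ i)"
  have Pn: "P $ i = g $ i" if "i \<le> m" for i
    using that by (simp add: P_def fps_sum_nth if_distrib[of "\<lambda>x. _ * x"] cong: if_cong)
  have "fps_X ^ Suc m dvd g - P" unfolding X_power_dvd_iff using Pn by auto
  then obtain R where "g - P = fps_X ^ Suc m * R" by (auto elim: dvdE)
  then have R: "g = P + fps_X ^ Suc m * R" by (simp add: algebra_simps)
  have pc: "prime CHAR('p mod_ring fps)" "q = CHAR('p mod_ring fps) ^ s"
    by (simp_all only: CHAR_fps q_def prime_card)
  have "g ^ q = P ^ q + (fps_X ^ Suc m * R) ^ q"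
    unfolding R by (rule freshmans_dream'[OF pc])
  moreover have "P ^ q = (\<Sum>i\<le>m. fps_const (g $ i) * fps_X ^ (i * q))"
    unfolding P_def freshmans_dream_sum'[OF pc]
    by (simp add: power_mult_distrib fps_const_power power_mult q_def mod_ring_power_card)
  moreover have "fps_X ^ Suc m dvd (fps_X ^ Suc m * R) ^ q"
    using q by (metis dvd_triv_left dvd_trans dvd_power neq0_conv)
  then have "((fps_X ^ Suc m * R) ^ q) $ m = 0" unfolding X_power_dvd_iff by blast
  ultimately have "(g ^ q) $ m = (\<Sum>i\<le>m. g $ i * (if m = i * q then 1 else 0))"
    by (simp add: fps_sum_nth)
  also have "\<dots> = (g oo fps_X ^ q) $ m"
  proof (cases "q dvd m")
    case True
    then obtain j where j: "m = j * q" by (metis dvdE mult.commute)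
    have "(\<Sum>i\<le>m. g $ i * (if m = i * q then 1 else 0)) = (\<Sum>i\<in>{j}. g $ i * (if m = i * q then 1 else 0))"
      using q j by (intro sum.mono_neutral_right) auto
    then show ?thesis using j q by (simp add: fps_nth_compose_X_power)
  next
    case False
    then have "m \<noteq> i * q" for i by auto
    then show ?thesis using False by (simp add: fps_nth_compose_X_power)
  qed
  finally show "(g ^ (CARD('p) ^ s)) $ m = (g oo fps_X ^ (CARD('p) ^ s)) $ m" by (simp add: q_def)
qed

text \<open>\<open>(1 + X)^r - 1\<close> has linear coefficient \<open>r\<close>, hence a
  compositional inverse; substituting \<open>m - 1\<close> into that yields the root minus
  1.\<close>

lemma fps_root_exists:
  fixes m :: "'a::field fps"
  assumes m: "m $ 0 = 1" and r: "(of_nat r :: 'a) \<noteq> 0"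
  shows "\<exists>h. h $ 0 = 1 \<and> h ^ r = m"
proof -
  define P :: "'a fps" where "P = (1 + fps_X) ^ r - 1"
  have c: "((1 + fps_X :: 'a fps) ^ n) $ 0 = 1 \<and> ((1 + fps_X :: 'a fps) ^ n) $ 1 = of_nat n" for n
    by (induction n) (simp_all add: fps_mult_nth)
  have P: "P $ 0 = 0" "P $ 1 \<noteq> 0" using c[of r] r by (simp_all add: P_def)
  define y where "y = fps_inv P oo (m - 1)"
  have m0: "(m - 1) $ 0 = 0" using m by simp
  have y0: "y $ 0 = 0" by (simp add: y_def fps_inv_def)
  have "P oo y = (P oo fps_inv P) oo (m - 1)"
    unfolding y_def by (rule fps_compose_assoc) (simp_all add: m fps_inv_def)
  also have "\<dots> = m - 1" using fps_inv_right[OF P] m0 by simp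
  finally have "P oo y = m - 1" .
  moreover have "P oo y = (1 + y) ^ r - 1"
    using y0 by (simp add: P_def fps_compose_sub_distrib fps_compose_power[symmetric] fps_compose_add_distrib)
  ultimately have "(1 + y) ^ r = m" by simp
  then show ?thesis using y0 by (intro exI[of _ "1 + y"]) simp
qed

lemma X_power_dvd_mult_nth:
  fixes u v :: "'a::field fps"
  assumes "fps_X ^ k dvd u"
  shows "(u * v) $ k = u $ k * v $ 0"
proof -
  obtain w where w: "u = fps_X ^ k * w" using assms by (auto elim: dvdE)
  then have "u * v = fps_X ^ k * (w * v)" by (simp add: mult.assoc)
  then have "(u * v) $ k = (w * v) $ 0" by (simp only: fps_X_power_mult_nth) simp
  then show ?thesis by (simp add: w fps_X_power_mult_nth)
qed

lemma X_power_dvd_unit_iff: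
  fixes u v :: "'a::field fps"
  assumes "v $ 0 \<noteq> 0"
  shows "fps_X ^ k dvd u * v \<longleftrightarrow> fps_X ^ k dvd u"
  using assms by (intro dvd_mult_unit_iff) simp

locale ershov =
  fixes s r :: nat and ty :: "'p::prime_card itself"
  assumes p5: "5 \<le> CARD('p)" and s: "1 \<le> s" and r0: "0 < r" and rq: "2 * r < CARD('p) ^ s"
    and pr: "\<not> CARD('p) dvd r"
begin

definition q :: nat where "q = CARD('p) ^ s"

abbreviation N :: "'p mod_ring fps monoid" where "N \<equiv> nottingham"

abbreviation Q :: "'p mod_ring fps set" where "Q \<equiv> ershov_Q1 s r"

definition stretch :: "'p mod_ring fps \<Rightarrow> 'p mod_ring fps" where "stretch f = f oo fps_X ^ q"

lemma q5: "5 \<le> q"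
proof -
  have "CARD('p) ^ 1 \<le> CARD('p) ^ s" using s p5 by (intro power_increasing) auto
  then show ?thesis using p5 by (simp add: q_def)
qed

lemma rq': "2 * r < q" using rq by (simp add: q_def)

lemma two: "(2 :: 'p mod_ring) \<noteq> 0"
proof
  assume "(2 :: 'p mod_ring) = 0"
  then have "(of_nat 2 :: 'p mod_ring) = 0" by simp
  then have "CARD('p) dvd 2" by (rule of_nat_0_mod_ring_dvd)
  then show False using p5 by (auto dest: dvd_imp_le)
qed

lemma r_nonzero: "(of_nat r :: 'p mod_ring) \<noteq> 0"
  using of_nat_0_mod_ring_dvd pr by blast

lemma Xq0: "(fps_X ^ q :: 'p mod_ring fps) $ 0 = 0"
  using q5 by simp

lemma stretch_simps [simp]:
  "stretch (f + g) = stretch f + stretch g" "stretch (f - g) = stretch f - stretch g"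
  "stretch (f * g) = stretch f * stretch g" "stretch 1 = 1" "stretch 0 = 0" "stretch (- f) = - stretch f"
  using Xq0 by (simp_all add: stretch_def fps_compose_add_distrib fps_compose_sub_distrib
      fps_compose_mult_distrib fps_compose_uminus)

lemma stretch_nth: "stretch f $ n = (if q dvd n then f $ (n div q) else 0)"
  by (simp add: stretch_def fps_nth_compose_X_power)

lemma stretch_nth_0 [simp]: "stretch f $ 0 = f $ 0"
  by (simp add: stretch_nth)

lemma stretch_nth_mult: "stretch f $ (q * i) = f $ i"
  using q5 by (simp add: stretch_nth)

lemma stretch_inj: "stretch f = stretch g \<longleftrightarrow> f = g"
  by (metis stretch_nth_mult fps_ext)

lemma stretch_dvd: "fps_X ^ k dvd f \<Longrightarrow> fps_X ^ (q * k) dvd stretch f"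
proof -
  assume "fps_X ^ k dvd f"
  then obtain g where "f = fps_X ^ k * g" by (auto elim: dvdE)
  then have "stretch f = fps_X ^ (q * k) * stretch g"
    using Xq0 by (simp add: stretch_def fps_compose_mult_distrib fps_compose_power[symmetric] power_mult)
  then show ?thesis by simp
qed

text \<open>Substituting \<open>g\<close> into \<open>f(t^q)\<close> gives \<open>f(g^q)\<close>,
  and \<open>g^q\<close> is \<open>g(t^q)\<close> by Frobenius. This is what makes the matrices
  compose.\<close>

lemma stretch_compose:
  assumes "g \<in> carrier N"
  shows "stretch f oo g = stretch (f oo g)"
proof -
  have g0: "g $ 0 = 0" using assms by (simp add: carrier_nottingham)
  have "stretch f oo g = f oo (fps_X ^ q oo g)"
    unfolding stretch_def using g0 Xq0 by (rule fps_compose_assoc[symmetric])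
  also have "fps_X ^ q oo g = g ^ q" using g0 by (simp add: fps_compose_power[symmetric])
  also have "\<dots> = g oo fps_X ^ q" unfolding q_def by (rule fps_power_card)
  also have "f oo (g oo fps_X ^ q) = (f oo g) oo fps_X ^ q"
    using Xq0 g0 by (rule fps_compose_assoc)
  finally show ?thesis by (simp add: stretch_def)
qed

text \<open>\<open>1, t\<^sup>r, t\<^sup>2\<^sup>r\<close> are linearly independent over the power series in \<open>t\<^sup>q\<close>, as \<open>0 < r < 2 r < q\<close>.\<close>

lemma independent:
  fixes u v w :: "'p mod_ring fps"
  defines "t \<equiv> stretch u + stretch v * fps_X ^ r + stretch w * fps_X ^ (2 * r)"
  shows "t $ (q * i) = u $ i" "t $ (q * i + r) = v $ i" "t $ (q * i + 2 * r) = w $ i"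
proof -
  have nd: "\<not> q dvd q * i + j" if "0 < j" "j < q" for i j
    using that by (simp add: dvd_add_right_iff nat_dvd_not_less)
  have nd': "\<not> q dvd q * i - j" if "j \<le> q * i" "0 < j" "j < q" for i j
    using that by (metis dvd_diffD1 dvd_triv_left nat_dvd_not_less)
  have m: "(stretch f * fps_X ^ j) $ n = (if n < j then 0 else stretch f $ (n - j))" for f j n
    by (simp add: fps_X_power_mult_right_nth)
  show "t $ (q * i) = u $ i"
    using nd'[of r i] nd'[of "2 * r" i] r0 rq' by (simp add: t_def m stretch_nth_mult stretch_nth)
  show "t $ (q * i + r) = v $ i"
  proof -
    have "stretch u $ (q * i + r) = 0" using nd[of r i] r0 rq' by (simp add: stretch_nth)
    moreover have "(stretch w * fps_X ^ (2 * r)) $ (q * i + r) = 0"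
      using nd'[of r i] r0 rq' by (auto simp: m stretch_nth)
    ultimately show ?thesis by (simp add: t_def m stretch_nth_mult)
  qed
  show "t $ (q * i + 2 * r) = w $ i"
  proof -
    have "stretch u $ (q * i + 2 * r) = 0" using nd[of "2 * r" i] r0 rq' by (simp add: stretch_nth)
    moreover have "(stretch v * fps_X ^ r) $ (q * i + 2 * r) = 0"
      using nd[of r i] r0 rq' by (simp add: m stretch_nth add.commute)
    ultimately show ?thesis by (simp add: t_def m stretch_nth_mult)
  qed
qed

subsection \<open>Matrix representatives\<close>

text \<open>The entries are kept before stretching, so degree \<open>k\<close> in them stands for
  \<open>t^(q k)\<close>; the denominator is multiplied out.\<close>

definition mrep where
  "mrep f m1 m2 m3 m4 \<longleftrightarrow> f \<in> carrier N \<and> m1 * m4 - m2 * m3 = 1 \<and>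
    m1 $ 0 = 1 \<and> m2 $ 0 = 0 \<and> m3 $ 0 = 0 \<and> m4 $ 0 = 1 \<and>
    f ^ r * (stretch m3 * fps_X ^ r + stretch m4) = stretch m1 * fps_X ^ r + stretch m2"

lemma X_dvd_stretch_iff: "fps_X ^ q dvd stretch f \<longleftrightarrow> f $ 0 = 0"
proof
  assume "fps_X ^ q dvd stretch f"
  then have "stretch f $ i = 0" if "i < q" for i using that unfolding X_power_dvd_iff by blast
  from this[of 0] show "f $ 0 = 0" using q5 by simp
next
  assume "f $ 0 = 0"
  then have "fps_X ^ 1 dvd f" unfolding X_power_dvd_iff by simp
  from stretch_dvd[OF this] show "fps_X ^ q dvd stretch f" by simp
qed

lemma mem_Q_iff: "f \<in> Q \<longleftrightarrow> (\<exists>m1 m2 m3 m4. mrep f m1 m2 m3 m4)"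
proof -
  have in_power: "(\<exists>a. a \<in> fps_in_power q \<and> R a) \<longleftrightarrow> (\<exists>m1. R (stretch m1))" for R
    by (auto simp: fps_in_power_def stretch_def)
  have eq: "(stretch m1 * stretch m4 - stretch m2 * stretch m3 = 1 \<and>
      fps_X ^ q dvd stretch m1 - 1 \<and> fps_X ^ q dvd stretch m2 \<and> fps_X ^ q dvd stretch m3 \<and>
      fps_X ^ q dvd stretch m4 - 1 \<and>
      f ^ r = (stretch m1 * fps_X ^ r + stretch m2) / (stretch m3 * fps_X ^ r + stretch m4)) \<longleftrightarrow>
    (m1 * m4 - m2 * m3 = 1 \<and> m1 $ 0 = 1 \<and> m2 $ 0 = 0 \<and> m3 $ 0 = 0 \<and> m4 $ 0 = 1 \<and>
      f ^ r * (stretch m3 * fps_X ^ r + stretch m4) = stretch m1 * fps_X ^ r + stretch m2)" for m1 m2 m3 m4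
  proof -
    have 1: "stretch m1 * stretch m4 - stretch m2 * stretch m3 = 1 \<longleftrightarrow> m1 * m4 - m2 * m3 = 1"
      using stretch_inj[of "m1 * m4 - m2 * m3" 1] by simp
    have 2: "fps_X ^ q dvd stretch h - 1 \<longleftrightarrow> h $ 0 = 1" for h
      using X_dvd_stretch_iff[of "h - 1"] by simp
    have "f ^ r = (stretch m1 * fps_X ^ r + stretch m2) / (stretch m3 * fps_X ^ r + stretch m4) \<longleftrightarrow>
      f ^ r * (stretch m3 * fps_X ^ r + stretch m4) = stretch m1 * fps_X ^ r + stretch m2" if "m4 $ 0 = 1"
      by (rule unit_eq_div2) (use that r0 in simp)
    then show ?thesis unfolding 1 2 X_dvd_stretch_iff by blast
  qed
  show ?thesis
    unfolding ershov_Q1_def Let_def q_def[symmetric] mem_Collect_eq mrep_def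
    by (simp only: ex_simps in_power eq conj_assoc)
qed

text \<open>The \<open>r\<close>-th power turns composition into Moebius transformations, so the
  matrix is that of \<open>f\<close> with \<open>g\<close> substituted, times that of
  \<open>g\<close>.\<close>

lemma mrep_mult:
  assumes f: "mrep f m1 m2 m3 m4" and g: "mrep g m1' m2' m3' m4'"
  shows "mrep (f oo g) ((m1 oo g) * m1' + (m2 oo g) * m3') ((m1 oo g) * m2' + (m2 oo g) * m4')
    ((m3 oo g) * m1' + (m4 oo g) * m3') ((m3 oo g) * m2' + (m4 oo g) * m4')"
proof -
  have fc: "f \<in> carrier N" and gc: "g \<in> carrier N" using f g by (auto simp: mrep_def)
  have g0: "g $ 0 = 0" using gc by (simp add: carrier_nottingham)
  define a b c d where "a = m1 oo g" and "b = m2 oo g" and "c = m3 oo g" and "d = m4 oo g"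
  have det: "a * d - b * c = 1"
  proof -
    have "a * d - b * c = (m1 * m4 - m2 * m3) oo g"
      using g0 by (simp add: a_def b_def c_def d_def fps_compose_sub_distrib fps_compose_mult_distrib)
    then show ?thesis using f by (simp add: mrep_def)
  qed
  have det': "m1' * m4' - m2' * m3' = 1" using g by (simp add: mrep_def)
  have "(f ^ r * (stretch m3 * fps_X ^ r + stretch m4)) oo g = (stretch m1 * fps_X ^ r + stretch m2) oo g"
    using f by (simp add: mrep_def)
  then have 1: "(f oo g) ^ r * (stretch c * g ^ r + stretch d) = stretch a * g ^ r + stretch b"
    using g0 by (simp add: fps_compose_mult_distrib fps_compose_add_distrib fps_compose_power[symmetric]
        stretch_compose[OF gc] a_def b_def c_def d_def)
  have 2: "g ^ r * (stretch m3' * fps_X ^ r + stretch m4') = stretch m1' * fps_X ^ r + stretch m2'"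
    using g by (simp add: mrep_def)
  have "(f oo g) ^ r * (stretch c * (stretch m1' * fps_X ^ r + stretch m2')
        + stretch d * (stretch m3' * fps_X ^ r + stretch m4'))
      = ((f oo g) ^ r * (stretch c * g ^ r + stretch d)) * (stretch m3' * fps_X ^ r + stretch m4')"
    unfolding 2[symmetric] by (simp add: algebra_simps)
  also have "\<dots> = stretch a * (g ^ r * (stretch m3' * fps_X ^ r + stretch m4'))
      + stretch b * (stretch m3' * fps_X ^ r + stretch m4')"
    unfolding 1 by (simp add: algebra_simps)
  finally have eq: "(f oo g) ^ r * (stretch (c * m1' + d * m3') * fps_X ^ r + stretch (c * m2' + d * m4'))
      = stretch (a * m1' + b * m3') * fps_X ^ r + stretch (a * m2' + b * m4')"
    unfolding 2 by (simp add: algebra_simps)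
  have "(a * m1' + b * m3') * (c * m2' + d * m4') - (a * m2' + b * m4') * (c * m1' + d * m3')
      = (a * d - b * c) * (m1' * m4' - m2' * m3')" by (simp add: algebra_simps)
  then have "(a * m1' + b * m3') * (c * m2' + d * m4') - (a * m2' + b * m4') * (c * m1' + d * m3') = 1"
    by (simp add: det det')
  then show ?thesis
    using eq f g carrier_nottingham_compose[OF fc gc]
    unfolding mrep_def a_def[symmetric] b_def[symmetric] c_def[symmetric] d_def[symmetric]
    by (simp add: a_def b_def c_def d_def)
qed

text \<open>The adjugate matrix, with the inverse series substituted.\<close>

lemma mrep_inv:
  assumes f: "mrep f m1 m2 m3 m4"
  shows "mrep (fps_inv f) (m4 oo fps_inv f) (- (m2 oo fps_inv f)) (- (m3 oo fps_inv f)) (m1 oo fps_inv f)"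
proof -
  have fc: "f \<in> carrier N" using f by (auto simp: mrep_def)
  define h where "h = fps_inv f"
  have h: "h \<in> carrier N" "f oo h = fps_X" unfolding h_def using fps_inv_nottingham[OF fc] by blast+
  have h0: "h $ 0 = 0" using h(1) by (simp add: carrier_nottingham)
  define a b c d where "a = m1 oo h" and "b = m2 oo h" and "c = m3 oo h" and "d = m4 oo h"
  have "(m1 * m4 - m2 * m3) oo h = 1" using f by (simp add: mrep_def)
  then have det: "d * a - (- b) * (- c) = 1"
    using h0 by (simp add: a_def b_def c_def d_def fps_compose_sub_distrib fps_compose_mult_distrib mult.commute)
  have "(f ^ r * (stretch m3 * fps_X ^ r + stretch m4)) oo h = (stretch m1 * fps_X ^ r + stretch m2) oo h"
    using f by (simp add: mrep_def)
  then have "fps_X ^ r * (stretch c * h ^ r + stretch d) = stretch a * h ^ r + stretch b"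
    using h0 h(2) by (simp add: fps_compose_mult_distrib fps_compose_add_distrib
        fps_compose_power[symmetric] stretch_compose[OF h(1)] a_def b_def c_def d_def)
  then have "h ^ r * (stretch (- c) * fps_X ^ r + stretch a) = stretch d * fps_X ^ r + stretch (- b)"
    by (simp add: algebra_simps)
  then show ?thesis
    using f det h(1) unfolding mrep_def h_def[symmetric] a_def[symmetric] b_def[symmetric]
      c_def[symmetric] d_def[symmetric] by (simp add: a_def b_def c_def d_def)
qed

lemma mrep_one: "mrep fps_X 1 0 0 1"
  by (simp add: mrep_def carrier_nottingham)

lemma mrep_difference:
  assumes "mrep f m1 m2 m3 m4"
  shows "(f ^ r - fps_X ^ r) * (stretch m3 * fps_X ^ r + stretch m4) =
    stretch m2 + stretch (m1 - m4) * fps_X ^ r + stretch (- m3) * fps_X ^ (2 * r)"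
proof -
  have "fps_X ^ (2 * r) = fps_X ^ r * (fps_X ^ r :: 'p mod_ring fps)" by (simp add: mult_2 power_add)
  then show ?thesis using assms by (simp add: mrep_def algebra_simps)
qed

text \<open>By \<open>independent\<close> both off-diagonal entries vanish and the diagonal ones
  agree; the determinant leaves a square root of 1, and the constant term 1 rules out -1.\<close>

lemma mrep_one_unique:
  assumes "mrep fps_X m1 m2 m3 m4"
  shows "m1 = 1" "m2 = 0" "m3 = 0" "m4 = 1"
proof -
  have z: "stretch m2 + stretch (m1 - m4) * fps_X ^ r + stretch (- m3) * fps_X ^ (2 * r) = 0"
    using mrep_difference[OF assms] by simp
  show b: "m2 = 0" using independent(1)[of m2 "m1 - m4" "- m3"] unfolding z by (intro fps_ext) simp
  have "- m3 = 0" using independent(3)[of m2 "m1 - m4" "- m3"] unfolding z by (intro fps_ext) simp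
  then show "m3 = 0" by simp
  have "m1 - m4 = 0" using independent(2)[of m2 "m1 - m4" "- m3"] unfolding z by (intro fps_ext) simp
  then have ad: "m4 = m1" by simp
  have "m1 * m1 = 1" using assms b ad by (simp add: mrep_def)
  then have "(m1 - 1) * (m1 + 1) = 0" by (simp add: algebra_simps)
  moreover have "(m1 + 1) $ 0 \<noteq> 0" using assms two by (simp add: mrep_def)
  then have "m1 + 1 \<noteq> 0" by (metis fps_zero_nth)
  ultimately show "m1 = 1" by simp
  with ad show "m4 = 1" by simp
qed

section \<open>The congruence filtration of Ershov's group\<close>

definition qrep where
  "qrep k f m1 m2 m3 m4 \<longleftrightarrow> 1 \<le> k \<and> mrep f m1 m2 m3 m4 \<and> fps_X ^ k dvd m1 - 1 \<and> fps_X ^ k dvd m2 \<and>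
    fps_X ^ k dvd m3 \<and> fps_X ^ k dvd m4 - 1"

definition qlead :: "nat \<Rightarrow> 'p mod_ring sl2 \<Rightarrow> 'p mod_ring fps \<Rightarrow> bool" where
  "qlead k A f \<longleftrightarrow> (\<exists>m1 m2 m3 m4. qrep k f m1 m2 m3 m4 \<and> A = (m1 $ k, m2 $ k, m3 $ k))"

text \<open>The determinant condition expresses the trace of the matrix minus the identity by
  products of order \<open>2 k\<close>. Leading terms are thus traceless, and three coefficients
  describe them.\<close>

lemma qrep_trace:
  assumes "qrep k f m1 m2 m3 m4"
  shows "m4 $ k = - m1 $ k"
proof -
  have k: "1 \<le> k" and det: "m1 * m4 - m2 * m3 = 1"
    and d: "fps_X ^ k dvd m1 - 1" "fps_X ^ k dvd m2" "fps_X ^ k dvd m3" "fps_X ^ k dvd m4 - 1"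
    using assms by (auto simp: qrep_def mrep_def)
  have "(m1 - 1) + (m4 - 1) = m2 * m3 - (m1 - 1) * (m4 - 1)" using det by (simp add: algebra_simps)
  moreover have "fps_X ^ (k + k) dvd m2 * m3 - (m1 - 1) * (m4 - 1)"
    by (intro dvd_diff X_power_dvd_mult d)
  ultimately have "fps_X ^ (k + k) dvd (m1 - 1) + (m4 - 1)" by simp
  then have "((m1 - 1) + (m4 - 1)) $ k = 0"
    using k unfolding X_power_dvd_iff by (metis less_add_same_cancel1 less_le_trans zero_less_one)
  then have "m1 $ k + m4 $ k = 0"
    using k unfolding fps_add_nth fps_sub_nth fps_one_nth by simp
  then show ?thesis by (simp add: eq_neg_iff_add_eq_0 add.commute)
qed

lemma qlead_mult:
  assumes "qlead k A f" "qlead k B g"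
  shows "qlead k (A + B) (f oo g)"
proof -
  obtain m1 m2 m3 m4 where f: "qrep k f m1 m2 m3 m4" and A: "A = (m1 $ k, m2 $ k, m3 $ k)"
    using assms(1) unfolding qlead_def by blast
  obtain m1' m2' m3' m4' where g: "qrep k g m1' m2' m3' m4'" and B: "B = (m1' $ k, m2' $ k, m3' $ k)"
    using assms(2) unfolding qlead_def by blast
  have k: "1 \<le> k" and mf: "mrep f m1 m2 m3 m4" and mg: "mrep g m1' m2' m3' m4'"
    and df: "fps_X ^ k dvd m1 - 1" "fps_X ^ k dvd m2" "fps_X ^ k dvd m3" "fps_X ^ k dvd m4 - 1"
    and dg: "fps_X ^ k dvd m1' - 1" "fps_X ^ k dvd m2'" "fps_X ^ k dvd m3'" "fps_X ^ k dvd m4' - 1"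
    using f g by (auto simp: qrep_def)
  have g0: "g $ 0 = 0" "g $ 1 = 1" using mg by (auto simp: mrep_def carrier_nottingham)
  have c: "m1 $ 0 = 1" "m4 $ 0 = 1" "m1' $ 0 = 1" "m2' $ 0 = 0" "m3' $ 0 = 0" "m4' $ 0 = 1"
    using mf mg by (auto simp: mrep_def)
  have shift: "(h oo g) - 1 = (h - 1) oo g" for h by (simp add: fps_compose_sub_distrib)
  note cd = X_power_dvd_compose[OF _ g0(1)] and cl = compose_leading[OF _ g0]
  have e1: "(m1 oo g) * m1' + (m2 oo g) * m3' - 1 = ((m1 - 1) oo g) * m1' + (m1' - 1) + (m2 oo g) * m3'"
    unfolding shift[symmetric] by (simp add: algebra_simps)
  have e2: "(m1 oo g) * m2' + (m2 oo g) * m4' = m2' * (m1 oo g) + (m2 oo g) * m4'" by (simp add: mult.commute)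
  have e3: "(m3 oo g) * m1' + (m4 oo g) * m3' = (m3 oo g) * m1' + m3' * (m4 oo g)" by (simp add: mult.commute)
  have e4: "(m3 oo g) * m2' + (m4 oo g) * m4' - 1 = (m3 oo g) * m2' + ((m4 - 1) oo g) * m4' + (m4' - 1)"
    unfolding shift[symmetric] by (simp add: algebra_simps)
  have q: "qrep k (f oo g) ((m1 oo g) * m1' + (m2 oo g) * m3') ((m1 oo g) * m2' + (m2 oo g) * m4')
    ((m3 oo g) * m1' + (m4 oo g) * m3') ((m3 oo g) * m2' + (m4 oo g) * m4')"
    unfolding qrep_def e1 e2 e3 e4
    using mrep_mult[OF mf mg, unfolded e2 e3] k df dg by (auto intro!: dvd_add dvd_mult2 cd)
  have n1: "((m1 oo g) * m1' + (m2 oo g) * m3' - 1) $ k = m1 $ k + m1' $ k"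
    unfolding e1 fps_add_nth X_power_dvd_mult_nth[OF cd[OF df(1)]] X_power_dvd_mult_nth[OF cd[OF df(2)]]
      cl[OF df(1)] cl[OF df(2)] using c k by simp
  have n2: "((m1 oo g) * m2' + (m2 oo g) * m4') $ k = m2 $ k + m2' $ k"
    unfolding e2 fps_add_nth X_power_dvd_mult_nth[OF cd[OF df(2)]] X_power_dvd_mult_nth[OF dg(2)]
      cl[OF df(2)] using c by simp
  have n3: "((m3 oo g) * m1' + (m4 oo g) * m3') $ k = m3 $ k + m3' $ k"
    unfolding e3 fps_add_nth X_power_dvd_mult_nth[OF cd[OF df(3)]] X_power_dvd_mult_nth[OF dg(3)]
      cl[OF df(3)] using c by simp
  have "((m1 oo g) * m1' + (m2 oo g) * m3') $ k = m1 $ k + m1' $ k" using n1 k by simp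
  with q n2 n3 show ?thesis unfolding qlead_def A B by (intro exI conjI) auto
qed

lemma qlead_inv:
  assumes "qlead k A f"
  shows "qlead k (- A) (fps_inv f)"
proof -
  obtain m1 m2 m3 m4 where f: "qrep k f m1 m2 m3 m4" and A: "A = (m1 $ k, m2 $ k, m3 $ k)"
    using assms(1) unfolding qlead_def by blast
  have k: "1 \<le> k" and mf: "mrep f m1 m2 m3 m4"
    and df: "fps_X ^ k dvd m1 - 1" "fps_X ^ k dvd m2" "fps_X ^ k dvd m3" "fps_X ^ k dvd m4 - 1"
    using f by (auto simp: qrep_def)
  define h where "h = fps_inv f"
  have "h \<in> carrier N" using mrep_inv[OF mf] by (simp add: mrep_def h_def)
  then have h0: "h $ 0 = 0" "h $ 1 = 1" by (auto simp: carrier_nottingham)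
  have shift: "(g oo h) - 1 = (g - 1) oo h" for g by (simp add: fps_compose_sub_distrib)
  note cd = X_power_dvd_compose[OF _ h0(1)] and cl = compose_leading[OF _ h0]
  have q: "qrep k h (m4 oo h) (- (m2 oo h)) (- (m3 oo h)) (m1 oo h)"
    unfolding qrep_def shift dvd_minus_iff
    using mrep_inv[OF mf, folded h_def] k df by (auto intro: cd)
  have "((m4 oo h) - 1) $ k = - m1 $ k"
    unfolding shift cl[OF df(4)] using qrep_trace[OF f] k by simp
  then have "(m4 oo h) $ k = - m1 $ k" using k by simp
  with q show ?thesis
    unfolding qlead_def A h_def[symmetric] using cl[OF df(2)] cl[OF df(3)] by (intro exI conjI) auto
qed

lemma qlead_Suc: "1 \<le> k \<Longrightarrow> qlead k 0 f \<longleftrightarrow> (\<exists>A. qlead (Suc k) A f)"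
proof
  assume k: "1 \<le> k"
  show "\<exists>A. qlead (Suc k) A f" if z: "qlead k 0 f"
  proof -
    obtain m1 m2 m3 m4 where f: "qrep k f m1 m2 m3 m4" and A: "0 = (m1 $ k, m2 $ k, m3 $ k)"
      using z unfolding qlead_def by blast
    have "m4 $ k = 0" using qrep_trace[OF f] A by (simp add: zero_prod_def)
    then have "qrep (Suc k) f m1 m2 m3 m4"
      using f A k unfolding qrep_def X_power_dvd_Suc_iff by (simp add: zero_prod_def)
    then show ?thesis unfolding qlead_def by blast
  qed
  show "qlead k 0 f" if z: "\<exists>A. qlead (Suc k) A f"
  proof -
    obtain m1 m2 m3 m4 where f: "qrep (Suc k) f m1 m2 m3 m4" using z unfolding qlead_def by blast
    then have "qrep k f m1 m2 m3 m4" "m1 $ k = 0" "m2 $ k = 0" "m3 $ k = 0"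
      using k unfolding qrep_def X_power_dvd_Suc_iff by simp_all
    then show ?thesis unfolding qlead_def by (metis zero_prod_def)
  qed
qed

lemma qlead_one: "mrep f m1 m2 m3 m4 \<Longrightarrow> \<exists>A. qlead 1 A f"
proof -
  assume m: "mrep f m1 m2 m3 m4"
  have "fps_X ^ 1 dvd h \<longleftrightarrow> h $ 0 = 0" for h :: "'p mod_ring fps" unfolding X_power_dvd_iff by simp
  then have "qrep 1 f m1 m2 m3 m4" using m unfolding qrep_def by (simp add: mrep_def)
  then show ?thesis unfolding qlead_def by blast
qed

text \<open>Three entries are prescribed and the determinant gives the fourth. As
  \<open>r < q k\<close>, a factor \<open>t^r\<close> splits off the numerator, and the
  \<open>r\<close>-th root is taken of a series with constant term 1.\<close>

lemma qlead_exists: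
  assumes k: "1 \<le> k"
  shows "\<exists>f. qlead k A f"
proof -
  obtain a b c where A: "A = (a, b, c)" by (cases A)
  define m1 where "m1 = 1 + fps_const a * fps_X ^ k"
  define m2 where "m2 = fps_const b * fps_X ^ k"
  define m3 where "m3 = fps_const c * fps_X ^ k"
  define m4 where "m4 = (1 + m2 * m3) * inverse m1"
  have a0: "m1 $ 0 = 1" and b0: "m2 $ 0 = 0" and c0: "m3 $ 0 = 0"
    using k by (simp_all add: m1_def m2_def m3_def)
  have ai: "inverse m1 * m1 = 1" using a0 by (intro inverse_mult_eq_1) simp
  have det: "m1 * m4 - m2 * m3 = 1"
  proof -
    have "m1 * m4 = (1 + m2 * m3) * (inverse m1 * m1)" by (simp add: m4_def algebra_simps)
    then show ?thesis by (simp add: ai)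
  qed
  have d0: "m4 $ 0 = 1" using a0 b0 by (simp add: m4_def)
  have "m4 - 1 = (1 + m2 * m3) * inverse m1 - inverse m1 * m1" by (simp add: m4_def ai)
  also have "\<dots> = (m2 * m3 - fps_const a * fps_X ^ k) * inverse m1"
    by (simp add: m1_def algebra_simps)
  finally have dd: "fps_X ^ k dvd m4 - 1" by (simp add: m2_def)
  have rqk: "r < q * k" using rq' k by (metis less_le_trans mult_le_mono2 mult.right_neutral mult_2 trans_less_add1 le_add1 le_less_trans)
  define m2x where "m2x = fps_const b * fps_X ^ (q * k - r)"
  have sb: "stretch m2 = fps_X ^ r * m2x"
  proof -
    have "stretch m2 = fps_const b * fps_X ^ (q * k)"
      using Xq0 by (simp add: stretch_def m2_def fps_compose_mult_distrib fps_compose_power[symmetric] power_mult)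
    also have "fps_X ^ (q * k) = fps_X ^ r * (fps_X ^ (q * k - r) :: 'p mod_ring fps)"
      using rqk by (simp flip: power_add)
    finally show ?thesis by (simp add: m2x_def mult.left_commute)
  qed
  define v where "v = stretch m3 * fps_X ^ r + stretch m4"
  have v0: "v $ 0 = 1" using c0 d0 by (simp add: v_def)
  have "((stretch m1 + m2x) * inverse v) $ 0 = 1" using a0 v0 rqk by (simp add: m2x_def)
  then obtain h where h: "h $ 0 = 1" "h ^ r = (stretch m1 + m2x) * inverse v"
    using fps_root_exists r_nonzero by blast
  have vi: "inverse v * v = 1" using v0 by (intro inverse_mult_eq_1) simp
  have "(fps_X * h) ^ r * v = fps_X ^ r * (stretch m1 + m2x) * (inverse v * v)"
    unfolding power_mult_distrib h(2) by (simp only: mult.assoc)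
  also have "\<dots> = stretch m1 * fps_X ^ r + stretch m2"
    unfolding vi sb by (simp add: algebra_simps)
  finally have "(fps_X * h) ^ r * v = stretch m1 * fps_X ^ r + stretch m2" .
  moreover have "fps_X * h \<in> carrier N" using h(1) by (simp add: carrier_nottingham)
  ultimately have "mrep (fps_X * h) m1 m2 m3 m4"
    unfolding mrep_def v_def using det a0 b0 c0 d0 by simp
  then have "qrep k (fps_X * h) m1 m2 m3 m4"
    unfolding qrep_def using k dd by (simp add: m1_def m2_def m3_def)
  moreover have "m1 $ k = a" "m2 $ k = b" "m3 $ k = c" using k by (simp_all add: m1_def m2_def m3_def)
  ultimately show ?thesis unfolding qlead_def A by blast
qed

text \<open>By \<open>mrep_difference\<close> the order of \<open>f^r - t^r\<close> is at least
  \<open>q k\<close>; dividing by \<open>t^r\<close> and by a unit with constant term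
  \<open>r\<close> bounds \<open>f / t - 1\<close>. The order \<open>k + 2\<close>, rather than
  \<open>k + 1\<close>, makes substitution of \<open>f\<close> invisible in leading
  brackets.\<close>

lemma qlead_close:
  assumes "qlead k A f"
  shows "fps_X ^ (k + 2) dvd f - fps_X"
proof -
  obtain m1 m2 m3 m4 where f: "qrep k f m1 m2 m3 m4" using assms unfolding qlead_def by blast
  have k: "1 \<le> k" and mf: "mrep f m1 m2 m3 m4"
    and df: "fps_X ^ k dvd m1 - 1" "fps_X ^ k dvd m2" "fps_X ^ k dvd m3" "fps_X ^ k dvd m4 - 1"
    using f by (auto simp: qrep_def)
  have "(m1 - 1) - (m4 - 1) = m1 - m4" by simp
  then have ad: "fps_X ^ k dvd m1 - m4" using dvd_diff[OF df(1,4)] by metis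
  have "fps_X ^ (q * k) dvd (f ^ r - fps_X ^ r) * (stretch m3 * fps_X ^ r + stretch m4)"
    unfolding mrep_difference[OF mf]
    by (intro dvd_add dvd_mult2 stretch_dvd) (use df ad in simp_all)
  moreover have "(stretch m3 * fps_X ^ r + stretch m4) $ 0 \<noteq> 0" using mf by (simp add: mrep_def)
  ultimately have 1: "fps_X ^ (q * k) dvd f ^ r - fps_X ^ r" using X_power_dvd_unit_iff by blast
  have fc: "f \<in> carrier N" using mf by (simp add: mrep_def)
  then have "fps_X ^ 1 dvd f" unfolding X_power_dvd_iff by (simp add: carrier_nottingham)
  then obtain h where h: "f = fps_X * h" by (auto elim: dvdE)
  have h0: "h $ 0 = 1" using fc by (simp add: h carrier_nottingham)
  have rqk: "r \<le> q * k" using rq' k by (metis le_trans less_imp_le mult_le_mono2 mult.right_neutral mult_2 le_add1)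
  have "f ^ r - fps_X ^ r = fps_X ^ r * (h ^ r - 1 ^ r)"
    by (simp add: h power_mult_distrib algebra_simps)
  moreover have "fps_X ^ (q * k) = fps_X ^ r * (fps_X ^ (q * k - r) :: 'p mod_ring fps)"
    using rqk by (simp flip: power_add)
  ultimately have "fps_X ^ r * fps_X ^ (q * k - r) dvd fps_X ^ r * (h ^ r - 1 ^ r)"
    using 1 by (simp only:)
  then have 2: "fps_X ^ (q * k - r) dvd h ^ r - 1 ^ r"
    by (subst (asm) dvd_mult_cancel_left) simp
  define S where "S = (\<Sum>i<r. (1 :: 'p mod_ring fps) ^ (r - Suc i) * h ^ i)"
  have "S $ 0 = of_nat r" using h0 by (simp add: S_def fps_sum_nth fps_power_zeroth)
  then have "S $ 0 \<noteq> 0" using r_nonzero by simp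
  moreover have "h ^ r - 1 ^ r = (h - 1) * S" unfolding S_def by (rule power_diff_sumr2)
  ultimately have 3: "fps_X ^ (q * k - r) dvd h - 1" using 2 X_power_dvd_unit_iff by metis
  have "k + 1 \<le> q * k - r"
  proof -
    obtain j where j: "k = Suc j" using k by (cases k) auto
    have "5 * j \<le> q * j" using q5 by simp
    moreover have "q * k = q * j + q" by (simp add: j)
    ultimately show ?thesis using rq' q5 j by linarith
  qed
  then have "fps_X ^ (k + 1) dvd h - 1" using 3 X_power_dvd_mono by blast
  then have "fps_X ^ 1 * fps_X ^ (k + 1) dvd fps_X ^ 1 * (h - 1)" by simp
  moreover have "fps_X ^ 1 * (h - 1) = f - fps_X" by (simp add: h algebra_simps)
  moreover have "fps_X ^ 1 * fps_X ^ (k + 1) = (fps_X ^ (k + 2) :: 'p mod_ring fps)" by simp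
  ultimately show ?thesis by metis
qed

text \<open>The order \<open>q k + 2 r\<close> covers all positions at which
  \<open>independent\<close> reads off coefficients of index below \<open>k\<close>. The diagonal
  entries follow from the determinant, since \<open>m1 + 1\<close> is a unit.\<close>

lemma qlead_of_close:
  assumes m: "mrep f m1 m2 m3 m4" and k: "1 \<le> k" and close: "fps_X ^ Suc (q * k + 2 * r) dvd f - fps_X"
  shows "\<exists>A. qlead k A f"
proof -
  define J where "J = q * k + 2 * r"
  have f0: "f $ 0 = 0" using m by (simp add: mrep_def carrier_nottingham)
  obtain r' where r': "r = Suc r'" using r0 by (cases r) auto
  have "fps_X ^ (Suc J + r') dvd f ^ Suc r' - fps_X ^ Suc r'"
    by (rule X_power_dvd_diff_power) (use close f0 J_def in auto)
  then have "fps_X ^ J dvd f ^ r - fps_X ^ r" unfolding r' by (rule X_power_dvd_mono) simp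
  then have d: "fps_X ^ J dvd stretch m2 + stretch (m1 - m4) * fps_X ^ r + stretch (- m3) * fps_X ^ (2 * r)"
    unfolding mrep_difference[OF m, symmetric] by (rule dvd_mult2)
  have lt: "q * i + j < J" if "i < k" "j \<le> 2 * r" for i j
  proof -
    have "q * i + q \<le> q * k" using that(1) by (metis Suc_leI mult_le_mono2 mult_Suc_right add.commute)
    then show ?thesis using that(2) q5 by (simp add: J_def)
  qed
  have b: "fps_X ^ k dvd m2" and ad: "fps_X ^ k dvd m1 - m4" and c': "fps_X ^ k dvd - m3"
    using d independent[of m2 "m1 - m4" "- m3"] lt[of _ 0] lt[of _ r] lt[of _ "2 * r"]
    unfolding X_power_dvd_iff by (metis add.right_neutral le0, metis le_add1 mult_2, metis order_refl)
  have c: "fps_X ^ k dvd m3" using c' by simp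
  have det: "m1 * m4 - m2 * m3 = 1" using m by (simp add: mrep_def)
  have "(m1 - 1) * (m1 + 1) = m1 * (m1 - m4) + m2 * m3 + ((m1 * m4 - m2 * m3) - 1)"
    by (simp add: algebra_simps)
  then have "(m1 - 1) * (m1 + 1) = m1 * (m1 - m4) + m2 * m3" by (simp add: det)
  moreover have "fps_X ^ k dvd m1 * (m1 - m4) + m2 * m3"
    by (intro dvd_add dvd_mult ad c)
  moreover have "(m1 + 1) $ 0 \<noteq> 0" using m two by (simp add: mrep_def)
  ultimately have a: "fps_X ^ k dvd m1 - 1" using X_power_dvd_unit_iff by metis
  have "(m1 - 1) - (m1 - m4) = m4 - 1" by simp
  then have "fps_X ^ k dvd m4 - 1" using dvd_diff[OF a ad] by metis
  with a b c m k have "qrep k f m1 m2 m3 m4" by (simp add: qrep_def)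
  then show ?thesis unfolding qlead_def by blast
qed

text \<open>\<open>P\<close> and \<open>R\<close> represent \<open>f oo g\<close> and
  \<open>g oo f\<close>. By \<open>qlead_close\<close> the substitutions change entries only beyond
  degree \<open>k + l\<close>, so \<open>P - R\<close> has the leading term of an ordinary matrix
  commutator; multiplying by the inverse of \<open>R\<close> and substituting \<open>v\<close>
  preserve it.\<close>

lemma qlead_comm:
  assumes "qlead k A f" "qlead l B g"
  shows "qlead (k + l) (sl_br A B) ((f oo g) oo fps_inv (g oo f))"
proof -
  obtain m1 m2 m3 m4 where f: "qrep k f m1 m2 m3 m4" and A: "A = (m1 $ k, m2 $ k, m3 $ k)"
    using assms(1) unfolding qlead_def by blast
  obtain m1' m2' m3' m4' where g: "qrep l g m1' m2' m3' m4'" and B: "B = (m1' $ l, m2' $ l, m3' $ l)"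
    using assms(2) unfolding qlead_def by blast
  have k: "1 \<le> k" and mf: "mrep f m1 m2 m3 m4"
    and df: "fps_X ^ k dvd m1 - 1" "fps_X ^ k dvd m2" "fps_X ^ k dvd m3" "fps_X ^ k dvd m4 - 1"
    using f by (auto simp: qrep_def)
  have l: "1 \<le> l" and mg: "mrep g m1' m2' m3' m4'"
    and dg: "fps_X ^ l dvd m1' - 1" "fps_X ^ l dvd m2'" "fps_X ^ l dvd m3'" "fps_X ^ l dvd m4' - 1"
    using g by (auto simp: qrep_def)
  have f0: "f $ 0 = 0" and g0: "g $ 0 = 0" using mf mg by (auto simp: mrep_def carrier_nottingham)
  define n where "n = k + l"
  define P1 P2 P3 P4 where "P1 = (m1 oo g) * m1' + (m2 oo g) * m3'" and "P2 = (m1 oo g) * m2' + (m2 oo g) * m4'"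
    and "P3 = (m3 oo g) * m1' + (m4 oo g) * m3'" and "P4 = (m3 oo g) * m2' + (m4 oo g) * m4'"
  define R1 R2 R3 R4 where "R1 = (m1' oo f) * m1 + (m2' oo f) * m3" and "R2 = (m1' oo f) * m2 + (m2' oo f) * m4"
    and "R3 = (m3' oo f) * m1 + (m4' oo f) * m3" and "R4 = (m3' oo f) * m2 + (m4' oo f) * m4"
  have P: "mrep (f oo g) P1 P2 P3 P4" unfolding P1_def P2_def P3_def P4_def by (rule mrep_mult[OF mf mg])
  have R: "mrep (g oo f) R1 R2 R3 R4" unfolding R1_def R2_def R3_def R4_def by (rule mrep_mult[OF mg mf])
  have R0: "R1 $ 0 = 1" "R2 $ 0 = 0" "R3 $ 0 = 0" "R4 $ 0 = 1" and Rdet: "R1 * R4 - R2 * R3 = 1"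
    using R by (auto simp: mrep_def)
  define v where "v = fps_inv (g oo f)"
  note V = mrep_inv[OF R, folded v_def]
  have vc: "v \<in> carrier N" using V by (simp add: mrep_def)
  then have v0: "v $ 0 = 0" "v $ 1 = 1" by (auto simp: carrier_nottingham)
  \<comment> \<open>The product of \<open>P\<close> with the adjugate of \<open>R\<close>;
    substituting \<open>v\<close> gives the matrix of the group commutator.\<close>
  define Z1 Z2 Z3 Z4 where "Z1 = P1 * R4 - P2 * R3" and "Z2 = P2 * R1 - P1 * R2"
    and "Z3 = P3 * R4 - P4 * R3" and "Z4 = P4 * R1 - P3 * R2"
  have Z: "mrep ((f oo g) oo v) (Z1 oo v) (Z2 oo v) (Z3 oo v) (Z4 oo v)"
    using mrep_mult[OF P V] v0(1)
    by (simp add: Z1_def Z2_def Z3_def Z4_def fps_compose_sub_distrib fps_compose_mult_distrib algebra_simps)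
  define E1 E2 E3 E4 where "E1 = P1 - R1" and "E2 = P2 - R2" and "E3 = P3 - R3" and "E4 = P4 - R4"
  have gcl: "fps_X ^ Suc (l + 1) dvd g - fps_X" using qlead_close[OF assms(2)] by simp
  have fcl: "fps_X ^ Suc (k + 1) dvd f - fps_X" using qlead_close[OF assms(1)] by simp
  have cg: "fps_X ^ Suc n dvd (h oo g) - h" if "fps_X ^ k dvd h" for h
    using compose_diff[OF that gcl g0] by (simp add: n_def)
  have cf: "fps_X ^ Suc n dvd (h oo f) - h" if "fps_X ^ l dvd h" for h
    using compose_diff[OF that fcl f0] by (simp add: n_def add.commute)
  have shift: "((h - 1) oo w) - (h - 1) = (h oo w) - h" for h w :: "'p mod_ring fps"
    by (simp add: fps_compose_sub_distrib)
  have dl: "fps_X ^ Suc n dvd (m1 oo g) - m1" "fps_X ^ Suc n dvd (m2 oo g) - m2"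
      "fps_X ^ Suc n dvd (m3 oo g) - m3" "fps_X ^ Suc n dvd (m4 oo g) - m4"
      "fps_X ^ Suc n dvd (m1' oo f) - m1'" "fps_X ^ Suc n dvd (m2' oo f) - m2'"
      "fps_X ^ Suc n dvd (m3' oo f) - m3'" "fps_X ^ Suc n dvd (m4' oo f) - m4'"
    using cg[OF df(1)] cg[OF df(2)] cg[OF df(3)] cg[OF df(4)] cf[OF dg(1)] cf[OF dg(2)] cf[OF dg(3)] cf[OF dg(4)]
    unfolding shift by blast+
  have pr: "fps_X ^ n dvd x * y" "(x * y) $ n = x $ k * y $ l"
    if xy: "fps_X ^ k dvd x" "fps_X ^ l dvd y" for x y :: "'p mod_ring fps"
  proof -
    show "fps_X ^ n dvd x * y" unfolding n_def using xy by (rule X_power_dvd_mult)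
    obtain x' where x': "x = fps_X ^ k * x'" using xy(1) by (auto elim: dvdE)
    have "(x * y) $ n = (x' * y) $ l" by (simp add: x' n_def mult.assoc fps_X_power_mult_nth)
    also have "\<dots> = (y * x') $ l" by (simp add: mult.commute)
    also have "\<dots> = y $ l * x' $ 0" by (rule X_power_dvd_mult_nth[OF xy(2)])
    also have "x' $ 0 = x $ k" by (simp add: x' fps_X_power_mult_nth)
    finally show "(x * y) $ n = x $ k * y $ l" by simp
  qed
  have close: "fps_X ^ n dvd E \<and> E $ n = F $ n" if "fps_X ^ Suc n dvd E - F" "fps_X ^ n dvd F"
    for E F :: "'p mod_ring fps"
  proof -
    have "fps_X ^ n dvd (E - F) + F" using that X_power_dvd_mono[OF that(1), of n] by (intro dvd_add) simp_all
    moreover have "(E - F) $ n = 0" using that(1) unfolding X_power_dvd_iff by blast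
    ultimately show ?thesis by simp
  qed
  \<comment> \<open>The commutator of the untwisted matrices, written with the identity subtracted,
    so that every product has factors of orders \<open>k\<close> and \<open>l\<close>.\<close>
  define F1 where "F1 = m2 * m3' - m3 * m2'"
  define F2 where "F2 = (m1 - 1) * m2' + m2 * (m4' - 1) - m2 * (m1' - 1) - (m4 - 1) * m2'"
  define F3 where "F3 = m3 * (m1' - 1) + (m4 - 1) * m3' - (m1 - 1) * m3' - m3 * (m4' - 1)"
  define F4 where "F4 = m3 * m2' - m2 * m3'"
  have E1F: "E1 - F1 = ((m1 oo g) - m1) * m1' + ((m2 oo g) - m2) * m3'
      - ((m1' oo f) - m1') * m1 - ((m2' oo f) - m2') * m3"
    by (simp add: E1_def P1_def R1_def F1_def algebra_simps)
  have E2F: "E2 - F2 = ((m1 oo g) - m1) * m2' + ((m2 oo g) - m2) * m4'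
      - ((m1' oo f) - m1') * m2 - ((m2' oo f) - m2') * m4"
    by (simp add: E2_def P2_def R2_def F2_def algebra_simps)
  have E3F: "E3 - F3 = ((m3 oo g) - m3) * m1' + ((m4 oo g) - m4) * m3'
      - ((m3' oo f) - m3') * m1 - ((m4' oo f) - m4') * m3"
    by (simp add: E3_def P3_def R3_def F3_def algebra_simps)
  have E4F: "E4 - F4 = ((m3 oo g) - m3) * m2' + ((m4 oo g) - m4) * m4'
      - ((m3' oo f) - m3') * m2 - ((m4' oo f) - m4') * m4"
    by (simp add: E4_def P4_def R4_def F4_def algebra_simps)
  have EF: "fps_X ^ Suc n dvd E1 - F1" "fps_X ^ Suc n dvd E2 - F2" "fps_X ^ Suc n dvd E3 - F3" "fps_X ^ Suc n dvd E4 - F4"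
    unfolding E1F E2F E3F E4F by (intro dvd_add dvd_diff dvd_mult2 dl)+
  have Fd: "fps_X ^ n dvd F1" "fps_X ^ n dvd F2" "fps_X ^ n dvd F3" "fps_X ^ n dvd F4"
    unfolding F1_def F2_def F3_def F4_def by (intro dvd_add dvd_diff pr(1) df dg)+
  have tr: "m4 $ k = - m1 $ k" "m4' $ l = - m1' $ l" using qrep_trace f g by blast+
  have Fn: "(F1 $ n, F2 $ n, F3 $ n) = sl_br A B"
    unfolding A B F1_def F2_def F3_def fps_add_nth[of "_ - _"] fps_add_nth[of "_ * _"] fps_sub_nth
      pr(2)[OF df(2) dg(3)] pr(2)[OF df(3) dg(2)] pr(2)[OF df(1) dg(2)] pr(2)[OF df(2) dg(4)]
      pr(2)[OF df(2) dg(1)] pr(2)[OF df(4) dg(2)] pr(2)[OF df(3) dg(1)] pr(2)[OF df(4) dg(3)]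
      pr(2)[OF df(1) dg(3)] pr(2)[OF df(3) dg(4)]
    using k l by (simp add: tr algebra_simps)
  have E: "fps_X ^ n dvd E1" "fps_X ^ n dvd E2" "fps_X ^ n dvd E3" "fps_X ^ n dvd E4"
    and En: "(E1 $ n, E2 $ n, E3 $ n) = sl_br A B"
    using close[OF EF(1) Fd(1)] close[OF EF(2) Fd(2)] close[OF EF(3) Fd(3)] close[OF EF(4) Fd(4)] Fn by auto
  have Z1: "Z1 - 1 = E1 * R4 - E2 * R3"
  proof -
    have "Z1 - 1 = E1 * R4 - E2 * R3 + ((R1 * R4 - R2 * R3) - 1)"
      by (simp add: Z1_def E1_def E2_def algebra_simps)
    then show ?thesis by (simp add: Rdet)
  qed
  have Z2: "Z2 = E2 * R1 - E1 * R2" by (simp add: Z2_def E1_def E2_def algebra_simps)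
  have Z3: "Z3 = E3 * R4 - E4 * R3" by (simp add: Z3_def E3_def E4_def algebra_simps)
  have Z4: "Z4 - 1 = E4 * R1 - E3 * R2"
  proof -
    have "Z4 - 1 = E4 * R1 - E3 * R2 + ((R1 * R4 - R2 * R3) - 1)"
      by (simp add: Z4_def E3_def E4_def algebra_simps)
    then show ?thesis by (simp add: Rdet)
  qed
  have Zd: "fps_X ^ n dvd Z1 - 1" "fps_X ^ n dvd Z2" "fps_X ^ n dvd Z3" "fps_X ^ n dvd Z4 - 1"
    unfolding Z1 Z2 Z3 Z4 by (intro dvd_diff dvd_mult2 E)+
  have Zn: "(Z1 - 1) $ n = E1 $ n" "Z2 $ n = E2 $ n" "Z3 $ n = E3 $ n"
    unfolding Z1 Z2 Z3 fps_sub_nth using R0 by (simp_all add: X_power_dvd_mult_nth E)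
  have sv: "(h oo v) - 1 = (h - 1) oo v" for h by (simp add: fps_compose_sub_distrib)
  have n1: "1 \<le> n" using k by (simp add: n_def)
  have q: "qrep n ((f oo g) oo v) (Z1 oo v) (Z2 oo v) (Z3 oo v) (Z4 oo v)"
    unfolding qrep_def sv using Z n1 Zd by (auto intro: X_power_dvd_compose[OF _ v0(1)])
  have "((Z1 oo v) - 1) $ n = E1 $ n" unfolding sv compose_leading[OF Zd(1) v0] by (rule Zn(1))
  then have "(Z1 oo v) $ n = E1 $ n" using n1 by simp
  then have "sl_br A B = ((Z1 oo v) $ n, (Z2 oo v) $ n, (Z3 oo v) $ n)"
    using En Zn compose_leading[OF Zd(2) v0] compose_leading[OF Zd(3) v0] by simp
  with q show ?thesis unfolding qlead_def n_def[symmetric] v_def[symmetric] by blast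
qed

subsection \<open>Ershov's group as a graded group\<close>

lemma Q_carrier: "f \<in> Q \<Longrightarrow> f \<in> carrier N"
  unfolding mem_Q_iff mrep_def by blast

lemma qlead_Q: "qlead k A f \<Longrightarrow> f \<in> Q"
  unfolding qlead_def qrep_def mem_Q_iff by blast

lemma Q_compose: "f \<in> Q \<Longrightarrow> g \<in> Q \<Longrightarrow> f oo g \<in> Q"
  unfolding mem_Q_iff using mrep_mult by blast

lemma Q_inv: "f \<in> Q \<Longrightarrow> fps_inv f \<in> Q"
  unfolding mem_Q_iff using mrep_inv by blast

lemma subgroup_Q: "subgroup Q N"
proof
  show "Q \<subseteq> carrier N" using Q_carrier by blast
  show "\<one>\<^bsub>N\<^esub> \<in> Q" unfolding one_nottingham mem_Q_iff using mrep_one by blast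
  show "x \<otimes>\<^bsub>N\<^esub> y \<in> Q" if "x \<in> Q" "y \<in> Q" for x y
    using Q_compose[OF that] by (simp add: mult_nottingham)
  show "inv\<^bsub>N\<^esub> x \<in> Q" if "x \<in> Q" for x
    using Q_inv[OF that] inv_nottingham[OF Q_carrier[OF that]] by simp
qed

text \<open>The filtration by matrices and the one induced from the Nottingham group are cofinal in
  each other, by \<open>qlead_close\<close> and \<open>qlead_of_close\<close>.\<close>

lemma openin_Q_iff:
  "openin (subtopology nottingham_topology Q) U \<longleftrightarrow>
    U \<subseteq> Q \<and> (\<forall>x\<in>U. \<exists>k\<ge>1. \<forall>g A. qlead k A g \<longrightarrow> x oo g \<in> U)"
proof
  assume "openin (subtopology nottingham_topology Q) U"
  then obtain V where V: "openin nottingham_topology V" "U = V \<inter> Q" by (auto simp: openin_subtopology)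
  show "U \<subseteq> Q \<and> (\<forall>x\<in>U. \<exists>k\<ge>1. \<forall>g A. qlead k A g \<longrightarrow> x oo g \<in> U)"
  proof (intro conjI ballI)
    show "U \<subseteq> Q" using V by blast
    fix x assume x: "x \<in> U"
    then obtain k where k: "k \<ge> 1" "\<And>g. g \<in> nottingham_filtration k \<Longrightarrow> x oo g \<in> V"
      using V unfolding openin_nottingham_iff by blast
    have "x oo g \<in> U" if g: "qlead k A g" for g A
    proof -
      have "g \<in> nottingham_filtration k"
        using qlead_close[OF g] X_power_dvd_mono[of "k + 2" "g - fps_X" "k + 1"] Q_carrier[OF qlead_Q[OF g]]
        unfolding nottingham_filtration_def by simp
      then show ?thesis using k(2) Q_compose[OF _ qlead_Q[OF g]] x V(2) by blast
    qed
    then show "\<exists>k\<ge>1. \<forall>g A. qlead k A g \<longrightarrow> x oo g \<in> U" using k(1) by blast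
  qed
next
  assume U: "U \<subseteq> Q \<and> (\<forall>x\<in>U. \<exists>k\<ge>1. \<forall>g A. qlead k A g \<longrightarrow> x oo g \<in> U)"
  interpret group N by (rule group_nottingham)
  show "openin (subtopology nottingham_topology Q) U"
  proof (subst openin_subopen, intro ballI)
    fix x assume x: "x \<in> U"
    then obtain k where k: "k \<ge> 1" "\<And>g A. qlead k A g \<Longrightarrow> x oo g \<in> U" using U by blast
    define J where "J = q * k + 2 * r"
    define W where "W = x <#\<^bsub>N\<^esub> nottingham_filtration J"
    have J: "1 \<le> J" using r0 by (simp add: J_def)
    have xQ: "x \<in> Q" and xc: "x \<in> carrier N" using x U Q_carrier by blast+
    have "openin nottingham_topology W"
      unfolding nottingham_topology_def W_def
      by (rule topology_generated_by_Basis) (use xc J in blast)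
    then have "openin (subtopology nottingham_topology Q) (W \<inter> Q)" by (auto simp: openin_subtopology)
    moreover have "fps_X \<in> nottingham_filtration J"
      by (simp add: nottingham_filtration_def carrier_nottingham)
    then have "x oo fps_X \<in> W" unfolding W_def l_coset_def mult_nottingham by blast
    then have "x \<in> W \<inter> Q" using xQ by simp
    moreover have "W \<inter> Q \<subseteq> U"
    proof
      fix y assume y: "y \<in> W \<inter> Q"
      then obtain g where g: "g \<in> nottingham_filtration J" "y = x oo g"
        unfolding W_def l_coset_def mult_nottingham by blast
      have gc: "g \<in> carrier N" using g(1) by (simp add: nottingham_filtration_def)
      have "inv\<^bsub>N\<^esub> x \<otimes>\<^bsub>N\<^esub> y = g"
        using xc gc unfolding g(2) mult_nottingham[symmetric] by (simp flip: m_assoc)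
      then have "g \<in> Q"
        using subgroup.m_closed[OF subgroup_Q subgroup.m_inv_closed[OF subgroup_Q xQ], of y] y by simp
      then obtain m1 m2 m3 m4 where m: "mrep g m1 m2 m3 m4" unfolding mem_Q_iff by blast
      have "fps_X ^ Suc (q * k + 2 * r) dvd g - fps_X"
        using g(1) by (simp add: nottingham_filtration_def J_def)
      then obtain A where "qlead k A g" using qlead_of_close[OF m k(1)] by blast
      then show "y \<in> U" using k(2) g(2) by blast
    qed
    ultimately show "\<exists>V. openin (subtopology nottingham_topology Q) V \<and> x \<in> V \<and> V \<subseteq> U" by blast
  qed
qed

abbreviation NQ where "NQ \<equiv> N \<lparr> carrier := Q \<rparr>"

lemma sl2_graded_group_Q: "sl2_graded_group NQ (subtopology nottingham_topology Q) qlead"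
proof -
  interpret N: group N by (rule group_nottingham)
  interpret group NQ by (rule N.subgroup_imp_group[OF subgroup_Q])
  have mult: "f \<otimes>\<^bsub>NQ\<^esub> g = f oo g" for f g by (simp add: mult_nottingham)
  have inv: "inv\<^bsub>NQ\<^esub> f = fps_inv f" if "f \<in> Q" for f
    using N.m_inv_consistent[OF subgroup_Q that] inv_nottingham[OF Q_carrier[OF that]] by simp
  show ?thesis
  proof unfold_locales
    fix k :: nat and A f
    assume f: "qlead k A f"
    show "1 \<le> k" using f by (auto simp: qlead_def qrep_def)
    show "f \<in> carrier NQ" using qlead_Q[OF f] by simp
    show "qlead k (- A) (inv\<^bsub>NQ\<^esub> f)" using qlead_inv[OF f] inv[OF qlead_Q[OF f]] by simp
    fix B g assume "qlead k B g"
    then show "qlead k (A + B) (f \<otimes>\<^bsub>NQ\<^esub> g)" unfolding mult by (rule qlead_mult[OF f])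
  next
    fix f assume "f \<in> carrier NQ"
    then have "f \<in> Q" by simp
    then show "\<exists>A. qlead 1 A f" unfolding mem_Q_iff using qlead_one by blast
  next
    fix k :: nat and f assume "1 \<le> k"
    then show "qlead k 0 f \<longleftrightarrow> (\<exists>A. qlead (Suc k) A f)" by (rule qlead_Suc)
  next
    fix k A assume "qlead k A \<one>\<^bsub>NQ\<^esub>"
    then have "qlead k A fps_X" by (simp add: one_nottingham)
    then obtain m1 m2 m3 m4 where "1 \<le> k" "mrep fps_X m1 m2 m3 m4" "A = (m1 $ k, m2 $ k, m3 $ k)"
      unfolding qlead_def qrep_def by blast
    then show "A = 0" using mrep_one_unique[of m1 m2 m3 m4] by (simp add: zero_prod_def)
  next
    fix k :: nat and A :: "'p mod_ring sl2" assume "1 \<le> k"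
    then show "\<exists>f. qlead k A f" by (rule qlead_exists)
  next
    fix k A f l B g assume fg: "qlead k A f" "qlead l B g"
    have c: "f \<in> Q" "g \<in> Q" using fg qlead_Q by blast+
    have "f \<otimes>\<^bsub>NQ\<^esub> g \<otimes>\<^bsub>NQ\<^esub> inv\<^bsub>NQ\<^esub> f \<otimes>\<^bsub>NQ\<^esub> inv\<^bsub>NQ\<^esub> g = (f \<otimes>\<^bsub>NQ\<^esub> g) \<otimes>\<^bsub>NQ\<^esub> inv\<^bsub>NQ\<^esub> (g \<otimes>\<^bsub>NQ\<^esub> f)"
    proof -
      have c': "f \<in> carrier NQ" "g \<in> carrier NQ" using c by simp_all
      show ?thesis
        unfolding inv_mult_group[OF c'(2,1)]
        by (rule m_assoc[OF m_closed[OF c'] inv_closed[OF c'(1)] inv_closed[OF c'(2)]])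
    qed
    also have "\<dots> = (f oo g) oo fps_inv (g oo f)"
      unfolding mult using inv[OF Q_compose[OF c(2,1)]] by simp
    finally show "qlead (k + l) (sl_br A B) (f \<otimes>\<^bsub>NQ\<^esub> g \<otimes>\<^bsub>NQ\<^esub> inv\<^bsub>NQ\<^esub> f \<otimes>\<^bsub>NQ\<^esub> inv\<^bsub>NQ\<^esub> g)"
      using qlead_comm[OF fg] by simp
  next
    fix f assume "f \<in> carrier NQ" and all: "\<And>k. 1 \<le> k \<Longrightarrow> \<exists>A. qlead k A f"
    have "(f - fps_X) $ i = 0" for i
    proof -
      obtain A where "qlead (Suc i) A f" using all[of "Suc i"] by auto
      from qlead_close[OF this] show ?thesis unfolding X_power_dvd_iff by auto
    qed
    then have "f - fps_X = 0" by (intro fps_ext) simp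
    then show "f = \<one>\<^bsub>NQ\<^esub>" by (simp add: one_nottingham)
  next
    show "sl_br (A + A') B = sl_br A B + sl_br A' B" for A A' B :: "'p mod_ring sl2"
      by (rule sl_br_add_left)
    show "sl_br A (B + B') = sl_br A B + sl_br A B'" for A B B' :: "'p mod_ring sl2"
      by (rule sl_br_add_right)
    fix k :: nat
    have "sl_br (1, 0, 0) (0, 1, 0) \<noteq> (0 :: 'p mod_ring sl2)" using two by (simp add: zero_prod_def)
    then show "\<exists>i\<ge>k. \<exists>j\<ge>k. \<exists>A B. sl_br A B \<noteq> (0 :: 'p mod_ring sl2)" by blast
  next
    have "(1, 0, 0) + (1, 0, 0) \<noteq> (0 :: 'p mod_ring sl2)" using two by (simp add: zero_prod_def)
    then show "\<exists>A :: 'p mod_ring sl2. A + A \<noteq> 0" by blast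
  next
    fix U
    show "openin (subtopology nottingham_topology Q) U \<longleftrightarrow> U \<subseteq> carrier NQ \<and>
      (\<forall>x\<in>U. \<exists>k\<ge>1. \<forall>g A. qlead k A g \<longrightarrow> x \<otimes>\<^bsub>NQ\<^esub> g \<in> U)"
      unfolding openin_Q_iff mult by simp
  next
    show "5 \<le> CARD('p)" by (rule p5)
    show "(2 :: 'p mod_ring) \<noteq> 0" by (rule two)
  qed
qed

lemma diameter_Q: "graph_diameter (proper_virt_gen_graph NQ (subtopology nottingham_topology Q)) = 2"
  by (rule sl2_graded_group.sl2_diameter[OF sl2_graded_group_Q])

end

section \<open>The diameters\<close>

theorem theorem4:
  fixes p :: nat
  assumes "prime p" and "5 \<le> p" and "p = CARD('p::prime_card)"
  shows "graph_diameter (proper_virt_gen_graph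
            (nottingham :: 'p mod_ring fps monoid) nottingham_topology) = 2
    \<and> (\<forall>(s::nat) (r::nat). 1 \<le> s \<and> 0 < r \<and> real r < real (p ^ s) / 2 \<and> \<not> p dvd r \<longrightarrow>
          graph_diameter (proper_virt_gen_graph
            ((nottingham :: 'p mod_ring fps monoid) \<lparr> carrier := ershov_Q1 s r \<rparr>)
            (subtopology nottingham_topology (ershov_Q1 s r))) = 2)"
proof (intro conjI allI impI)
  interpret nottingham_prime p "TYPE('p)"
    by unfold_locales (use assms in auto)
  show "graph_diameter (proper_virt_gen_graph
      (nottingham :: 'p mod_ring fps monoid) nottingham_topology) = 2"
    by (rule diameter_nottingham)
next
  fix s r :: nat
  assume h: "1 \<le> s \<and> 0 < r \<and> real r < real (p ^ s) / 2 \<and> \<not> p dvd r"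
  then have "real (2 * r) < real (p ^ s)" by simp
  then have "2 * r < p ^ s" by (simp only: of_nat_less_iff)
  then interpret ershov s r "TYPE('p)"
    by unfold_locales (use h assms in auto)
  show "graph_diameter (proper_virt_gen_graph
      ((nottingham :: 'p mod_ring fps monoid) \<lparr> carrier := ershov_Q1 s r \<rparr>)
      (subtopology nottingham_topology (ershov_Q1 s r))) = 2"
    by (rule diameter_Q)
qed

end
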